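(* Let $n\ge 3$ and let $\Omega\subseteq\mathbb{R}^n$ be a domain. Let $A$ be uniformly elliptic and bounded in $\Omega$, with ellipticity $\lambda$, and suppose that $b,c\in L^{n,q}(\Omega)$ for some $q\in[1,\infty)$, $d\in L^{\frac n2,\infty}(\Omega)$, with $b-c\in L^{n,1}(\Omega)$ and $d\ge\operatorname{div} b$. Let $G,g$ be the constructed Green's functions described in the context. Suppose that $G^*(x,y)=G^*_y(x)$ is a function such that $G^*_y\in L^1_{\mathrm{loc}}(\Omega)$ for almost every $y\in\Omega$, and such that for all $f\in L_c^\infty(\Omega)$ the function $$v_*^f(y)=\int_\Omega G^*(z,y)f(z)\,dz$$ is a $Y_0^{1,2}(\Omega)$ solution to the equation $-\operatorname{div}(A^t\nabla v_*^f+cv_*^f)+b\nabla v_*^f+dv_*^f=f$ in $\Omega$. Then, for almost every $y\in\Omega$, $G_y^*=G_y$ almost everywhere in $\Omega$. Analogously, suppose that $g^*(y,x)=g^*_x(y)$ is a function such that $g^*_x\in L^1_{\mathrm{loc}}(\Omega)$ for almost every $x\in\Omega$, and such that for all $f\in L_c^\infty(\Omega)$ the function $u_*^f(x)=\int_\Omega g^*(z,x)f(z)\,dz$ is a $Y_0^{1,2}(\Omega)$ solution to the equation $-\operatorname{div}(A\nabla u_*^f+bu_*^f)+c\nabla u_*^f+du_*^f=f$ in $\Omega$. Then, for almost every $x\in\Omega$, $g_x^*=g_x$ almost everywhere in $\Omega$.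
   Context: A domain is an open connected set. $A$ is a measurable $n\times n$ real matrix-valued function on $\Omega$, with transpose $A^t$; it is bounded, and uniformly elliptic with ellipticity $\lambda>0$: $\langle A(x)\xi,\xi\rangle\ge\lambda|\xi|^2$ for all $x\in\Omega,\ \xi\in\mathbb{R}^n$. $b,c$ are vector-valued functions and $d$ is a scalar function. $L^\infty_c(\Omega)$ is the space of bounded compactly supported functions in $\Omega$. Lorentz spaces: $\mu_f(t)=|\{x\in\Omega:|f(x)|>t\}|$, $f^*(s)=\inf\{t>0:\mu_f(t)\le s\}$, $\|f\|_{L^{p,q}(\Omega)}=\left(\int_0^\infty (t^{1/p}f^*(t))^q\frac{dt}{t}\right)^{1/q}$ for $q<\infty$, $\|f\|_{L^{p,\infty}(\Omega)}=\sup_{t>0}t^{1/p}f^*(t)$. $d\ge\operatorname{div}b$ means $\int_\Omega b\nabla\phi+d\phi\ge0$ for all $\phi\in C_c^\infty(\Omega)$ with $\phi\ge0$. $Y_0^{1,2}(\Omega)$ is the closure of $C_c^\infty(\Omega)$ under $\|u\|_{L^{2^*}(\Omega)}+\|\nabla u\|_{L^2(\Omega)}$, $2^*=\frac{2n}{n-2}$. $u$ is a solution to $-\operatorname{div}(A\nabla u+bu)+c\nabla u+du=f$ in $\Omega$ if $\int_\Omega A\nabla u\nabla\phi+b\nabla\phi\cdot u+c\nabla u\cdot\phi+du\phi=\int_\Omega f\phi$ for all $\phi\in C_c^\infty(\Omega)$; the adjoint equation is treated the same way with $A$ replaced by $A^t$ and $b,c$ interchanged. Constructed Green's functions: under the hypotheses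 of the claim there exist nonnegative measurable functions $G,g$ on $\Omega^2$, written $G_y(z)=G(z,y)$, $g_x(z)=g(z,x)$, with: (i) $G_y,g_x\in L^1_{\mathrm{loc}}(\Omega)$ for every $x,y\in\Omega$; (ii) for all $f\in L_c^\infty(\Omega)$, $v^f(y)=\int_\Omega G(z,y)f(z)\,dz$ and $u^f(x)=\int_\Omega g(z,x)f(z)\,dz$ belong to $Y_0^{1,2}(\Omega)$ and solve $-\operatorname{div}(A^t\nabla v^f+cv^f)+b\nabla v^f+dv^f=f$ and $-\operatorname{div}(A\nabla u^f+bu^f)+c\nabla u^f+du^f=f$ in $\Omega$, respectively; (iii) $G_y,g_x$ are bounded in $L^{\frac{n}{n-2},\infty}(\Omega)$ and $\nabla G_y,\nabla g_x$ in $L^{\frac{n}{n-1},\infty}(\Omega)$, uniformly in $x,y\in\Omega$; (iv) there is a constant $C'$ with $G_y(z)\le C'|z-y|^{2-n}$ and $g_x(z)\le C'|z-x|^{2-n}$ for almost every $z\in\Omega$; (v) $G(z,w)=g(w,z)$ for almost every $(z,w)\in\Omega^2$. $G$ and $g$ in the claim denote these functions. *)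

theory Defs
  imports "HOL-Analysis.Analysis"
begin

text \<open>
  The underlying space is \<open>real ^ 'n\<close>, so \<open>n\<close> is \<open>CARD('n)\<close>. Functions on \<open>\<Omega>\<close> are total functions
  whose values outside \<open>\<Omega>\<close> play no role; measure and integral refer to \<open>lebesgue_on \<Omega>\<close>.
\<close>

section \<open>Test functions\<close>

definition grad :: "(real ^ 'n \<Rightarrow> real) \<Rightarrow> real ^ 'n \<Rightarrow> real ^ 'n" where
  "grad \<phi> x = (\<chi> i. frechet_derivative \<phi> (at x) (axis i 1))"

primrec Ck :: "nat \<Rightarrow> (real ^ 'n \<Rightarrow> real) \<Rightarrow> bool" where
  "Ck 0 \<phi> \<longleftrightarrow> continuous_on UNIV \<phi>"
| "Ck (Suc k) \<phi> \<longleftrightarrow> (\<forall>x. \<phi> differentiable (at x)) \<and> (\<forall>i. Ck k (\<lambda>x. grad \<phi> x $ i))"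

text \<open>Elements of \<open>C_c^\<infinity>(\<Omega>)\<close> are identified with their extensions by zero to the whole space.\<close>

definition test_fun :: "(real ^ 'n) set \<Rightarrow> (real ^ 'n \<Rightarrow> real) set" where
  "test_fun \<Omega> = {\<phi>. (\<forall>k. Ck k \<phi>) \<and> compact (closure {x. \<phi> x \<noteq> 0}) \<and> closure {x. \<phi> x \<noteq> 0} \<subseteq> \<Omega>}"

section \<open>Lebesgue and Lorentz spaces\<close>

text \<open>Real power of an extended nonnegative number, for positive exponents.\<close>

definition epowr :: "ennreal \<Rightarrow> real \<Rightarrow> ennreal" where
  "epowr x a = (if x = \<infinity> then \<infinity> else ennreal (enn2real x powr a))"

definition Lp_norm :: "(real ^ 'n) set \<Rightarrow> real \<Rightarrow> (real ^ 'n \<Rightarrow> 'b::real_normed_vector) \<Rightarrow> ennreal" where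
  "Lp_norm \<Omega> p f = epowr (\<integral>\<^sup>+ x. ennreal (norm (f x) powr p) \<partial>lebesgue_on \<Omega>) (1 / p)"

definition L1_loc :: "(real ^ 'n) set \<Rightarrow> (real ^ 'n \<Rightarrow> 'b::euclidean_space) set" where
  "L1_loc \<Omega> = {f. \<forall>K. compact K \<and> K \<subseteq> \<Omega> \<longrightarrow> integrable (lebesgue_on K) f}"

definition Linf_c :: "(real ^ 'n) set \<Rightarrow> (real ^ 'n \<Rightarrow> real) set" where
  "Linf_c \<Omega> = {f. f \<in> borel_measurable (lebesgue_on \<Omega>) \<and> bounded (f ` \<Omega>) \<and>
                 (\<exists>K. compact K \<and> K \<subseteq> \<Omega> \<and> (\<forall>x\<in>\<Omega> - K. f x = 0))}"

definition distr_fun :: "(real ^ 'n) set \<Rightarrow> (real ^ 'n \<Rightarrow> 'b::real_normed_vector) \<Rightarrow> real \<Rightarrow> ennreal" where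
  "distr_fun \<Omega> f t = emeasure (lebesgue_on \<Omega>) {x \<in> \<Omega>. norm (f x) > t}"

text \<open>The infimum is \<open>\<infinity>\<close> when no admissible \<open>t\<close> exists.\<close>

definition rearr :: "(real ^ 'n) set \<Rightarrow> (real ^ 'n \<Rightarrow> 'b::real_normed_vector) \<Rightarrow> real \<Rightarrow> ennreal" where
  "rearr \<Omega> f s = Inf (ennreal ` {t. 0 < t \<and> distr_fun \<Omega> f t \<le> ennreal s})"

definition Lorentz_norm ::
    "(real ^ 'n) set \<Rightarrow> real \<Rightarrow> real \<Rightarrow> (real ^ 'n \<Rightarrow> 'b::real_normed_vector) \<Rightarrow> ennreal" where
  "Lorentz_norm \<Omega> p q f =
     epowr (\<integral>\<^sup>+ t\<in>{0<..}. (epowr (ennreal (t powr (1 / p)) * rearr \<Omega> f t) q * ennreal (1 / t)) \<partial>lborel) (1 / q)"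

definition weak_Lorentz_norm ::
    "(real ^ 'n) set \<Rightarrow> real \<Rightarrow> (real ^ 'n \<Rightarrow> 'b::real_normed_vector) \<Rightarrow> ennreal" where
  "weak_Lorentz_norm \<Omega> p f = (SUP t\<in>{0<..}. ennreal (t powr (1 / p)) * rearr \<Omega> f t)"

definition Lorentz :: "(real ^ 'n) set \<Rightarrow> real \<Rightarrow> real \<Rightarrow> (real ^ 'n \<Rightarrow> 'b::euclidean_space) set" where
  "Lorentz \<Omega> p q = {f. f \<in> borel_measurable (lebesgue_on \<Omega>) \<and> Lorentz_norm \<Omega> p q f < \<infinity>}"

definition weak_Lorentz :: "(real ^ 'n) set \<Rightarrow> real \<Rightarrow> (real ^ 'n \<Rightarrow> 'b::euclidean_space) set" where
  "weak_Lorentz \<Omega> p = {f. f \<in> borel_measurable (lebesgue_on \<Omega>) \<and> weak_Lorentz_norm \<Omega> p f < \<infinity>}"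

section \<open>Weak gradients and the space \<open>Y_0^{1,2}(\<Omega>)\<close>\<close>

definition weak_grad :: "(real ^ 'n) set \<Rightarrow> (real ^ 'n \<Rightarrow> real) \<Rightarrow> (real ^ 'n \<Rightarrow> real ^ 'n) \<Rightarrow> bool" where
  "weak_grad \<Omega> u Du \<longleftrightarrow> u \<in> L1_loc \<Omega> \<and> Du \<in> L1_loc \<Omega> \<and>
     (\<forall>\<phi>\<in>test_fun \<Omega>. (LINT x|lebesgue_on \<Omega>. u x *\<^sub>R grad \<phi> x) = - (LINT x|lebesgue_on \<Omega>. \<phi> x *\<^sub>R Du x))"

definition Y_norm :: "(real ^ 'n) set \<Rightarrow> (real ^ 'n \<Rightarrow> real) \<Rightarrow> (real ^ 'n \<Rightarrow> real ^ 'n) \<Rightarrow> ennreal" where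
  "Y_norm \<Omega> u Du = Lp_norm \<Omega> (2 * real CARD('n) / (real CARD('n) - 2)) u + Lp_norm \<Omega> 2 Du"

text \<open>The closure is taken among the weakly differentiable functions of finite norm.\<close>

definition Y0 :: "(real ^ 'n) set \<Rightarrow> (real ^ 'n \<Rightarrow> real) set" where
  "Y0 \<Omega> = {u. u \<in> borel_measurable (lebesgue_on \<Omega>) \<and>
     (\<exists>Du. Du \<in> borel_measurable (lebesgue_on \<Omega>) \<and> weak_grad \<Omega> u Du \<and> Y_norm \<Omega> u Du < \<infinity> \<and>
        (\<exists>\<phi>. (\<forall>k. \<phi> k \<in> test_fun \<Omega>) \<and>
           (\<lambda>k. Y_norm \<Omega> (\<lambda>x. \<phi> k x - u x) (\<lambda>x. grad (\<phi> k) x - Du x)) \<longlonglongrightarrow> 0))}"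

section \<open>The equation\<close>

text \<open>Since the library integral of a non-integrable function is \<open>0\<close>, convergence of the integrals
  is stated explicitly, here and in \<open>ge_div\<close>.\<close>

definition is_solution ::
    "(real ^ 'n) set \<Rightarrow> (real ^ 'n \<Rightarrow> real ^ 'n ^ 'n) \<Rightarrow> (real ^ 'n \<Rightarrow> real ^ 'n) \<Rightarrow> (real ^ 'n \<Rightarrow> real ^ 'n) \<Rightarrow>
     (real ^ 'n \<Rightarrow> real) \<Rightarrow> (real ^ 'n \<Rightarrow> real) \<Rightarrow> (real ^ 'n \<Rightarrow> real) \<Rightarrow> bool" where
  "is_solution \<Omega> A b c d f u \<longleftrightarrow>
     (\<exists>Du. weak_grad \<Omega> u Du \<and>
        (\<forall>\<phi>\<in>test_fun \<Omega>.
           let F = (\<lambda>x. (A x *v Du x) \<bullet> grad \<phi> x + (b x \<bullet> grad \<phi> x) * u x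
                          + (c x \<bullet> Du x) * \<phi> x + d x * u x * \<phi> x)
           in integrable (lebesgue_on \<Omega>) F \<and> integrable (lebesgue_on \<Omega>) (\<lambda>x. f x * \<phi> x) \<and>
              (LINT x|lebesgue_on \<Omega>. F x) = (LINT x|lebesgue_on \<Omega>. f x * \<phi> x)))"

definition is_adjoint_solution ::
    "(real ^ 'n) set \<Rightarrow> (real ^ 'n \<Rightarrow> real ^ 'n ^ 'n) \<Rightarrow> (real ^ 'n \<Rightarrow> real ^ 'n) \<Rightarrow> (real ^ 'n \<Rightarrow> real ^ 'n) \<Rightarrow>
     (real ^ 'n \<Rightarrow> real) \<Rightarrow> (real ^ 'n \<Rightarrow> real) \<Rightarrow> (real ^ 'n \<Rightarrow> real) \<Rightarrow> bool" where
  "is_adjoint_solution \<Omega> A b c d f v \<longleftrightarrow> is_solution \<Omega> (\<lambda>x. transpose (A x)) c b d f v"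

definition ge_div :: "(real ^ 'n) set \<Rightarrow> (real ^ 'n \<Rightarrow> real) \<Rightarrow> (real ^ 'n \<Rightarrow> real ^ 'n) \<Rightarrow> bool" where
  "ge_div \<Omega> d b \<longleftrightarrow>
     (\<forall>\<phi>\<in>test_fun \<Omega>. (\<forall>x. 0 \<le> \<phi> x) \<longrightarrow>
        integrable (lebesgue_on \<Omega>) (\<lambda>x. b x \<bullet> grad \<phi> x + d x * \<phi> x) \<and>
        0 \<le> (LINT x|lebesgue_on \<Omega>. b x \<bullet> grad \<phi> x + d x * \<phi> x))"

definition uniformly_elliptic :: "(real ^ 'n) set \<Rightarrow> real \<Rightarrow> (real ^ 'n \<Rightarrow> real ^ 'n ^ 'n) \<Rightarrow> bool" where
  "uniformly_elliptic \<Omega> lam A \<longleftrightarrow> 0 < lam \<and> (\<forall>x\<in>\<Omega>. \<forall>\<xi>. (A x *v \<xi>) \<bullet> \<xi> \<ge> lam * (norm \<xi>)\<^sup>2)"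

section \<open>Green's functions\<close>

definition potential :: "(real ^ 'n) set \<Rightarrow> (real ^ 'n \<Rightarrow> real ^ 'n \<Rightarrow> real) \<Rightarrow> (real ^ 'n \<Rightarrow> real) \<Rightarrow> real ^ 'n \<Rightarrow> real" where
  "potential \<Omega> K f y = (LINT z|lebesgue_on \<Omega>. K z y * f z)"

text \<open>The pole is the second argument: \<open>G_y\<close> is \<open>\<lambda>z. G z y\<close> and \<open>g_x\<close> is \<open>\<lambda>z. g z x\<close>.\<close>

definition green_bounds :: "(real ^ 'n) set \<Rightarrow> (real ^ 'n \<Rightarrow> real ^ 'n \<Rightarrow> real) \<Rightarrow> bool" where
  "green_bounds \<Omega> K \<longleftrightarrow>
     (\<lambda>p. K (fst p) (snd p)) \<in> borel_measurable (lebesgue_on (\<Omega> \<times> \<Omega>)) \<and>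
     (\<forall>z\<in>\<Omega>. \<forall>y\<in>\<Omega>. 0 \<le> K z y) \<and>
     (\<forall>y\<in>\<Omega>. (\<lambda>z. K z y) \<in> L1_loc \<Omega>) \<and>
     (\<exists>C::real. \<forall>y\<in>\<Omega>.
        weak_Lorentz_norm \<Omega> (real CARD('n) / (real CARD('n) - 2)) (\<lambda>z. K z y) \<le> ennreal C \<and>
        (\<exists>DK. weak_grad \<Omega> (\<lambda>z. K z y) DK \<and>
           weak_Lorentz_norm \<Omega> (real CARD('n) / (real CARD('n) - 1)) DK \<le> ennreal C)) \<and>
     (\<exists>C'::real. \<forall>y\<in>\<Omega>. AE z in lebesgue_on \<Omega>. K z y \<le> C' * norm (z - y) powr (2 - real CARD('n)))"

definition constructed_green ::
    "(real ^ 'n) set \<Rightarrow> (real ^ 'n \<Rightarrow> real ^ 'n ^ 'n) \<Rightarrow> (real ^ 'n \<Rightarrow> real ^ 'n) \<Rightarrow> (real ^ 'n \<Rightarrow> real ^ 'n) \<Rightarrow>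
     (real ^ 'n \<Rightarrow> real) \<Rightarrow> (real ^ 'n \<Rightarrow> real ^ 'n \<Rightarrow> real) \<Rightarrow> (real ^ 'n \<Rightarrow> real ^ 'n \<Rightarrow> real) \<Rightarrow> bool" where
  "constructed_green \<Omega> A b c d G g \<longleftrightarrow>
     green_bounds \<Omega> G \<and> green_bounds \<Omega> g \<and>
     (\<forall>f\<in>Linf_c \<Omega>.
        potential \<Omega> G f \<in> Y0 \<Omega> \<and> is_adjoint_solution \<Omega> A b c d f (potential \<Omega> G f) \<and>
        potential \<Omega> g f \<in> Y0 \<Omega> \<and> is_solution \<Omega> A b c d f (potential \<Omega> g f)) \<and>
     (AE p in lebesgue_on (\<Omega> \<times> \<Omega>). G (fst p) (snd p) = g (snd p) (fst p))"

end

theory Submission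
  imports Defs
begin

text \<open>
  The proof is by duality. Let \<open>v\<close> and \<open>w\<close> be solutions in \<open>Y_0^{1,2}(\<Omega>)\<close> of the adjoint equation with
  the same right-hand side \<open>f\<close>, and let \<open>h \<in> L_c^\<infinity>(\<Omega>)\<close>. The function \<open>u = u^h\<close> given by the kernel \<open>g\<close>
  solves the original equation with right-hand side \<open>h\<close>. Writing \<open>B\<close> for the bilinear form of the
  original operator, testing the equation of \<open>u\<close> against \<open>v\<close> and that of \<open>v\<close> against \<open>u\<close> gives
  \<open>\<integral> h v = B(u, v) = \<integral> f u\<close>, and likewise for \<open>w\<close> (\<open>solution_duality\<close>). Hence \<open>\<integral> h v = \<integral> h w\<close> for every
  \<open>h\<close>, so \<open>v = w\<close> almost everywhere (\<open>adjoint_solution_unique\<close>): solutions of the adjoint equation are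
  unique because the original equation is solvable.

  Applied to \<open>v_*^f\<close> and \<open>v^f\<close>, this says that for each \<open>f\<close> the kernels \<open>G^*(\<cdot>, y)\<close> and \<open>G(\<cdot>, y)\<close> have the
  same integral against \<open>f\<close> for almost every \<open>y\<close>. Taking for \<open>f\<close> the countably many indicators of
  rational boxes makes the exceptional null set independent of \<open>f\<close>, and a locally integrable
  function with vanishing integrals over all these boxes is zero almost everywhere
  (\<open>AE_zero_if_box_integrals_zero\<close>, \<open>kernel_unique\<close>).
  The claim for \<open>g\<close> is the same statement for the coefficients \<open>A\<^sup>t, c, b, d\<close>.

  The equations are given only against test functions, and the analytic work lies in extending
  them to \<open>Y_0^{1,2}(\<Omega>)\<close> (\<open>solution_tested_against_Y0\<close>). For this the lower order terms of \<open>B\<close> have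
  to be continuous in the gradient norm. The exponent \<open>q\<close> may exceed \<open>n\<close>, so that \<open>|b|\<^sup>2\<close> and \<open>|c|\<^sup>2\<close> are,
  like \<open>d\<close>, controlled only in weak \<open>L^{n/2}\<close>, and the embedding of \<open>Y_0^{1,2}\<close> into \<open>L^{2^*}\<close> together with
  Hoelder's inequality does not suffice. What is used is
  \<open>\<integral> V \<phi>\<^sup>2 \<le> C \<integral> |\<nabla>\<phi>|\<^sup>2\<close> for every weight \<open>V\<close> in weak \<open>L^{n/2}\<close> (\<open>weak_type_Hardy_inequality\<close>). It
  amounts to the Sobolev embedding into the Lorentz space \<open>L^{2^*,2}\<close> and is proved by comparing
  the measures \<open>m(s)\<close> of the sets \<open>{|\<phi>| \<ge> s}\<close> and \<open>m(2s)\<close>: for \<open>v = \<phi>\<^sup>2 / (s\<^sup>2 + \<phi>\<^sup>2)\<close>, averaging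
  \<open>\<integral> |v(x + h) - v(x)|\<^sup>2 dx \<le> |h|\<^sup>2 \<integral> |\<nabla>v|\<^sup>2\<close> over a ball of measure \<open>2 m(s)\<close> bounds \<open>m(2s)\<close> by
  \<open>C m(s)^{2/n} \<integral> |\<nabla>v|\<^sup>2\<close>. This makes \<open>s\<^sup>2 m(s)^{1 - 2/n}\<close> summable over dyadic \<open>s\<close>, because the energies
  \<open>s\<^sup>2 \<integral> |\<nabla>v|\<^sup>2\<close> telescope.

  Finally, the equation and the membership in \<open>Y_0^{1,2}(\<Omega>)\<close> each provide a weak gradient of their own;
  these agree by the fundamental lemma of the calculus of variations (\<open>weak_grad_unique\<close>).
\<close>

section \<open>Functions with vanishing integrals over boxes\<close>

text \<open>
  A family of boxes that is countable, closed under intersection and generates the Borel sets: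
  countability lets one null set serve all boxes, the other two properties feed a Dynkin argument.
\<close>

definition rat_boxes :: "'a::euclidean_space set set" where
  "rat_boxes = {box a b |a b. \<forall>i\<in>Basis. a \<bullet> i \<in> \<rat> \<and> b \<bullet> i \<in> \<rat>}"

lemma countable_rat_boxes: "countable (rat_boxes :: 'a::euclidean_space set set)"
proof -
  let ?v = "\<lambda>f::'a \<Rightarrow> real. \<Sum>i\<in>Basis. f i *\<^sub>R i"
  have c: "countable (Basis \<rightarrow>\<^sub>E \<rat> :: ('a \<Rightarrow> real) set)"
    by (intro countable_PiE countable_rat) auto
  have "rat_boxes \<subseteq> (\<lambda>(f, g). box (?v f) (?v g)) ` ((Basis \<rightarrow>\<^sub>E \<rat>) \<times> (Basis \<rightarrow>\<^sub>E \<rat>))"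
  proof
    fix B :: "'a set" assume "B \<in> rat_boxes"
    then obtain a b where B: "B = box a b" "\<forall>i\<in>Basis. a \<bullet> i \<in> \<rat> \<and> b \<bullet> i \<in> \<rat>"
      by (auto simp: rat_boxes_def)
    define f g where "f = restrict (\<lambda>i. a \<bullet> i) Basis" and "g = restrict (\<lambda>i. b \<bullet> i) Basis"
    have "?v f = a" "?v g = b"
      by (auto simp: f_def g_def euclidean_representation)
    moreover have "f \<in> Basis \<rightarrow>\<^sub>E \<rat>" "g \<in> Basis \<rightarrow>\<^sub>E \<rat>"
      using B by (auto simp: f_def g_def)
    ultimately show "B \<in> (\<lambda>(f, g). box (?v f) (?v g)) ` ((Basis \<rightarrow>\<^sub>E \<rat>) \<times> (Basis \<rightarrow>\<^sub>E \<rat>))"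
      using B by (intro image_eqI[of _ _ "(f, g)"]) auto
  qed
  then show ?thesis
    by (rule countable_subset) (intro countable_image countable_SIGMA c)
qed

lemma Int_stable_rat_boxes: "Int_stable (rat_boxes :: 'a::euclidean_space set set)"
proof (rule Int_stableI)
  fix A B :: "'a set" assume "A \<in> rat_boxes" "B \<in> rat_boxes"
  then obtain a b c d where "A = box a b" "B = box c d"
    and r: "\<forall>i\<in>Basis. a \<bullet> i \<in> \<rat> \<and> b \<bullet> i \<in> \<rat>" "\<forall>i\<in>Basis. c \<bullet> i \<in> \<rat> \<and> d \<bullet> i \<in> \<rat>"
    by (auto simp: rat_boxes_def)
  then show "A \<inter> B \<in> rat_boxes"
    unfolding rat_boxes_def
    by (auto simp: box_Int_box max_def min_def intro!: exI)
qed

lemma topological_basis_rat_boxes: "topological_basis (rat_boxes :: 'a::euclidean_space set set)"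
proof (rule topological_basisI)
  fix U :: "'a set" and x assume "open U" "x \<in> U"
  then obtain e where "e > 0" "ball x e \<subseteq> U" by (auto simp: open_contains_ball)
  with rational_boxes[OF \<open>e > 0\<close>, of x] show "\<exists>B\<in>rat_boxes. x \<in> B \<and> B \<subseteq> U"
    unfolding rat_boxes_def by blast
qed (auto simp: rat_boxes_def)

lemma borel_eq_rat_boxes: "sets (borel :: 'a::euclidean_space measure) = sigma_sets UNIV rat_boxes"
  using borel_eq_countable_basis[OF countable_rat_boxes topological_basis_rat_boxes]
  by (metis sets_measure_of Pow_UNIV subset_UNIV)

text \<open>
  The sets over which \<open>h\<close> integrates to zero form a Dynkin system; the total integral is needed
  for complements.
\<close>

lemma AE_zero_if_rat_box_integrals_zero:
  fixes h :: "'a::euclidean_space \<Rightarrow> real"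
  assumes h: "integrable lborel h" and h0: "(LINT x|lborel. h x) = 0"
    and B: "\<And>B. B \<in> rat_boxes \<Longrightarrow> (LINT x|lborel. indicator B x * h x) = 0"
  shows "AE x in lborel. h x = 0"
proof -
  have si: "set_integrable lborel S h" if "S \<in> sets borel" for S
    unfolding set_integrable_def using integrable_mult_indicator[OF _ h, of S] that by simp
  have A: "(LINT x:A|lborel. h x) = 0" if "A \<in> sets borel" for A
  proof -
    have "rat_boxes \<subseteq> Pow (UNIV :: 'a set)" "A \<in> sigma_sets UNIV rat_boxes"
      using that by (auto simp: borel_eq_rat_boxes)
    with Int_stable_rat_boxes show ?thesis
    proof (induction rule: sigma_sets_induct_disjoint)
      case (basic A) then show ?case using B by (simp add: set_lebesgue_integral_def)
    next
      case empty then show ?case by (simp add: set_lebesgue_integral_def)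
    next
      case (compl A)
      then have [measurable]: "A \<in> sets borel" by (simp add: borel_eq_rat_boxes)
      have "(LINT x:A \<union> (UNIV - A)|lborel. h x) = (LINT x:A|lborel. h x) + (LINT x:UNIV - A|lborel. h x)"
        by (intro set_integral_Un si) auto
      with compl h0 show ?case by (simp add: set_lebesgue_integral_def)
    next
      case (union A)
      then have [measurable]: "A i \<in> sets borel" for i
        by (auto simp: borel_eq_rat_boxes)
      have "(LINT x:(\<Union>i. A i)|lborel. h x) = (\<Sum>i. LINT x:A i|lborel. h x)"
      proof (rule lebesgue_integral_countable_add)
        show "set_integrable lborel (\<Union>i. A i) h"
          by (intro si) auto
      qed (use union in \<open>auto simp: disjoint_family_on_def\<close>)
      with union show ?case by simp
    qed
  qed
  have "AE x in lborel. h x = (\<lambda>_. 0) x"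
    by (rule density_unique_real) (use h A in \<open>auto simp: set_lebesgue_integral_def\<close>)
  then show ?thesis by simp
qed

text \<open>
  Localisation of the previous lemma: for a box \<open>Q\<close> with closure in \<open>\<Omega>\<close>, the function \<open>f\<close> cut off to
  \<open>Q\<close> is integrable, and its integrals over boxes \<open>B\<close> are those of \<open>f\<close> over the boxes \<open>Q \<inter> B\<close>. The
  function \<open>h\<close> in the proof is a Borel version of the cut-off.
\<close>

lemma AE_zero_if_box_integrals_zero:
  fixes f :: "real ^ 'n \<Rightarrow> real"
  assumes \<Omega>: "open \<Omega>" and f: "f \<in> L1_loc \<Omega>"
    and z: "\<And>B. B \<in> rat_boxes \<Longrightarrow> closure B \<subseteq> \<Omega> \<Longrightarrow> (LINT x|lebesgue_on \<Omega>. f x * indicator B x) = 0"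
  shows "AE x in lebesgue_on \<Omega>. f x = 0"
proof -
  have \<Omega>m [measurable]: "\<Omega> \<in> sets lebesgue" using \<Omega> by simp
  let ?F = "{B \<in> rat_boxes. closure B \<subseteq> \<Omega>}"
  have loc: "AE x in lebesgue. x \<in> Q \<longrightarrow> f x = 0" if Q: "Q \<in> ?F" for Q
  proof -
    have "bounded Q" "open Q" using Q by (auto simp: rat_boxes_def bounded_box)
    then have "compact (closure Q)" by simp
    then have "integrable (lebesgue_on (closure Q)) f" using f Q by (auto simp: L1_loc_def)
    then have ic: "integrable lebesgue (\<lambda>x. indicator (closure Q) x *\<^sub>R f x)"
      by (subst (asm) integrable_restrict_space) auto
    have "integrable lebesgue (\<lambda>x. indicator Q x *\<^sub>R (indicator (closure Q) x *\<^sub>R f x))"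
      by (rule integrable_mult_indicator[OF _ ic]) (use \<open>open Q\<close> in auto)
    also have "(\<lambda>x. indicator Q x *\<^sub>R (indicator (closure Q) x *\<^sub>R f x)) = (\<lambda>x. indicator Q x * f x)"
      using closure_subset[of Q] by (auto simp: fun_eq_iff indicator_def)
    finally have i: "integrable lebesgue (\<lambda>x. indicator Q x * f x)" .
    then have fm: "(\<lambda>x. indicator Q x * f x) \<in> borel_measurable lebesgue" by auto
    note fm [measurable]
    from completion_ex_borel_measurable_real[OF fm]
    obtain h where h: "h \<in> borel_measurable lborel" and ae: "AE x in lborel. indicator Q x * f x = h x"
      by metis
    have ae': "AE x in lebesgue. indicator Q x * f x = h x"
      using ae by (rule AE_completion)
    have hl [measurable]: "h \<in> borel_measurable lebesgue" using h by (rule measurable_completion)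
    have "integrable lebesgue h"
      using i ae' by (subst integrable_cong_AE[where g="\<lambda>x. indicator Q x * f x"]) (use hl in auto)
    then have ih: "integrable lborel h" using integrable_completion[OF h] by simp
    have box: "(LINT x|lborel. indicator B x * h x) = 0" if "B = UNIV \<or> B \<in> rat_boxes" for B
    proof -
      have BQ: "Q \<inter> B \<in> rat_boxes" using that Q Int_stable_rat_boxes by (auto simp: Int_stable_def)
      have "open B" using that by (auto simp: rat_boxes_def)
      then have [measurable]: "B \<in> sets lebesgue" by simp
      have "closure (Q \<inter> B) \<subseteq> \<Omega>" using Q closure_mono[of "Q \<inter> B" Q] by auto
      have "(LINT x|lborel. indicator B x * h x) = (LINT x|lebesgue. indicator B x * h x)"
        using \<open>open B\<close> h by (subst integral_completion) (auto intro!: borel_measurable_times)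
      also have "\<dots> = (LINT x|lebesgue. indicator B x * (indicator Q x * f x))"
        using ae' by (intro integral_cong_AE) auto
      also have "\<dots> = (LINT x|lebesgue. indicator \<Omega> x *\<^sub>R (f x * indicator (Q \<inter> B) x))"
        using Q closure_subset[of Q] by (intro Bochner_Integration.integral_cong) (auto simp: indicator_def)
      also have "\<dots> = (LINT x|lebesgue_on \<Omega>. f x * indicator (Q \<inter> B) x)"
        by (subst integral_restrict_space) auto
      also have "\<dots> = 0" by (rule z) fact+
      finally show ?thesis .
    qed
    have "AE x in lborel. h x = 0"
      using box[of UNIV] by (intro AE_zero_if_rat_box_integrals_zero ih box) auto
    from AE_completion[OF this] ae' show ?thesis
      by eventually_elim (auto simp: indicator_def)
  qed
  have "countable ?F" using countable_rat_boxes by (rule countable_subset[rotated]) auto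
  then have "AE x in lebesgue. \<forall>Q\<in>?F. x \<in> Q \<longrightarrow> f x = 0"
    using loc by (subst AE_ball_countable) auto
  moreover have "\<exists>Q\<in>?F. x \<in> Q" if "x \<in> \<Omega>" for x
  proof -
    obtain e where "e > 0" "cball x e \<subseteq> \<Omega>" using \<Omega> \<open>x \<in> \<Omega>\<close> by (auto simp: open_contains_cball)
    then obtain Q where "Q \<in> rat_boxes" "x \<in> Q" "Q \<subseteq> ball x e"
      using topological_basisE[OF topological_basis_rat_boxes, of "ball x e" x] by auto
    moreover have "closure Q \<subseteq> cball x e"
      using \<open>Q \<subseteq> ball x e\<close> ball_subset_cball[of x e] by (intro closure_minimal) auto
    ultimately show ?thesis using \<open>cball x e \<subseteq> \<Omega>\<close> by blast
  qed
  ultimately show ?thesis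
    by (subst AE_restrict_space_iff) (auto elim!: eventually_mono)
qed

section \<open>Smooth functions with support in a box\<close>

text \<open>
  Needed for products, whose derivatives involve the factors themselves.
\<close>

lemma Ck_SucD: "Ck (Suc k) \<phi> \<Longrightarrow> Ck k \<phi>"
proof (induction k arbitrary: \<phi>)
  case 0
  then have "\<And>x. isCont \<phi> x" by (auto intro: differentiable_imp_continuous_within)
  then show ?case by (auto simp: continuous_at_imp_continuous_on)
next
  case (Suc k)
  have "\<forall>x. \<phi> differentiable (at x)" "\<And>i. Ck (Suc k) (\<lambda>x. grad \<phi> x $ i)"
    using Suc.prems unfolding Ck.simps(2)[of "Suc k"] by auto
  with Suc.IH show ?case by (simp only: Ck.simps(2)) auto
qed

lemma grad_nth_eqI:
  assumes "(\<phi> has_derivative \<phi>') (at x)"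
  shows "grad \<phi> x $ i = \<phi>' (axis i 1)"
  using frechet_derivative_at[OF assms] by (simp add: grad_def)

lemma grad_inner_eq_derivative:
  assumes "\<phi> differentiable (at x)"
  shows "frechet_derivative \<phi> (at x) h = grad \<phi> x \<bullet> h"
proof -
  from assms have d: "(\<phi> has_derivative frechet_derivative \<phi> (at x)) (at x)"
    by (simp add: frechet_derivative_works)
  then have l: "linear (frechet_derivative \<phi> (at x))"
    by (rule has_derivative_linear)
  have "h = (\<Sum>i\<in>UNIV. (h $ i) *\<^sub>R axis i 1)"
    by (simp add: vec_eq_iff axis_def if_distrib cong: if_cong)
  then have "frechet_derivative \<phi> (at x) h = frechet_derivative \<phi> (at x) (\<Sum>i\<in>UNIV. (h $ i) *\<^sub>R axis i 1)"
    by simp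
  also have "\<dots> = (\<Sum>i\<in>UNIV. h $ i * frechet_derivative \<phi> (at x) (axis i 1))"
    by (simp add: linear_sum[OF l] linear_scale[OF l] o_def)
  also have "\<dots> = grad \<phi> x \<bullet> h"
    by (simp add: inner_vec_def grad_def mult.commute)
  finally show ?thesis .
qed

lemma grad_diff:
  assumes "\<phi> differentiable (at x)" "\<psi> differentiable (at x)"
  shows "grad (\<lambda>x. \<phi> x - \<psi> x) x = grad \<phi> x - grad \<psi> x"
proof -
  have "((\<lambda>x. \<phi> x - \<psi> x) has_derivative (\<lambda>h. frechet_derivative \<phi> (at x) h - frechet_derivative \<psi> (at x) h)) (at x)"
    using assms by (intro has_derivative_diff) (simp_all add: frechet_derivative_works)
  from grad_nth_eqI[OF this] show ?thesis by (simp add: vec_eq_iff) (simp add: grad_def)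
qed

lemma grad_add:
  assumes "\<phi> differentiable (at x)" "\<psi> differentiable (at x)"
  shows "grad (\<lambda>x. \<phi> x + \<psi> x) x = grad \<phi> x + grad \<psi> x"
proof -
  have "((\<lambda>x. \<phi> x + \<psi> x) has_derivative (\<lambda>h. frechet_derivative \<phi> (at x) h + frechet_derivative \<psi> (at x) h)) (at x)"
    using assms by (intro has_derivative_add) (simp_all add: frechet_derivative_works)
  from grad_nth_eqI[OF this] show ?thesis by (simp add: vec_eq_iff) (simp add: grad_def)
qed

lemma grad_mult:
  assumes "\<phi> differentiable (at x)" "\<psi> differentiable (at x)"
  shows "grad (\<lambda>x. \<phi> x * \<psi> x) x = \<phi> x *\<^sub>R grad \<psi> x + \<psi> x *\<^sub>R grad \<phi> x"
proof -
  have "((\<lambda>x. \<phi> x * \<psi> x) has_derivative (\<lambda>h. \<phi> x * frechet_derivative \<psi> (at x) h + frechet_derivative \<phi> (at x) h * \<psi> x)) (at x)"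
    using assms by (intro has_derivative_mult) (simp_all add: frechet_derivative_works)
  from grad_nth_eqI[OF this] show ?thesis by (simp add: vec_eq_iff) (simp add: grad_def)
qed

lemma grad_const [simp]: "grad (\<lambda>x. c) x = 0"
  by (simp add: grad_def vec_eq_iff)

lemma Ck_const: "Ck k (\<lambda>x. c)"
  by (induction k arbitrary: c) (auto simp: continuous_on_const)

lemma Ck_diff: "Ck k \<phi> \<Longrightarrow> Ck k \<psi> \<Longrightarrow> Ck k (\<lambda>x. \<phi> x - \<psi> x)"
proof (induction k arbitrary: \<phi> \<psi>)
  case 0 then show ?case by (auto intro: continuous_on_diff)
next
  case (Suc k) then show ?case by (auto simp: grad_diff intro: differentiable_diff)
qed

lemma Ck_add: "Ck k \<phi> \<Longrightarrow> Ck k \<psi> \<Longrightarrow> Ck k (\<lambda>x. \<phi> x + \<psi> x)"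
proof (induction k arbitrary: \<phi> \<psi>)
  case 0 then show ?case by (auto intro: continuous_on_add)
next
  case (Suc k) then show ?case by (auto simp: grad_add intro: differentiable_add)
qed

lemma Ck_mult: "Ck k \<phi> \<Longrightarrow> Ck k \<psi> \<Longrightarrow> Ck k (\<lambda>x. \<phi> x * \<psi> x)"
proof (induction k arbitrary: \<phi> \<psi>)
  case 0 then show ?case by (auto intro: continuous_on_mult)
next
  case (Suc k)
  have "Ck k \<phi>" "Ck k \<psi>" using Suc.prems by (auto intro: Ck_SucD simp del: Ck.simps)
  with Suc show ?case by (auto simp: grad_mult intro!: differentiable_mult Ck_add)
qed

lemma Ck_prod: "(\<And>i. i \<in> I \<Longrightarrow> Ck k (\<phi> i)) \<Longrightarrow> Ck k (\<lambda>x. \<Prod>i\<in>I. \<phi> i x)"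
  by (induction I rule: infinite_finite_induct) (auto simp: Ck_const intro!: Ck_mult)

text \<open>
  The functions \<open>t^{-k} e^{-1/t}\<close>, extended by zero to \<open>t \<le> 0\<close>. The span of all of them is closed
  under differentiation, so smoothness of \<open>e^{-1/t}\<close> becomes an induction over this family.
\<close>

definition flat :: "nat \<Rightarrow> real \<Rightarrow> real" where
  "flat k t = (if t \<le> 0 then 0 else inverse t ^ k * exp (- inverse t))"

lemma flat_tendsto_0: "(flat k \<longlongrightarrow> 0) (at 0)"
proof -
  have "((\<lambda>x::real. x ^ k / exp x) \<longlongrightarrow> 0) at_top" by (rule tendsto_power_div_exp_0)
  from filterlim_compose[OF this filterlim_inverse_at_top_right]
  have "((\<lambda>t::real. inverse t ^ k / exp (inverse t)) \<longlongrightarrow> 0) (at_right 0)" .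
  then have r: "(flat k \<longlongrightarrow> 0) (at_right 0)"
    by (rule Lim_transform_eventually)
      (auto simp: flat_def exp_minus divide_inverse eventually_at_right_field intro!: exI[of _ 1])
  have l: "(flat k \<longlongrightarrow> 0) (at_left 0)"
    by (rule Lim_transform_eventually[OF tendsto_const])
      (auto simp: flat_def eventually_at_left_field intro!: exI[of _ "-1"])
  from l r show ?thesis by (simp add: filterlim_split_at)
qed

lemma has_real_derivative_flat:
  "(flat k has_real_derivative flat (k + 2) t - real k * flat (k + 1) t) (at t)"
proof -
  consider "t < 0" | "t = 0" | "t > 0" by linarith
  then show ?thesis
  proof cases
    case 1
    have "((\<lambda>t. 0) has_real_derivative 0) (at t)" by simp
    then have "(flat k has_real_derivative 0) (at t)"
      by (rule has_field_derivative_transform_within_open[of _ _ _ "{..<0}"]) (use 1 in \<open>auto simp: flat_def\<close>)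
    with 1 show ?thesis by (simp add: flat_def)
  next
    case 2
    have "((\<lambda>h. flat k h / h) \<longlongrightarrow> 0) (at 0)"
      by (rule Lim_transform_eventually[OF flat_tendsto_0[of "k + 1"]])
        (auto simp: flat_def field_simps eventually_at_filter)
    then show ?thesis using 2 by (simp add: has_field_derivative_iff flat_def)
  next
    case 3
    have "((\<lambda>t. inverse t ^ k * exp (- inverse t)) has_real_derivative
        real k * inverse t ^ (k - 1) * (- (inverse t)\<^sup>2) * exp (- inverse t)
          + inverse t ^ k * (exp (- inverse t) * (inverse t)\<^sup>2)) (at t)"
      using 3 by (auto intro!: derivative_eq_intros simp: power2_eq_square)
    moreover have "real k * inverse t ^ (k - 1) * (- (inverse t)\<^sup>2) * exp (- inverse t)
          + inverse t ^ k * (exp (- inverse t) * (inverse t)\<^sup>2) = flat (k + 2) t - real k * flat (k + 1) t"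
      using 3 by (cases k) (auto simp: flat_def power2_eq_square algebra_simps)
    ultimately have "((\<lambda>t. inverse t ^ k * exp (- inverse t)) has_real_derivative flat (k + 2) t - real k * flat (k + 1) t) (at t)"
      by simp
    then show ?thesis
      by (rule has_field_derivative_transform_within_open[of _ _ _ "{0<..}"]) (use 3 in \<open>auto simp: flat_def\<close>)
  qed
qed

lemma Ck_flat_coord: "Ck k (\<lambda>x::real^'n. flat j (m * x $ i + c))"
proof (induction k arbitrary: j)
  case 0
  have "isCont (flat j) t" for t
    using has_real_derivative_flat by (rule DERIV_isCont)
  then have "continuous_on UNIV (flat j)" by (simp add: continuous_at_imp_continuous_on)
  then show ?case
    by (auto intro!: continuous_on_compose2[of UNIV "flat j"] continuous_intros)
next
  case (Suc k)
  let ?d = "\<lambda>x. flat (j + 2) (m * x $ i + c) - real j * flat (j + 1) (m * x $ i + c)"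
  have d: "((\<lambda>x::real^'n. flat j (m * x $ i + c)) has_derivative (\<lambda>h. ?d x * (m * h $ i))) (at x)" for x
  proof -
    have "((\<lambda>x::real^'n. m * x $ i + c) has_derivative (\<lambda>h. m * h $ i)) (at x)"
      by (auto intro!: derivative_eq_intros bounded_linear_imp_has_derivative bounded_linear_vec_nth)
    from DERIV_compose_FDERIV[OF has_real_derivative_flat this] show ?thesis
      by (simp add: mult.commute)
  qed
  have "(\<lambda>x. grad (\<lambda>x::real^'n. flat j (m * x $ i + c)) x $ l) = (\<lambda>x. ?d x * (m * axis l 1 $ i))" for l
    using grad_nth_eqI[OF d] by auto
  moreover have "Ck k (\<lambda>x::real^'n. ?d x * (m * axis l 1 $ i))" for l
    by (intro Ck_mult Ck_diff Ck_const Suc)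
  ultimately show ?case
    using d by (auto simp: differentiable_def)
qed

text \<open>
  The parameter \<open>m\<close> replaces taking roots: \<open>e^{-1/(m t)}\<close> is the \<open>m\<close>-th root of \<open>e^{-1/t}\<close>, so
  the bumps increase to the indicator of the box as \<open>m\<close> grows.
\<close>

definition box_bump :: "real^'n \<Rightarrow> real^'n \<Rightarrow> real \<Rightarrow> real^'n \<Rightarrow> real" where
  "box_bump a b m x = (\<Prod>i\<in>UNIV. flat 0 (m * (x $ i - a $ i)) * flat 0 (m * (b $ i - x $ i)))"

lemma Ck_box_bump: "Ck k (box_bump a b m)"
proof -
  have "Ck k (\<lambda>x. \<Prod>i\<in>UNIV. flat 0 (m * x $ i + (- m * a $ i)) * flat 0 ((- m) * x $ i + m * b $ i))"
    by (intro Ck_prod Ck_mult Ck_flat_coord)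
  also have "(\<lambda>x. \<Prod>i\<in>UNIV. flat 0 (m * x $ i + (- m * a $ i)) * flat 0 ((- m) * x $ i + m * b $ i)) = box_bump a b m"
    by (auto simp: box_bump_def fun_eq_iff algebra_simps)
  finally show ?thesis .
qed

lemma box_bump_outside: "0 < m \<Longrightarrow> x \<notin> box a b \<Longrightarrow> box_bump a b m x = 0"
  by (auto simp: box_bump_def mem_box_cart flat_def not_less mult_le_0_iff zero_le_mult_iff prod_zero_iff)

lemma box_bump_test_fun:
  assumes "0 < m" "closure (box a b) \<subseteq> \<Omega>"
  shows "box_bump a b m \<in> test_fun \<Omega>"
proof -
  have "{x. box_bump a b m x \<noteq> 0} \<subseteq> box a b" using box_bump_outside[OF assms(1)] by blast
  then have *: "closure {x. box_bump a b m x \<noteq> 0} \<subseteq> closure (box a b)" by (rule closure_mono)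
  moreover have "bounded {x. box_bump a b m x \<noteq> 0}"
    using \<open>{x. box_bump a b m x \<noteq> 0} \<subseteq> box a b\<close> bounded_subset[OF bounded_box] by blast
  ultimately show ?thesis
    using assms unfolding test_fun_def by (auto simp: Ck_box_bump)
qed

lemma flat_0_bounds: "0 \<le> flat 0 t" "flat 0 t \<le> 1"
  by (auto simp: flat_def)

lemma box_bump_bounds: "\<bar>box_bump a b m x\<bar> \<le> 1"
proof -
  have "0 \<le> box_bump a b m x" unfolding box_bump_def by (intro prod_nonneg) (auto simp: flat_0_bounds)
  moreover have "box_bump a b m x \<le> 1" unfolding box_bump_def
    by (intro prod_le_1) (auto simp: flat_0_bounds intro!: mult_le_one)
  ultimately show ?thesis by simp
qed

lemma box_bump_tendsto: "(\<lambda>m. box_bump a b (real (Suc m)) x) \<longlonglongrightarrow> indicator (box a b) x"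
proof (cases "x \<in> box a b")
  case True
  have "(\<lambda>m. flat 0 (real (Suc m) * s)) \<longlonglongrightarrow> 1" if "0 < s" for s
  proof -
    have "(\<lambda>m. exp (- (inverse (real (Suc m)) * inverse s))) \<longlonglongrightarrow> exp (- (0 * inverse s))"
      by (intro tendsto_intros LIMSEQ_inverse_real_of_nat)
    moreover have "flat 0 (real (Suc m) * s) = exp (- (inverse (real (Suc m)) * inverse s))" for m
      using that by (simp add: flat_def mult_le_0_iff del: of_nat_Suc)
    ultimately show ?thesis by simp
  qed
  then have "(\<lambda>m. box_bump a b (real (Suc m)) x) \<longlonglongrightarrow> (\<Prod>i\<in>(UNIV::'a set). 1 * 1)"
    unfolding box_bump_def using True by (intro tendsto_prod tendsto_mult) (auto simp: mem_box_cart)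
  then show ?thesis using True by simp
next
  case False
  then show ?thesis by (simp add: box_bump_outside)
qed

section \<open>Uniqueness of weak gradients\<close>

lemma L1_loc_integrable_indicator:
  fixes f :: "real ^ 'n \<Rightarrow> 'b::euclidean_space"
  assumes "f \<in> L1_loc \<Omega>" "compact K" "K \<subseteq> \<Omega>" "open \<Omega>"
  shows "integrable (lebesgue_on \<Omega>) (\<lambda>x. indicator K x *\<^sub>R f x)"
proof -
  have K: "K \<in> sets lebesgue" using \<open>compact K\<close> by (simp add: borel_compact)
  have "integrable (lebesgue_on K) f" using assms by (auto simp: L1_loc_def)
  then have "integrable lebesgue (\<lambda>x. indicator K x *\<^sub>R f x)"
    using K by (subst (asm) integrable_restrict_space) auto
  also have "(\<lambda>x. indicator K x *\<^sub>R f x) = (\<lambda>x. indicator \<Omega> x *\<^sub>R (indicator K x *\<^sub>R f x))"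
    using \<open>K \<subseteq> \<Omega>\<close> by (auto simp: indicator_def fun_eq_iff)
  finally show ?thesis
    using \<open>open \<Omega>\<close> by (subst integrable_restrict_space) auto
qed

lemma test_funD:
  assumes "\<phi> \<in> test_fun \<Omega>"
  shows "continuous_on UNIV \<phi>" "\<phi> differentiable (at x)" "continuous_on UNIV (grad \<phi>)"
    "compact (closure {x. \<phi> x \<noteq> 0})" "closure {x. \<phi> x \<noteq> 0} \<subseteq> \<Omega>"
proof -
  have Ck: "Ck 0 \<phi>" "Ck (Suc 0) \<phi>" using assms by (auto simp: test_fun_def simp del: Ck.simps)
  show "continuous_on UNIV \<phi>" "\<phi> differentiable (at x)" using Ck by auto
  have "continuous_on UNIV (\<lambda>x. \<chi> i. grad \<phi> x $ i)"
    using Ck(2) by (intro continuous_on_vec_lambda) auto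
  then show "continuous_on UNIV (grad \<phi>)" by simp
  show "compact (closure {x. \<phi> x \<noteq> 0})" "closure {x. \<phi> x \<noteq> 0} \<subseteq> \<Omega>"
    using assms by (auto simp: test_fun_def)
qed

lemma measurable_lebesgue_on_continuous:
  fixes f :: "'a::euclidean_space \<Rightarrow> 'b::euclidean_space"
  assumes "continuous_on UNIV f"
  shows "f \<in> borel_measurable (lebesgue_on S)"
proof -
  have "f \<in> borel_measurable borel" using assms by (rule borel_measurable_continuous_onI)
  then have "f \<in> borel_measurable lebesgue" by (simp add: measurable_completion)
  then show ?thesis by (rule measurable_restrict_space1)
qed

lemma test_fun_mult_integrable:
  fixes f :: "real ^ 'n \<Rightarrow> 'b::euclidean_space"
  assumes f: "f \<in> L1_loc \<Omega>" and \<Omega>: "open \<Omega>" and \<phi>: "\<phi> \<in> test_fun \<Omega>"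
  shows "integrable (lebesgue_on \<Omega>) (\<lambda>x. \<phi> x *\<^sub>R f x)"
proof -
  let ?K = "closure {x. \<phi> x \<noteq> 0}"
  note \<phi>' = test_funD[OF \<phi>]
  have "compact (\<phi> ` ?K)"
    by (intro compact_continuous_image continuous_on_subset[OF \<phi>'(1)] \<phi>') auto
  then obtain B where B: "\<And>x. x \<in> ?K \<Longrightarrow> norm (\<phi> x) \<le> B"
    using compact_imp_bounded[of "\<phi> ` ?K"] by (auto simp: bounded_iff)
  have i: "integrable (lebesgue_on \<Omega>) (\<lambda>x. B *\<^sub>R (indicator ?K x *\<^sub>R f x))"
    by (intro integrable_scaleR_right L1_loc_integrable_indicator f \<phi>' \<Omega>)
  have eq: "\<phi> x *\<^sub>R f x = \<phi> x *\<^sub>R (indicator ?K x *\<^sub>R f x)" for x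
    using closure_subset[of "{x. \<phi> x \<noteq> 0}"] by (auto simp: indicator_def)
  show ?thesis
  proof (rule Bochner_Integration.integrable_bound[OF i])
    show "(\<lambda>x. \<phi> x *\<^sub>R f x) \<in> borel_measurable (lebesgue_on \<Omega>)"
      unfolding eq
      by (rule borel_measurable_scaleR[OF measurable_lebesgue_on_continuous[OF \<phi>'(1)]
            borel_measurable_integrable[OF L1_loc_integrable_indicator[OF f \<phi>'(4,5) \<Omega>]]])
    show "AE x in lebesgue_on \<Omega>. norm (\<phi> x *\<^sub>R f x) \<le> norm (B *\<^sub>R (indicator ?K x *\<^sub>R f x))"
    proof (rule AE_I2)
      fix x
      show "norm (\<phi> x *\<^sub>R f x) \<le> norm (B *\<^sub>R (indicator ?K x *\<^sub>R f x))"
      proof (cases "x \<in> ?K")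
        case True
        then show ?thesis using B[OF True] by (auto intro!: mult_right_mono)
      next
        case False
        then show ?thesis by (subst eq) simp
      qed
    qed
  qed
qed

text \<open>
  Bumps converging boundedly to the indicator of a box reduce this to vanishing integrals over boxes.
\<close>

lemma fundamental_lemma_calculus_of_variations:
  fixes f :: "real ^ 'n \<Rightarrow> real"
  assumes f: "f \<in> L1_loc \<Omega>" and \<Omega>: "open \<Omega>"
    and z: "\<And>\<phi>. \<phi> \<in> test_fun \<Omega> \<Longrightarrow> (LINT x|lebesgue_on \<Omega>. \<phi> x * f x) = 0"
  shows "AE x in lebesgue_on \<Omega>. f x = 0"
proof (rule AE_zero_if_box_integrals_zero[OF \<Omega> f])
  fix B :: "(real ^ 'n) set" assume "B \<in> rat_boxes" and c: "closure B \<subseteq> \<Omega>"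
  then obtain a b where B: "B = box a b" by (auto simp: rat_boxes_def)
  let ?K = "closure B" and ?\<beta> = "\<lambda>m. box_bump a b (real (Suc m))"
  have i: "integrable (lebesgue_on \<Omega>) (\<lambda>x. indicator ?K x *\<^sub>R f x)"
    using f \<Omega> c by (intro L1_loc_integrable_indicator) (auto simp: B bounded_box)
  have t: "?\<beta> m \<in> test_fun \<Omega>" for m using c by (intro box_bump_test_fun) (auto simp: B)
  have eq: "?\<beta> m x * f x = ?\<beta> m x * (indicator ?K x *\<^sub>R f x)" for m x
    using box_bump_outside[of "real (Suc m)" x a b] closure_subset[of B] by (auto simp: indicator_def B)
  have "(\<lambda>m. LINT x|lebesgue_on \<Omega>. ?\<beta> m x * f x) \<longlonglongrightarrow> (LINT x|lebesgue_on \<Omega>. f x * indicator B x)"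
  proof (rule integral_dominated_convergence)
    show "integrable (lebesgue_on \<Omega>) (\<lambda>x. norm (indicator ?K x *\<^sub>R f x))" using i by (rule integrable_norm)
    have [measurable]: "(\<lambda>x. indicator ?K x *\<^sub>R f x) \<in> borel_measurable (lebesgue_on \<Omega>)" using i by auto
    have [measurable]: "B \<in> sets (lebesgue_on \<Omega>)"
      using closure_subset[of B] c \<Omega> by (auto simp: sets_restrict_space_iff B)
    have eq': "f x * indicator B x = (indicator ?K x *\<^sub>R f x) * indicator B x" for x
      using closure_subset[of B] by (auto simp: indicator_def)
    show "(\<lambda>x. f x * indicator B x) \<in> borel_measurable (lebesgue_on \<Omega>)"
      unfolding eq' by measurable
    show "(\<lambda>x. ?\<beta> m x * f x) \<in> borel_measurable (lebesgue_on \<Omega>)" for m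
      unfolding eq
      by (rule borel_measurable_times[OF measurable_lebesgue_on_continuous[OF test_funD(1)[OF t]]
            borel_measurable_integrable[OF i]])
    show "AE x in lebesgue_on \<Omega>. (\<lambda>m. ?\<beta> m x * f x) \<longlonglongrightarrow> f x * indicator B x"
      unfolding B by (intro AE_I2) (subst mult.commute, intro tendsto_intros box_bump_tendsto)
    show "AE x in lebesgue_on \<Omega>. norm (?\<beta> m x * f x) \<le> norm (indicator ?K x *\<^sub>R f x)" for m
      unfolding eq using box_bump_bounds[of a b "real (Suc m)"]
      by (intro AE_I2) (simp add: abs_mult mult_left_le_one_le)
  qed
  moreover have "(LINT x|lebesgue_on \<Omega>. ?\<beta> m x * f x) = 0" for m by (intro z t)
  ultimately show "(LINT x|lebesgue_on \<Omega>. f x * indicator B x) = 0"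
    by (simp add: LIMSEQ_const_iff)
qed

lemma weak_grad_unique:
  fixes u :: "real ^ 'n \<Rightarrow> real"
  assumes \<Omega>: "open \<Omega>" and D: "weak_grad \<Omega> u D" and E: "weak_grad \<Omega> u E"
  shows "AE x in lebesgue_on \<Omega>. D x = E x"
proof -
  have loc: "D \<in> L1_loc \<Omega>" "E \<in> L1_loc \<Omega>" using D E by (auto simp: weak_grad_def)
  have "AE x in lebesgue_on \<Omega>. (D x - E x) \<bullet> axis i 1 = 0" for i
  proof (rule fundamental_lemma_calculus_of_variations[OF _ \<Omega>])
    show "(\<lambda>x. (D x - E x) \<bullet> axis i 1) \<in> L1_loc \<Omega>"
      using loc by (auto simp: L1_loc_def intro!: integrable_inner_left Bochner_Integration.integrable_diff)
    fix \<phi> :: "real ^ 'n \<Rightarrow> real" assume \<phi>: "\<phi> \<in> test_fun \<Omega>"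
    have eq: "(LINT x|lebesgue_on \<Omega>. \<phi> x *\<^sub>R D x) = (LINT x|lebesgue_on \<Omega>. \<phi> x *\<^sub>R E x)"
      using D E \<phi> by (auto simp: weak_grad_def)
    note i = test_fun_mult_integrable[OF loc(1) \<Omega> \<phi>] test_fun_mult_integrable[OF loc(2) \<Omega> \<phi>]
    have "(LINT x|lebesgue_on \<Omega>. \<phi> x * ((D x - E x) \<bullet> axis i 1))
        = (LINT x|lebesgue_on \<Omega>. (\<phi> x *\<^sub>R D x - \<phi> x *\<^sub>R E x) \<bullet> axis i 1)"
      by (simp add: inner_diff_left algebra_simps)
    also have "\<dots> = 0"
      using i eq by (subst integral_inner_left) (auto simp: Bochner_Integration.integral_diff)
    finally show "(LINT x|lebesgue_on \<Omega>. \<phi> x * ((D x - E x) \<bullet> axis i 1)) = 0" .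
  qed
  then have "AE x in lebesgue_on \<Omega>. \<forall>i\<in>UNIV. (D x - E x) \<bullet> axis i 1 = 0"
    by (intro AE_finite_allI) auto
  then show ?thesis
    by eventually_elim (auto simp: vec_eq_iff inner_axis)
qed

section \<open>Weak-type functions on sets of finite measure\<close>

text \<open>
  A discrete layer-cake formula: the value \<open>v\<close> is at most \<open>\<tau>\<close> or lies in one dyadic interval above \<open>\<tau>\<close>.
\<close>

lemma dyadic_bound:
  fixes v \<tau> :: real
  assumes "0 < \<tau>"
  shows "ennreal v \<le> ennreal \<tau> + (\<Sum>j. ennreal (2 ^ Suc j * \<tau>) * indicator {t. 2 ^ j * \<tau> < t} v)"
proof (cases "v \<le> \<tau>")
  case True
  then have "ennreal v \<le> ennreal \<tau>" by (rule ennreal_leI)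
  then show ?thesis by (rule order_trans) simp
next
  case False
  obtain N where "v / \<tau> < 2 ^ N" using real_arch_pow[of 2 "v / \<tau>"] by auto
  then have ex: "v \<le> 2 ^ N * \<tau>" using assms by (simp add: field_simps)
  define k where "k = (LEAST k. v \<le> 2 ^ k * \<tau>)"
  have k: "v \<le> 2 ^ k * \<tau>" unfolding k_def using ex by (rule LeastI)
  with False have "k \<noteq> 0" by (intro notI) simp
  then obtain j where j: "k = Suc j" by (cases k) auto
  then have "2 ^ j * \<tau> < v"
    using not_less_Least[of j "\<lambda>k. v \<le> 2 ^ k * \<tau>"] by (auto simp: k_def not_le)
  have term_le: "f j \<le> (\<Sum>j. f j)" for f :: "nat \<Rightarrow> ennreal"
    using sum_le_suminf[of f "{j}"] by simp
  have "ennreal v \<le> ennreal (2 ^ Suc j * \<tau>) * indicator {t. 2 ^ j * \<tau> < t} v"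
    using k j \<open>2 ^ j * \<tau> < v\<close> by (auto intro: ennreal_leI)
  also have "\<dots> \<le> (\<Sum>j. ennreal (2 ^ Suc j * \<tau>) * indicator {t. 2 ^ j * \<tau> < t} v)"
    by (rule term_le)
  also have "\<dots> \<le> ennreal \<tau> + \<dots>" by simp
  finally show ?thesis .
qed

text \<open>
  Weak \<open>L^\<alpha>\<close> functions behave on sets of finite measure as Hoelder's inequality would predict for
  \<open>L^\<alpha>\<close>. The layers above height \<open>\<tau>\<close> sum to a geometric series because \<open>\<alpha> > 1\<close>; the choice
  \<open>\<tau> = (K / m)^{1/\<alpha>}\<close> balances them against the bounded part \<open>\<tau> m\<close>.
\<close>

lemma nn_integral_weak_Lebesgue_bound:
  fixes V :: "'a \<Rightarrow> real" and \<alpha> K m :: real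
  assumes V [measurable]: "V \<in> borel_measurable M" and K: "0 < K" and \<alpha>: "1 < \<alpha>"
    and weak: "\<And>t. 0 < t \<Longrightarrow> emeasure M {x \<in> space M. t < V x} \<le> ennreal (K * t powr (- \<alpha>))"
    and E [measurable]: "E \<in> sets M" and m: "emeasure M E = ennreal m" "0 \<le> m"
  shows "(\<integral>\<^sup>+x. ennreal (V x) * indicator E x \<partial>M)
    \<le> ennreal (K powr (1 / \<alpha>) * (1 + 2 / (1 - 2 powr (1 - \<alpha>))) * m powr (1 - 1 / \<alpha>))"
proof (cases "m = 0")
  case True
  then have "E \<in> null_sets M" using m by auto
  then have "AE x in M. x \<notin> E" by (rule AE_not_in)
  then have "(\<integral>\<^sup>+x. ennreal (V x) * indicator E x \<partial>M) = (\<integral>\<^sup>+x. 0 \<partial>M)"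
    by (intro nn_integral_cong_AE) (auto elim!: eventually_mono)
  then show ?thesis by simp
next
  case False
  with m have "0 < m" by simp
  define \<tau> where "\<tau> = (K / m) powr (1 / \<alpha>)"
  have "0 < \<tau>" using K \<open>0 < m\<close> by (simp add: \<tau>_def)
  define L where "L j = {x \<in> space M. 2 ^ j * \<tau> < V x}" for j :: nat
  have L [measurable]: "L j \<in> sets M" for j unfolding L_def by measurable
  define \<rho> where "\<rho> = 2 powr (1 - \<alpha>)"
  have \<rho>: "0 < \<rho>" "\<rho> < 1" using \<alpha> by (auto simp: \<rho>_def powr_less_one)
  have term_le: "ennreal (2 ^ Suc j * \<tau>) * emeasure M (L j) \<le> ennreal (2 * K * \<tau> powr (1 - \<alpha>) * \<rho> ^ j)" for j
  proof -
    have "emeasure M (L j) \<le> ennreal (K * (2 ^ j * \<tau>) powr (- \<alpha>))"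
      unfolding L_def using \<open>0 < \<tau>\<close> by (intro weak) simp
    then have "ennreal (2 ^ Suc j * \<tau>) * emeasure M (L j)
        \<le> ennreal (2 ^ Suc j * \<tau>) * ennreal (K * (2 ^ j * \<tau>) powr (- \<alpha>))"
      by (rule mult_left_mono) simp
    also have "\<dots> = ennreal (2 ^ Suc j * \<tau> * (K * (2 ^ j * \<tau>) powr (- \<alpha>)))"
      using \<open>0 < \<tau>\<close> by (intro ennreal_mult'[symmetric]) simp
    also have "2 ^ Suc j * \<tau> * (K * (2 ^ j * \<tau>) powr (- \<alpha>))
        = 2 * K * (2 ^ j * \<tau>) powr (1 - \<alpha>)"
      using \<open>0 < \<tau>\<close> by (simp add: powr_diff powr_minus field_simps)
    also have "(2 ^ j * \<tau>) powr (1 - \<alpha>) = \<tau> powr (1 - \<alpha>) * \<rho> ^ j"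
      using \<open>0 < \<tau>\<close>
      by (simp add: \<rho>_def powr_mult powr_powr flip: powr_realpow) (simp add: mult.commute)
    finally show ?thesis by (simp add: mult.assoc)
  qed
  have "(\<integral>\<^sup>+x. ennreal (V x) * indicator E x \<partial>M)
      \<le> (\<integral>\<^sup>+x. ennreal \<tau> * indicator E x + (\<Sum>j. ennreal (2 ^ Suc j * \<tau>) * indicator (L j) x) \<partial>M)"
  proof (rule nn_integral_mono)
    fix x assume "x \<in> space M"
    then have "ennreal (V x) \<le> ennreal \<tau> + (\<Sum>j. ennreal (2 ^ Suc j * \<tau>) * indicator (L j) x)"
      using dyadic_bound[OF \<open>0 < \<tau>\<close>, of "V x"] by (simp add: L_def indicator_def)
    then show "ennreal (V x) * indicator E x
        \<le> ennreal \<tau> * indicator E x + (\<Sum>j. ennreal (2 ^ Suc j * \<tau>) * indicator (L j) x)"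
      by (auto simp: indicator_def)
  qed
  also have "\<dots> = ennreal \<tau> * emeasure M E + (\<Sum>j. ennreal (2 ^ Suc j * \<tau>) * emeasure M (L j))"
    by (simp add: nn_integral_add nn_integral_suminf nn_integral_cmult)
  also have "\<dots> \<le> ennreal \<tau> * emeasure M E + (\<Sum>j. ennreal (2 * K * \<tau> powr (1 - \<alpha>) * \<rho> ^ j))"
    by (intro add_left_mono suminf_le term_le) auto
  also have "(\<Sum>j. ennreal (2 * K * \<tau> powr (1 - \<alpha>) * \<rho> ^ j)) = ennreal (\<Sum>j. 2 * K * \<tau> powr (1 - \<alpha>) * \<rho> ^ j)"
    using \<rho> K by (intro suminf_ennreal2 summable_mult summable_geometric) auto
  also have "(\<Sum>j. 2 * K * \<tau> powr (1 - \<alpha>) * \<rho> ^ j) = 2 * K * \<tau> powr (1 - \<alpha>) * (1 / (1 - \<rho>))"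
    using \<rho> by (subst suminf_mult) (auto simp: suminf_geometric)
  also have "ennreal \<tau> * emeasure M E = ennreal (\<tau> * m)"
    using \<open>0 < \<tau>\<close> m by (simp add: ennreal_mult')
  also have "\<tau> * m = K powr (1 / \<alpha>) * m powr (1 - 1 / \<alpha>)"
    using K \<open>0 < m\<close> by (simp add: \<tau>_def powr_divide powr_diff)
  also have "\<tau> powr (1 - \<alpha>) = K powr (1 / \<alpha> - 1) * m powr (1 - 1 / \<alpha>)"
  proof -
    have e: "(1 / \<alpha>) * (1 - \<alpha>) = 1 / \<alpha> - 1" using \<alpha> by (simp add: field_simps)
    have "\<tau> powr (1 - \<alpha>) = (K / m) powr (1 / \<alpha> - 1)" unfolding \<tau>_def powr_powr e ..
    also have "\<dots> = K powr (1 / \<alpha> - 1) / m powr (1 / \<alpha> - 1)"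
      using K \<open>0 < m\<close> by (simp add: powr_divide)
    also have "\<dots> = K powr (1 / \<alpha> - 1) * m powr (1 - 1 / \<alpha>)"
      using powr_minus[of m "1 / \<alpha> - 1"] by (simp add: divide_inverse)
    finally show ?thesis .
  qed
  also have "2 * K * (K powr (1 / \<alpha> - 1) * m powr (1 - 1 / \<alpha>)) * (1 / (1 - \<rho>))
      = K powr (1 / \<alpha>) * m powr (1 - 1 / \<alpha>) * (2 / (1 - \<rho>))"
    using K by (simp add: powr_diff)
  also have "ennreal (K powr (1 / \<alpha>) * m powr (1 - 1 / \<alpha>)) + ennreal (K powr (1 / \<alpha>) * m powr (1 - 1 / \<alpha>) * (2 / (1 - \<rho>)))
      = ennreal (K powr (1 / \<alpha>) * (1 + 2 / (1 - \<rho>)) * m powr (1 - 1 / \<alpha>))"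
    using \<rho> by (subst ennreal_plus[symmetric]) (auto simp: algebra_simps)
  finally show ?thesis by (simp add: \<rho>_def)
qed

section \<open>Translations and superlevel sets\<close>

lemma nn_integral_lborel_translate:
  fixes f :: "'a::euclidean_space \<Rightarrow> ennreal"
  assumes [measurable]: "f \<in> borel_measurable borel"
  shows "(\<integral>\<^sup>+x. f (x + c) \<partial>lborel) = (\<integral>\<^sup>+x. f x \<partial>lborel)"
proof -
  have "(\<integral>\<^sup>+x. f x \<partial>lborel) = (\<integral>\<^sup>+x. f x \<partial>distr lborel borel ((+) c))"
    by (simp add: lborel_distr_plus)
  also have "\<dots> = (\<integral>\<^sup>+x. f (x + c) \<partial>lborel)"
    by (subst nn_integral_distr) (auto simp: add.commute)
  finally show ?thesis ..
qed

text \<open>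
  The increment is the integral of the directional derivative over the unit interval; the variance
  of that derivative is nonnegative.
\<close>

lemma increment_square_le:
  fixes v :: "real ^ 'n \<Rightarrow> real"
  assumes d: "\<And>x. v differentiable (at x)" and c: "continuous_on UNIV (grad v)"
  shows "ennreal ((v (x + h) - v x)\<^sup>2)
    \<le> (\<integral>\<^sup>+t. indicator {0..1} t * ennreal ((grad v (x + t *\<^sub>R h) \<bullet> h)\<^sup>2) \<partial>lborel)"
proof -
  define g where "g t = grad v (x + t *\<^sub>R h) \<bullet> h" for t :: real
  define \<delta> where "\<delta> = v (x + h) - v x"
  have cg: "continuous_on {0..1} g" unfolding g_def
    by (intro continuous_intros continuous_on_compose2[OF c]) auto
  have der: "((\<lambda>t. v (x + t *\<^sub>R h)) has_real_derivative g t) (at t)" for t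
  proof -
    have "((\<lambda>t. x + t *\<^sub>R h) has_derivative (\<lambda>s. s *\<^sub>R h)) (at t)"
      by (auto intro!: derivative_eq_intros)
    moreover have "(v has_derivative frechet_derivative v (at (x + t *\<^sub>R h))) (at (x + t *\<^sub>R h))"
      using d by (simp add: frechet_derivative_works)
    ultimately have "((\<lambda>t. v (x + t *\<^sub>R h)) has_derivative (\<lambda>s. frechet_derivative v (at (x + t *\<^sub>R h)) (s *\<^sub>R h))) (at t)"
      by (rule has_derivative_compose)
    then show ?thesis
      by (simp add: has_field_derivative_def grad_inner_eq_derivative[OF d] g_def mult.commute[of _ "_ \<bullet> _"])
  qed
  have "(g has_integral (v (x + 1 *\<^sub>R h) - v (x + 0 *\<^sub>R h))) {0..1}"
    using der by (intro fundamental_theorem_of_calculus)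
      (auto simp flip: has_real_derivative_iff_has_vector_derivative intro: has_field_derivative_at_within)
  then have g1: "(g has_integral \<delta>) {0..1}" by (simp add: \<delta>_def)
  have "(\<lambda>t. (g t)\<^sup>2) integrable_on {0..1}"
    by (intro integrable_continuous_real continuous_intros cg)
  then obtain I where I: "((\<lambda>t. (g t)\<^sup>2) has_integral I) {0..1}" by blast
  have "((\<lambda>t. (g t)\<^sup>2 - g t * (2 * \<delta>) + \<delta>\<^sup>2) has_integral I - \<delta> * (2 * \<delta>) + \<delta>\<^sup>2 * (1 - 0)) {0..1}"
    using has_integral_const_real[of "\<delta>\<^sup>2" 0 1]
    by (intro has_integral_add has_integral_diff has_integral_mult_left I g1) simp
  then have "0 \<le> I - \<delta> * (2 * \<delta>) + \<delta>\<^sup>2 * (1 - 0)"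
  proof (rule has_integral_nonneg)
    fix t show "0 \<le> (g t)\<^sup>2 - g t * (2 * \<delta>) + \<delta>\<^sup>2"
      using zero_le_power2[of "g t - \<delta>"] by (simp add: power2_diff)
  qed
  then have "\<delta>\<^sup>2 \<le> I" by (simp add: power2_eq_square)
  then have "ennreal (\<delta>\<^sup>2) \<le> ennreal I" by (rule ennreal_leI)
  also have "ennreal I = (\<integral>\<^sup>+t. ennreal (indicator {0..1} t * (g t)\<^sup>2) \<partial>lborel)"
    using nn_integral_has_integral_lebesgue[OF _ I] by simp
  also have "\<dots> = (\<integral>\<^sup>+t. indicator {0..1} t * ennreal ((g t)\<^sup>2) \<partial>lborel)"
    by (intro nn_integral_cong) (auto simp: indicator_def)
  finally show ?thesis by (simp add: \<delta>_def g_def)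
qed

lemma translation_estimate:
  fixes v :: "real ^ 'n \<Rightarrow> real"
  assumes d: "\<And>x. v differentiable (at x)" and c: "continuous_on UNIV (grad v)"
  shows "(\<integral>\<^sup>+x. ennreal ((v (x + h) - v x)\<^sup>2) \<partial>lborel)
    \<le> ennreal ((norm h)\<^sup>2) * (\<integral>\<^sup>+x. ennreal ((norm (grad v x))\<^sup>2) \<partial>lborel)"
proof -
  have [measurable]: "grad v \<in> borel_measurable borel" using c by (rule borel_measurable_continuous_onI)
  let ?N = "\<lambda>x. ennreal ((norm (grad v x))\<^sup>2)"
  have "(\<integral>\<^sup>+x. ennreal ((v (x + h) - v x)\<^sup>2) \<partial>lborel)
      \<le> (\<integral>\<^sup>+x. \<integral>\<^sup>+t. indicator {0..1} t * (ennreal ((norm h)\<^sup>2) * ?N (x + t *\<^sub>R h)) \<partial>(lborel :: real measure) \<partial>lborel)"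
  proof (rule nn_integral_mono)
    fix x
    have "ennreal ((v (x + h) - v x)\<^sup>2)
        \<le> (\<integral>\<^sup>+t. indicator {0..1} t * ennreal ((grad v (x + t *\<^sub>R h) \<bullet> h)\<^sup>2) \<partial>lborel)"
      by (rule increment_square_le[OF d c])
    also have "\<dots> \<le> (\<integral>\<^sup>+t. indicator {0..1} t * (ennreal ((norm h)\<^sup>2) * ?N (x + t *\<^sub>R h)) \<partial>lborel)"
    proof (intro nn_integral_mono mult_left_mono)
      fix t :: real
      have "(grad v (x + t *\<^sub>R h) \<bullet> h)\<^sup>2 \<le> (norm h)\<^sup>2 * (norm (grad v (x + t *\<^sub>R h)))\<^sup>2"
        using Cauchy_Schwarz_ineq[of "grad v (x + t *\<^sub>R h)" h]
        by (simp add: power2_norm_eq_inner mult.commute)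
      then show "ennreal ((grad v (x + t *\<^sub>R h) \<bullet> h)\<^sup>2) \<le> ennreal ((norm h)\<^sup>2) * ?N (x + t *\<^sub>R h)"
        by (simp add: ennreal_leI flip: ennreal_mult)
    qed auto
    finally show "ennreal ((v (x + h) - v x)\<^sup>2)
      \<le> (\<integral>\<^sup>+t. indicator {0..1} t * (ennreal ((norm h)\<^sup>2) * ?N (x + t *\<^sub>R h)) \<partial>(lborel :: real measure))" .
  qed
  also have "\<dots> = (\<integral>\<^sup>+t. \<integral>\<^sup>+x. indicator {0..1} t * (ennreal ((norm h)\<^sup>2) * ?N (x + t *\<^sub>R h)) \<partial>lborel \<partial>(lborel :: real measure))"
    by (rule lborel_pair.Fubini') measurable
  also have "\<dots> = (\<integral>\<^sup>+t. indicator {0..1} t * (ennreal ((norm h)\<^sup>2) * (\<integral>\<^sup>+x. ?N x \<partial>lborel)) \<partial>(lborel :: real measure))"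
    by (simp add: nn_integral_cmult nn_integral_lborel_translate[where f="?N"])
  also have "\<dots> = ennreal ((norm h)\<^sup>2) * (\<integral>\<^sup>+x. ?N x \<partial>lborel)"
    by (subst nn_integral_multc) auto
  finally show ?thesis .
qed

text \<open>
  Translating by vectors \<open>h\<close> of a ball of measure \<open>2 m\<close>, twice that of \<open>F\<close>, moves a point \<open>x \<in> E\<close>
  outside \<open>F\<close> for at least half of all \<open>h\<close>, and then \<open>v\<close> drops by a fixed amount. Integrating the
  squared increments over \<open>x\<close> and \<open>h\<close> bounds the measure of \<open>E\<close> by the energy of \<open>v\<close> times the
  squared radius, which is a multiple of \<open>m^{2/n}\<close>.
\<close>

lemma superlevel_gap_estimate:
  fixes v :: "real ^ 'n \<Rightarrow> real"
  assumes d: "\<And>x. v differentiable (at x)" and c: "continuous_on UNIV (grad v)"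
    and E [measurable]: "E \<in> sets borel" and F [measurable]: "F \<in> sets borel"
    and m: "emeasure lborel F = ennreal m" "0 < m"
    and gap: "\<And>x y. x \<in> E \<Longrightarrow> y \<notin> F \<Longrightarrow> 3 / 10 \<le> v x - v y"
  shows "emeasure lborel E \<le> ennreal (200 / 9 * ((2 * m / unit_ball_vol (real CARD('n))) powr (2 / real CARD('n))))
    * (\<integral>\<^sup>+x. ennreal ((norm (grad v x))\<^sup>2) \<partial>lborel)"
proof -
  have [measurable]: "v \<in> borel_measurable borel"
    by (intro borel_measurable_continuous_onI continuous_at_imp_continuous_on ballI differentiable_imp_continuous_within d)
  have [measurable]: "grad v \<in> borel_measurable borel" using c by (rule borel_measurable_continuous_onI)
  have [measurable]: "- F \<in> sets borel" using F by (rule borel_comp)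
  let ?N = "\<integral>\<^sup>+x. ennreal ((norm (grad v x))\<^sup>2) \<partial>lborel"
  define n \<omega> where "n = real CARD('n)" and "\<omega> = unit_ball_vol n"
  have n: "0 < n" by (simp add: n_def)
  then have \<omega>: "0 < \<omega>" by (simp add: \<omega>_def)
  \<comment> \<open>The radius for which the ball has measure \<open>2 m\<close>.\<close>
  define r where "r = (2 * m / \<omega>) powr (1 / n)"
  have r: "0 < r" using m \<omega> by (simp add: r_def)
  have "r ^ CARD('n) = 2 * m / \<omega>"
    using r m n \<omega> by (simp add: r_def powr_powr n_def flip: powr_realpow)
  then have vol: "emeasure lborel (cball (0::real^'n) r) = ennreal (2 * m)"
    using r \<omega> by (auto simp: emeasure_cball \<omega>_def n_def simp del: unit_ball_vol_pos)
  have r2: "r\<^sup>2 = (2 * m / \<omega>) powr (2 / n)"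
    using r by (simp add: r_def powr_powr flip: powr_realpow)
  let ?B = "cball (0::real^'n) r"
  have [measurable]: "?B \<in> sets borel" by simp
  have ms: "(\<lambda>h. indicator (- F) (x + h) :: ennreal) \<in> borel_measurable lborel"
      "(\<lambda>h. indicator F (h + x) :: ennreal) \<in> borel_measurable lborel"
      "(\<lambda>h. indicator ?B h :: ennreal) \<in> borel_measurable lborel" for x
    using measurable_compose[of "\<lambda>h. x + h" borel borel "indicator (- F) :: _ \<Rightarrow> ennreal" borel]
      measurable_compose[of "\<lambda>h. h + x" borel borel "indicator F :: _ \<Rightarrow> ennreal" borel]
      borel_measurable_indicator[of ?B borel] by simp_all
  \<comment> \<open>The translates that leave \<open>F\<close> fill at least half of the ball.\<close>
  have many: "ennreal m \<le> (\<integral>\<^sup>+h. indicator ?B h * indicator (- F) (x + h) \<partial>lborel)" for x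
  proof -
    have "ennreal (2 * m) = (\<integral>\<^sup>+h. indicator ?B h \<partial>lborel)" by (simp add: vol)
    also have "\<dots> \<le> (\<integral>\<^sup>+h. indicator ?B h * indicator (- F) (x + h) + indicator F (h + x) \<partial>lborel)"
      by (intro nn_integral_mono) (auto simp: indicator_def add.commute)
    also have "\<dots> = (\<integral>\<^sup>+h. indicator ?B h * indicator (- F) (x + h) \<partial>lborel) + (\<integral>\<^sup>+h. indicator F (h + x) \<partial>lborel)"
      by (intro nn_integral_add borel_measurable_times_ennreal ms)
    also have "(\<integral>\<^sup>+h. indicator F (h + x) \<partial>lborel) = ennreal m"
      using nn_integral_lborel_translate[of "indicator F" x] by (simp add: m)
    finally have "ennreal (2 * m) \<le> (\<integral>\<^sup>+h. indicator ?B h * indicator (- F) (x + h) \<partial>lborel) + ennreal m" .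
    moreover have "ennreal (2 * m) = ennreal m + ennreal m" using m by (simp flip: ennreal_plus)
    ultimately show ?thesis by (simp add: add.commute ennreal_add_left_cancel_le)
  qed
  have "ennreal (9 / 100) * (emeasure lborel E * ennreal m)
      = (\<integral>\<^sup>+x. ennreal (9 / 100) * (indicator E x * ennreal m) \<partial>lborel)"
    by (simp add: nn_integral_cmult nn_integral_multc)
  also have "\<dots> \<le> (\<integral>\<^sup>+x. ennreal (9 / 100) * (indicator E x * (\<integral>\<^sup>+h. indicator ?B h * indicator (- F) (x + h) \<partial>lborel)) \<partial>lborel)"
    by (intro nn_integral_mono mult_left_mono many) auto
  also have "\<dots> = (\<integral>\<^sup>+x. \<integral>\<^sup>+h. ennreal (9 / 100) * (indicator E x * (indicator ?B h * indicator (- F) (x + h))) \<partial>lborel \<partial>lborel)"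
  proof (rule nn_integral_cong)
    fix x
    have "(\<integral>\<^sup>+h. ennreal (9 / 100) * (indicator E x * (indicator ?B h * indicator (- F) (x + h))) \<partial>lborel)
        = ennreal (9 / 100) * (\<integral>\<^sup>+h. indicator E x * (indicator ?B h * indicator (- F) (x + h)) \<partial>lborel)"
      by (intro nn_integral_cmult borel_measurable_times_ennreal ms borel_measurable_const)
    also have "(\<integral>\<^sup>+h. indicator E x * (indicator ?B h * indicator (- F) (x + h)) \<partial>lborel)
        = indicator E x * (\<integral>\<^sup>+h. indicator ?B h * indicator (- F) (x + h) \<partial>lborel)"
      by (intro nn_integral_cmult borel_measurable_times_ennreal ms)
    finally show "ennreal (9 / 100) * (indicator E x * (\<integral>\<^sup>+h. indicator ?B h * indicator (- F) (x + h) \<partial>lborel))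
        = (\<integral>\<^sup>+h. ennreal (9 / 100) * (indicator E x * (indicator ?B h * indicator (- F) (x + h))) \<partial>lborel)" ..
  qed
  also have "\<dots> \<le> (\<integral>\<^sup>+x. \<integral>\<^sup>+h. indicator ?B h * ennreal ((v (x + h) - v x)\<^sup>2) \<partial>lborel \<partial>lborel)"
  proof (intro nn_integral_mono)
    fix x h
    show "ennreal (9 / 100) * (indicator E x * (indicator ?B h * indicator (- F) (x + h)))
        \<le> indicator ?B h * ennreal ((v (x + h) - v x)\<^sup>2)"
    proof (cases "x \<in> E \<and> x + h \<notin> F")
      case True
      then have "3 / 10 \<le> v x - v (x + h)" by (intro gap) auto
      then have "(3 / 10)\<^sup>2 \<le> (v x - v (x + h))\<^sup>2" by (intro power_mono) auto
      then have "9 / 100 \<le> (v (x + h) - v x)\<^sup>2" by (simp add: power2_commute power_divide)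
      then show ?thesis by (auto simp: indicator_def intro: ennreal_leI)
    qed (auto simp: indicator_def)
  qed
  also have "\<dots> = (\<integral>\<^sup>+h. \<integral>\<^sup>+x. indicator ?B h * ennreal ((v (x + h) - v x)\<^sup>2) \<partial>lborel \<partial>lborel)"
    by (rule lborel_pair.Fubini') measurable
  also have "\<dots> = (\<integral>\<^sup>+h. indicator ?B h * (\<integral>\<^sup>+x. ennreal ((v (x + h) - v x)\<^sup>2) \<partial>lborel) \<partial>lborel)"
    by (simp add: nn_integral_cmult)
  also have "\<dots> \<le> (\<integral>\<^sup>+h. indicator ?B h * (ennreal (r\<^sup>2) * ?N) \<partial>lborel)"
  proof (intro nn_integral_mono)
    fix h :: "real^'n"
    show "indicator ?B h * (\<integral>\<^sup>+x. ennreal ((v (x + h) - v x)\<^sup>2) \<partial>lborel) \<le> indicator ?B h * (ennreal (r\<^sup>2) * ?N)"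
    proof (cases "h \<in> ?B")
      case True
      then have "ennreal ((norm h)\<^sup>2) \<le> ennreal (r\<^sup>2)" by (intro ennreal_leI power_mono) auto
      with translation_estimate[OF d c, of h] have "(\<integral>\<^sup>+x. ennreal ((v (x + h) - v x)\<^sup>2) \<partial>lborel) \<le> ennreal (r\<^sup>2) * ?N"
        by (meson order_trans mult_right_mono zero_le)
      then show ?thesis using True by simp
    qed simp
  qed
  also have "\<dots> = ennreal (2 * m) * (ennreal (r\<^sup>2) * ?N)"
    by (subst nn_integral_multc) (auto simp: vol)
  finally have le: "ennreal (9 / 100) * (emeasure lborel E * ennreal m) \<le> ennreal (2 * m) * (ennreal (r\<^sup>2) * ?N)" .
  have "emeasure lborel E = ennreal (100 / (9 * m)) * (ennreal (9 / 100) * (emeasure lborel E * ennreal m))"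
  proof -
    have "ennreal (100 / (9 * m)) * (ennreal (9 / 100) * (emeasure lborel E * ennreal m))
      = ennreal (100 / (9 * m)) * ennreal (9 / 100) * ennreal m * emeasure lborel E"
      by (simp add: ac_simps)
    also have "ennreal (100 / (9 * m)) * ennreal (9 / 100) * ennreal m = ennreal 1"
      using m by (simp flip: ennreal_mult)
    finally show ?thesis by simp
  qed
  also have "\<dots> \<le> ennreal (100 / (9 * m)) * (ennreal (2 * m) * (ennreal (r\<^sup>2) * ?N))"
    by (intro mult_left_mono le) simp
  also have "\<dots> = ennreal (100 / (9 * m)) * ennreal (2 * m) * ennreal (r\<^sup>2) * ?N" by (simp add: ac_simps)
  also have "ennreal (100 / (9 * m)) * ennreal (2 * m) * ennreal (r\<^sup>2) = ennreal (200 / 9 * r\<^sup>2)"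
    using m by (simp flip: ennreal_mult)
  finally show ?thesis by (simp only: r2 \<omega>_def n_def)
qed

section \<open>A Hardy inequality for weak-type weights\<close>

text \<open>
  If \<open>m2\<close> is comparable to \<open>m1\<close>, then \<open>m1^p\<close> can be replaced by \<open>m2^p\<close> and cancelled on the left.
  If \<open>m2\<close> is much smaller, the factor 4 from doubling \<open>s\<close> is outweighed by the decay of the measure.
  The threshold \<open>e\<close> is chosen so that \<open>e^{1-p} = 1/8\<close>, whence the factor one half.
\<close>

lemma level_decay_dichotomy:
  fixes s m1 m2 p C d :: real
  assumes p: "0 < p" "p < 1" and C: "0 \<le> C" and d: "0 \<le> d"
    and m: "0 < m2" "m2 \<le> m1" and le: "s\<^sup>2 * m2 \<le> C * m1 powr p * d"
  shows "(2 * s)\<^sup>2 * m2 powr (1 - p) \<le> 4 * C * (8 powr (p / (1 - p))) * d + s\<^sup>2 * m1 powr (1 - p) / 2"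
proof -
  define e where "e = 8 powr (- 1 / (1 - p))"
  have e: "0 < e" by (simp add: e_def)
  have "e powr (1 - p) = 8 powr (- 1)" using p unfolding e_def powr_powr by simp
  then have e1: "e powr (1 - p) = 1 / 8" by (simp only: powr_minus_divide powr_one)
  have e2: "e powr (- p) = 8 powr (p / (1 - p))" by (simp add: e_def powr_powr)
  show ?thesis
  proof (cases "e * m1 \<le> m2")
    case True
    then have "m1 \<le> m2 / e" using e by (simp add: field_simps)
    then have "m1 powr p \<le> (m2 / e) powr p" using m p by (intro powr_mono2) auto
    also have "\<dots> = m2 powr p * e powr (- p)"
      using m e by (simp add: powr_divide powr_minus_divide)
    finally have "C * m1 powr p * d \<le> C * (m2 powr p * e powr (- p)) * d"
      using C d by (intro mult_right_mono mult_left_mono) auto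
    with le have "s\<^sup>2 * m2 \<le> C * (m2 powr p * e powr (- p)) * d" by simp
    then have "s\<^sup>2 * m2 / m2 powr p \<le> C * (m2 powr p * e powr (- p)) * d / m2 powr p"
      by (rule divide_right_mono) simp
    then have "s\<^sup>2 * m2 powr (1 - p) \<le> C * e powr (- p) * d"
      using m by (simp add: powr_diff)
    then have "4 * (s\<^sup>2 * m2 powr (1 - p)) \<le> 4 * (C * 8 powr (p / (1 - p)) * d)" by (simp add: e2)
    moreover have "0 \<le> s\<^sup>2 * m1 powr (1 - p) / 2" by simp
    moreover have "(2 * s)\<^sup>2 * m2 powr (1 - p) = 4 * (s\<^sup>2 * m2 powr (1 - p))"
      by (simp add: power_mult_distrib)
    ultimately show ?thesis by linarith
  next
    case False
    then have "m2 powr (1 - p) \<le> (e * m1) powr (1 - p)" using m p by (intro powr_mono2) auto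
    also have "\<dots> = m1 powr (1 - p) / 8" using m e by (simp add: powr_mult e1)
    finally have "(2 * s)\<^sup>2 * m2 powr (1 - p) \<le> (2 * s)\<^sup>2 * (m1 powr (1 - p) / 8)"
      by (rule mult_left_mono) simp
    also have "\<dots> = s\<^sup>2 * m1 powr (1 - p) / 2" by (simp add: power_mult_distrib)
    moreover have "0 \<le> 4 * C * (8 powr (p / (1 - p))) * d" using C d by simp
    ultimately show ?thesis by linarith
  qed
qed

text \<open>
  A smooth substitute for the truncation of \<open>|t|\<close> between the levels \<open>s\<close> and \<open>2 s\<close>: it is at most
  one half below \<open>s\<close> and at least four fifths above \<open>2 s\<close>.
\<close>

definition soft_step :: "real \<Rightarrow> real \<Rightarrow> real" where
  "soft_step s t = t\<^sup>2 / (s\<^sup>2 + t\<^sup>2)"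

text \<open>
  The scale-invariant factor \<open>(s T')\<^sup>2\<close> by which composition with \<open>T = soft_step s\<close> changes the energy.
\<close>

definition soft_weight :: "real \<Rightarrow> real \<Rightarrow> real" where
  "soft_weight s t = s\<^sup>2 * (2 * s\<^sup>2 * t / (s\<^sup>2 + t\<^sup>2)\<^sup>2)\<^sup>2"

lemma soft_step_bounds: "0 \<le> soft_step s t" "soft_step s t \<le> 1"
  by (auto simp: soft_step_def divide_le_eq_1 sum_power2_gt_zero_iff)

lemma DERIV_soft_step:
  assumes "0 < s"
  shows "(soft_step s has_real_derivative 2 * s\<^sup>2 * t / (s\<^sup>2 + t\<^sup>2)\<^sup>2) (at t)"
proof -
  have "s\<^sup>2 + t\<^sup>2 \<noteq> 0" using assms by (simp add: sum_power2_eq_zero_iff)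
  then have "((\<lambda>t. t\<^sup>2 / (s\<^sup>2 + t\<^sup>2)) has_real_derivative
      ((2 * t) * (s\<^sup>2 + t\<^sup>2) - t\<^sup>2 * (2 * t)) / ((s\<^sup>2 + t\<^sup>2) * (s\<^sup>2 + t\<^sup>2))) (at t)"
    by (auto intro!: derivative_eq_intros)
  then show ?thesis
    by (simp add: soft_step_def[abs_def] power2_eq_square algebra_simps)
qed

text \<open>
  In the variable \<open>\<tau> = t\<^sup>2 / s\<^sup>2\<close> the left-hand side is \<open>4 \<tau> / (1 + \<tau>)^4\<close>, while halving \<open>s\<close> changes
  \<open>\<tau>\<close> to \<open>4 \<tau>\<close> and the difference of steps is \<open>3 \<tau> / ((1 + 4 \<tau>)(1 + \<tau>))\<close>.
\<close>

lemma soft_weight_le_telescoping: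
  assumes "0 < s"
  shows "soft_weight s t \<le> 16 / 3 * (soft_step (s / 2) t - soft_step s t)"
proof -
  define \<tau> where "\<tau> = t\<^sup>2 / s\<^sup>2"
  have \<tau>: "0 \<le> \<tau>" by (simp add: \<tau>_def)
  have t2: "t\<^sup>2 = \<tau> * s\<^sup>2" using assms by (simp add: \<tau>_def)
  have "soft_weight s t = s\<^sup>2 * (4 * (s\<^sup>2)\<^sup>2 * t\<^sup>2 / ((s\<^sup>2 + t\<^sup>2)\<^sup>2)\<^sup>2)"
    by (simp add: soft_weight_def power_divide power_mult_distrib)
  also have "\<dots> = s\<^sup>2 * (4 * (s\<^sup>2)\<^sup>2 * (\<tau> * s\<^sup>2) / ((s\<^sup>2 * (1 + \<tau>))\<^sup>2)\<^sup>2)"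
    by (simp add: t2 algebra_simps)
  also have "\<dots> = 4 * \<tau> / ((1 + \<tau>)\<^sup>2)\<^sup>2"
    using assms \<tau> by (simp add: power_mult_distrib power2_eq_square)
  also have "\<dots> \<le> 4 * \<tau> / (1 + \<tau>)\<^sup>2"
  proof (rule divide_left_mono)
    have "1 \<le> (1 + \<tau>)\<^sup>2" using \<tau> by (simp add: one_le_power)
    then show "(1 + \<tau>)\<^sup>2 \<le> ((1 + \<tau>)\<^sup>2)\<^sup>2"
      using self_le_power[of "(1 + \<tau>)\<^sup>2" 2] by simp
  qed (use \<tau> in auto)
  also have "\<dots> \<le> 16 / 3 * (3 * \<tau> / ((1 + 4 * \<tau>) * (1 + \<tau>)))"
  proof -
    have "(1 + 4 * \<tau>) * (1 + \<tau>) \<le> 4 * (1 + \<tau>)\<^sup>2" using \<tau> by (simp add: power2_eq_square algebra_simps)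
    then have "16 * \<tau> / (4 * (1 + \<tau>)\<^sup>2) \<le> 16 * \<tau> / ((1 + 4 * \<tau>) * (1 + \<tau>))"
      using \<tau> by (intro divide_left_mono) (auto intro!: mult_pos_pos add_pos_nonneg)
    then show ?thesis by simp
  qed
  also have "3 * \<tau> / ((1 + 4 * \<tau>) * (1 + \<tau>)) = 4 * \<tau> / (1 + 4 * \<tau>) - \<tau> / (1 + \<tau>)"
  proof -
    have "1 + 4 * \<tau> \<noteq> 0" "1 + \<tau> \<noteq> 0" using \<tau> by auto
    then show ?thesis by (simp add: divide_simps) (simp add: algebra_simps)
  qed
  also have "4 * \<tau> / (1 + 4 * \<tau>) = soft_step (s / 2) t"
  proof -
    have "soft_step (s / 2) t = (\<tau> * s\<^sup>2) / (s\<^sup>2 * ((1 + 4 * \<tau>) / 4))"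
      by (simp add: soft_step_def t2 power_divide algebra_simps add_divide_distrib)
    also have "\<dots> = 4 * \<tau> / (1 + 4 * \<tau>)" using assms by simp
    finally show ?thesis by simp
  qed
  also have "\<tau> / (1 + \<tau>) = soft_step s t"
  proof -
    have "soft_step s t = (\<tau> * s\<^sup>2) / (s\<^sup>2 * (1 + \<tau>))"
      by (simp add: soft_step_def t2 algebra_simps)
    also have "\<dots> = \<tau> / (1 + \<tau>)" using assms by simp
    finally show ?thesis by simp
  qed
  finally show ?thesis .
qed

lemma sum_soft_weight_le:
  assumes "0 < \<epsilon>"
  shows "(\<Sum>j<J. soft_weight (\<epsilon> * 2 ^ j) t) \<le> 16 / 3"
proof -
  let ?R = "\<lambda>j. soft_step (\<epsilon> / 2 * 2 ^ j) t"
  have "(\<Sum>j<J. soft_weight (\<epsilon> * 2 ^ j) t) \<le> (\<Sum>j<J. 16 / 3 * (?R j - ?R (Suc j)))"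
    using assms by (intro sum_mono order_trans[OF soft_weight_le_telescoping]) auto
  also have "\<dots> = 16 / 3 * (?R 0 - ?R J)"
    by (simp only: sum_distrib_left[symmetric] sum_lessThan_telescope'[of ?R J])
  also have "\<dots> \<le> 16 / 3 * 1"
    using soft_step_bounds[of "\<epsilon> / 2 * 2 ^ 0" t] soft_step_bounds[of "\<epsilon> / 2 * 2 ^ J" t] by (intro mult_left_mono) linarith+
  finally show ?thesis by simp
qed

lemma soft_step_gap:
  assumes "0 < s" "2 * s \<le> \<bar>a\<bar>" "\<bar>b\<bar> < s"
  shows "3 / 10 \<le> soft_step s a - soft_step s b"
proof -
  have "(2 * s)\<^sup>2 \<le> \<bar>a\<bar>\<^sup>2" using assms by (intro power_mono) auto
  then have a: "4 * s\<^sup>2 \<le> a\<^sup>2" by (simp add: power_mult_distrib)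
  have "\<bar>b\<bar>\<^sup>2 \<le> s\<^sup>2" using assms by (intro power_mono) auto
  then have b: "b\<^sup>2 \<le> s\<^sup>2" by simp
  have s: "0 < s\<^sup>2" using assms by simp
  have "0 < s\<^sup>2 + a\<^sup>2" "0 < s\<^sup>2 + b\<^sup>2" using s by (simp_all add: add_pos_nonneg)
  then have "4 / 5 \<le> soft_step s a" "soft_step s b \<le> 1 / 2"
    using a b by (simp_all add: soft_step_def le_divide_eq divide_le_eq)
  then show ?thesis by simp
qed

lemma grad_soft_step:
  fixes \<phi> :: "real ^ 'n \<Rightarrow> real"
  assumes "0 < s" and d: "\<phi> differentiable (at x)"
  shows "(\<lambda>x. soft_step s (\<phi> x)) differentiable (at x)"
    and "grad (\<lambda>x. soft_step s (\<phi> x)) x = (2 * s\<^sup>2 * \<phi> x / (s\<^sup>2 + (\<phi> x)\<^sup>2)\<^sup>2) *\<^sub>R grad \<phi> x"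
proof -
  have "(\<phi> has_derivative frechet_derivative \<phi> (at x)) (at x)" using d by (simp add: frechet_derivative_works)
  from DERIV_compose_FDERIV[OF DERIV_soft_step[OF \<open>0 < s\<close>] this]
  have D: "((\<lambda>x. soft_step s (\<phi> x)) has_derivative
      (\<lambda>h. frechet_derivative \<phi> (at x) h * (2 * s\<^sup>2 * \<phi> x / (s\<^sup>2 + (\<phi> x)\<^sup>2)\<^sup>2))) (at x)" .
  then show "(\<lambda>x. soft_step s (\<phi> x)) differentiable (at x)" by (auto simp: differentiable_def)
  show "grad (\<lambda>x. soft_step s (\<phi> x)) x = (2 * s\<^sup>2 * \<phi> x / (s\<^sup>2 + (\<phi> x)\<^sup>2)\<^sup>2) *\<^sub>R grad \<phi> x"
    using grad_nth_eqI[OF D] by (simp add: vec_eq_iff) (simp add: grad_def)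
qed

definition level_meas :: "(real ^ 'n \<Rightarrow> real) \<Rightarrow> real \<Rightarrow> real" where
  "level_meas \<phi> s = measure lborel {x. s \<le> \<bar>\<phi> x\<bar>}"

definition weighted_energy :: "(real ^ 'n \<Rightarrow> real) \<Rightarrow> real \<Rightarrow> ennreal" where
  "weighted_energy \<phi> s = (\<integral>\<^sup>+x. ennreal (soft_weight s (\<phi> x) * (norm (grad \<phi> x))\<^sup>2) \<partial>lborel)"

definition dyadic_const :: "real \<Rightarrow> real" where
  "dyadic_const n = 4 * (200 / 9 * (2 / unit_ball_vol n) powr (2 / n)) * 8 powr ((2 / n) / (1 - 2 / n))"

lemma dyadic_const_nonneg: "0 \<le> dyadic_const n"
  by (simp add: dyadic_const_def)

lemma superlevel_set:
  fixes \<phi> :: "real ^ 'n \<Rightarrow> real"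
  assumes \<phi>: "\<phi> \<in> test_fun \<Omega>" and s: "0 < s"
  shows "{x. s \<le> \<bar>\<phi> x\<bar>} \<in> sets borel"
    and "emeasure lborel {x. s \<le> \<bar>\<phi> x\<bar>} = ennreal (level_meas \<phi> s)"
    and "{x. s \<le> \<bar>\<phi> x\<bar>} \<subseteq> closure {x. \<phi> x \<noteq> 0}"
proof -
  have [measurable]: "\<phi> \<in> borel_measurable borel"
    by (intro borel_measurable_continuous_onI test_funD[OF \<phi>])
  show *: "{x. s \<le> \<bar>\<phi> x\<bar>} \<in> sets borel" by measurable
  show sub: "{x. s \<le> \<bar>\<phi> x\<bar>} \<subseteq> closure {x. \<phi> x \<noteq> 0}"
    using s closure_subset[of "{x. \<phi> x \<noteq> 0}"] by auto
  have "emeasure lborel {x. s \<le> \<bar>\<phi> x\<bar>} \<le> emeasure lborel (closure {x. \<phi> x \<noteq> 0})"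
    using sub by (intro emeasure_mono) auto
  also have "\<dots> < \<infinity>" using emeasure_compact_finite[OF test_funD(4)[OF \<phi>]] by simp
  finally show "emeasure lborel {x. s \<le> \<bar>\<phi> x\<bar>} = ennreal (level_meas \<phi> s)"
    unfolding level_meas_def by (intro emeasure_eq_ennreal_measure) auto
qed

lemma level_meas_nonneg [simp]: "0 \<le> level_meas \<phi> s"
  by (simp add: level_meas_def)

lemma level_meas_antimono:
  assumes \<phi>: "\<phi> \<in> test_fun \<Omega>" and s: "0 < s" "s \<le> t"
  shows "level_meas \<phi> t \<le> level_meas \<phi> s"
proof -
  have t: "0 < t" using s by simp
  have "ennreal (level_meas \<phi> t) \<le> ennreal (level_meas \<phi> s)"
    unfolding superlevel_set(2)[OF \<phi> t, symmetric] superlevel_set(2)[OF \<phi> s(1), symmetric]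
    using s superlevel_set(1)[OF \<phi> s(1)] by (intro emeasure_mono) auto
  then show ?thesis by simp
qed

text \<open>
  One dyadic step. The gap estimate for \<open>v = soft_step s \<phi>\<close> bounds the measure at level \<open>2 s\<close> by
  \<open>C m(s)^{2/n}\<close> times the energy of \<open>v\<close>, and the dichotomy turns this into a contraction for
  \<open>s\<^sup>2 m(s)^\<theta>\<close> up to the energy at scale \<open>s\<close>.
\<close>

lemma level_decay:
  fixes \<phi> :: "real ^ 'n \<Rightarrow> real"
  assumes n: "CARD('n) \<ge> 3" and \<phi>: "\<phi> \<in> test_fun \<Omega>" and s: "0 < s"
  defines "\<theta> \<equiv> 1 - 2 / real CARD('n)"
  shows "ennreal ((2 * s)\<^sup>2 * level_meas \<phi> (2 * s) powr \<theta>)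
    \<le> ennreal (dyadic_const (real CARD('n))) * weighted_energy \<phi> s + ennreal (s\<^sup>2 * level_meas \<phi> s powr \<theta> / 2)"
proof -
  let ?n = "real CARD('n)"
  define m1 m2 where "m1 = level_meas \<phi> s" and "m2 = level_meas \<phi> (2 * s)"
  have m: "0 \<le> m2" "m2 \<le> m1" using level_meas_antimono[OF \<phi> s, of "2 * s"] s by (simp_all add: m1_def m2_def)
  have "unit_ball_vol ?n \<noteq> 0" using unit_ball_vol_pos[of ?n] by linarith
  then have C0: "0 < dyadic_const ?n" by (simp add: dyadic_const_def)
  consider "m2 = 0" | "0 < m2" "weighted_energy \<phi> s = \<infinity>" | d where "0 < m2" "weighted_energy \<phi> s = ennreal d" "0 \<le> d"
    using m by (cases "weighted_energy \<phi> s") (auto simp: le_less)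
  then show ?thesis
  proof cases
    case 1
    then show ?thesis by (simp flip: m2_def)
  next
    case 2
    then show ?thesis using C0 by (simp add: ennreal_mult_top)
  next
    case (3 d)
    define v where "v x = soft_step s (\<phi> x)" for x
    have dv: "v differentiable (at x)" for x
      unfolding v_def[abs_def] by (intro grad_soft_step s test_funD[OF \<phi>])
    have gv: "grad v x = (2 * s\<^sup>2 * \<phi> x / (s\<^sup>2 + (\<phi> x)\<^sup>2)\<^sup>2) *\<^sub>R grad \<phi> x" for x
      unfolding v_def[abs_def] by (intro grad_soft_step s test_funD[OF \<phi>])
    have cv: "continuous_on UNIV (grad v)"
    proof -
      have "s\<^sup>2 + t\<^sup>2 \<noteq> 0" for t using s by (simp add: sum_power2_eq_zero_iff)
      then show ?thesis
        unfolding gv[abs_def] by (intro continuous_intros test_funD[OF \<phi>]) auto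
    qed
    have e: "ennreal (s\<^sup>2) * (\<integral>\<^sup>+x. ennreal ((norm (grad v x))\<^sup>2) \<partial>lborel) = ennreal d"
    proof -
      have [measurable]: "grad v \<in> borel_measurable borel" using cv by (rule borel_measurable_continuous_onI)
      have "ennreal (s\<^sup>2) * (\<integral>\<^sup>+x. ennreal ((norm (grad v x))\<^sup>2) \<partial>lborel)
          = (\<integral>\<^sup>+x. ennreal (s\<^sup>2) * ennreal ((norm (grad v x))\<^sup>2) \<partial>lborel)"
        by (rule nn_integral_cmult[symmetric]) measurable
      also have "\<dots> = weighted_energy \<phi> s"
        unfolding weighted_energy_def
        by (intro nn_integral_cong) (simp add: gv soft_weight_def power_mult_distrib power_divide flip: ennreal_mult)
      finally show ?thesis using 3 by simp
    qed
    define C where "C = 200 / 9 * (2 / unit_ball_vol ?n) powr (2 / ?n)"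
    have "emeasure lborel {x. 2 * s \<le> \<bar>\<phi> x\<bar>}
        \<le> ennreal (200 / 9 * (2 * m1 / unit_ball_vol ?n) powr (2 / ?n)) * (\<integral>\<^sup>+x. ennreal ((norm (grad v x))\<^sup>2) \<partial>lborel)"
    proof (rule superlevel_gap_estimate[OF dv cv])
      show "{x. 2 * s \<le> \<bar>\<phi> x\<bar>} \<in> sets borel" "{x. s \<le> \<bar>\<phi> x\<bar>} \<in> sets borel"
        using s by (auto intro!: superlevel_set[OF \<phi>])
      show "emeasure lborel {x. s \<le> \<bar>\<phi> x\<bar>} = ennreal m1" unfolding m1_def by (rule superlevel_set[OF \<phi> s])
      show "0 < m1" using 3 m by simp
      fix x y assume "x \<in> {x. 2 * s \<le> \<bar>\<phi> x\<bar>}" "y \<notin> {x. s \<le> \<bar>\<phi> x\<bar>}"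
      then show "3 / 10 \<le> v x - v y" unfolding v_def by (intro soft_step_gap s) auto
    qed
    also have "emeasure lborel {x. 2 * s \<le> \<bar>\<phi> x\<bar>} = ennreal m2"
      unfolding m2_def using s by (intro superlevel_set[OF \<phi>]) simp
    also have "200 / 9 * (2 * m1 / unit_ball_vol ?n) powr (2 / ?n) = C * m1 powr (2 / ?n)"
    proof -
      have "2 * m1 / unit_ball_vol ?n = 2 / unit_ball_vol ?n * m1" by simp
      then show ?thesis unfolding C_def using m by (simp only: powr_mult mult.assoc)
    qed
    finally have "ennreal (s\<^sup>2) * ennreal m2 \<le> ennreal (s\<^sup>2) *
        (ennreal (C * m1 powr (2 / ?n)) * (\<integral>\<^sup>+x. ennreal ((norm (grad v x))\<^sup>2) \<partial>lborel))"
      by (rule mult_left_mono) simp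
    also have "\<dots> = ennreal (C * m1 powr (2 / ?n)) * ennreal d"
      unfolding e[symmetric] by (rule mult.left_commute)
    also have "\<dots> = ennreal (C * m1 powr (2 / ?n) * d)"
      using 3(3) by (rule ennreal_mult''[symmetric])
    finally have "ennreal (s\<^sup>2 * m2) \<le> ennreal (C * m1 powr (2 / ?n) * d)"
      using m by (simp add: ennreal_mult)
    then have "s\<^sup>2 * m2 \<le> C * m1 powr (2 / ?n) * d"
      using 3 by (simp add: C_def)
    then have "(2 * s)\<^sup>2 * m2 powr (1 - 2 / ?n)
      \<le> 4 * C * (8 powr (2 / ?n / (1 - 2 / ?n))) * d + s\<^sup>2 * m1 powr (1 - 2 / ?n) / 2"
      using n 3 m by (intro level_decay_dichotomy) (auto simp: C_def)
    also have "4 * C * (8 powr (2 / ?n / (1 - 2 / ?n))) = dyadic_const ?n"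
      by (simp add: dyadic_const_def C_def)
    finally have "ennreal ((2 * s)\<^sup>2 * m2 powr \<theta>) \<le> ennreal (dyadic_const ?n * d + s\<^sup>2 * m1 powr \<theta> / 2)"
      unfolding \<theta>_def by (rule ennreal_leI)
    also have "\<dots> = ennreal (dyadic_const ?n) * ennreal d + ennreal (s\<^sup>2 * m1 powr \<theta> / 2)"
      using C0 3 by (simp add: ennreal_plus ennreal_mult)
    finally show ?thesis using 3 by (simp add: m1_def m2_def)
  qed
qed

text \<open>
  The energies at different scales overlap, but the weights telescope pointwise.
\<close>

lemma sum_weighted_energy_le:
  fixes \<phi> :: "real ^ 'n \<Rightarrow> real"
  assumes \<phi>: "\<phi> \<in> test_fun \<Omega>" and \<epsilon>: "0 < \<epsilon>"
  shows "(\<Sum>j<J. weighted_energy \<phi> (\<epsilon> * 2 ^ j)) \<le> ennreal (16 / 3) * (\<integral>\<^sup>+x. ennreal ((norm (grad \<phi> x))\<^sup>2) \<partial>lborel)"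
proof -
  have [measurable]: "\<phi> \<in> borel_measurable borel" "grad \<phi> \<in> borel_measurable borel"
    by (intro borel_measurable_continuous_onI test_funD[OF \<phi>])+
  have nn: "0 \<le> soft_weight s t" for s t by (simp add: soft_weight_def)
  have "(\<Sum>j<J. weighted_energy \<phi> (\<epsilon> * 2 ^ j))
      = (\<integral>\<^sup>+x. (\<Sum>j<J. ennreal (soft_weight (\<epsilon> * 2 ^ j) (\<phi> x) * (norm (grad \<phi> x))\<^sup>2)) \<partial>lborel)"
    unfolding weighted_energy_def soft_weight_def by (rule nn_integral_sum[symmetric]) measurable
  also have "\<dots> \<le> (\<integral>\<^sup>+x. ennreal (16 / 3) * ennreal ((norm (grad \<phi> x))\<^sup>2) \<partial>lborel)"
  proof (rule nn_integral_mono)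
    fix x
    have "(\<Sum>j<J. ennreal (soft_weight (\<epsilon> * 2 ^ j) (\<phi> x) * (norm (grad \<phi> x))\<^sup>2))
        = ennreal ((\<Sum>j<J. soft_weight (\<epsilon> * 2 ^ j) (\<phi> x)) * (norm (grad \<phi> x))\<^sup>2)"
      by (simp add: nn sum_distrib_right)
    also have "\<dots> \<le> ennreal (16 / 3 * (norm (grad \<phi> x))\<^sup>2)"
      by (intro ennreal_leI mult_right_mono sum_soft_weight_le \<epsilon>) simp
    also have "\<dots> = ennreal (16 / 3) * ennreal ((norm (grad \<phi> x))\<^sup>2)" by (rule ennreal_mult) auto
    finally show "(\<Sum>j<J. ennreal (soft_weight (\<epsilon> * 2 ^ j) (\<phi> x) * (norm (grad \<phi> x))\<^sup>2))
        \<le> ennreal (16 / 3) * ennreal ((norm (grad \<phi> x))\<^sup>2)" .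
  qed
  also have "\<dots> = ennreal (16 / 3) * (\<integral>\<^sup>+x. ennreal ((norm (grad \<phi> x))\<^sup>2) \<partial>lborel)"
    by (rule nn_integral_cmult) measurable
  finally show ?thesis .
qed

text \<open>
  Iterating \<open>a(j+1) \<le> c e(j) + a(j) / 2\<close>; the invariant carries \<open>2 a(J)\<close> so that the factor one half
  is absorbed. As \<open>J\<close> grows, the sum becomes comparable to the square of the \<open>L^{2^*,2}\<close> norm of the part
  of \<open>\<phi>\<close> above height \<open>\<epsilon>\<close>.
\<close>

lemma sum_level_le:
  fixes \<phi> :: "real ^ 'n \<Rightarrow> real"
  assumes n: "CARD('n) \<ge> 3" and \<phi>: "\<phi> \<in> test_fun \<Omega>" and \<epsilon>: "0 < \<epsilon>"
  defines "\<theta> \<equiv> 1 - 2 / real CARD('n)"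
  shows "(\<Sum>j<J. ennreal ((\<epsilon> * 2 ^ j)\<^sup>2 * level_meas \<phi> (\<epsilon> * 2 ^ j) powr \<theta>))
    \<le> ennreal (2 * \<epsilon>\<^sup>2 * level_meas \<phi> \<epsilon> powr \<theta>)
      + ennreal (32 / 3 * dyadic_const (real CARD('n))) * (\<integral>\<^sup>+x. ennreal ((norm (grad \<phi> x))\<^sup>2) \<partial>lborel)"
proof -
  let ?c = "ennreal (dyadic_const (real CARD('n)))"
  define a where "a j = (\<epsilon> * 2 ^ j)\<^sup>2 * level_meas \<phi> (\<epsilon> * 2 ^ j) powr \<theta>" for j
  define e where "e j = weighted_energy \<phi> (\<epsilon> * 2 ^ j)" for j
  have a0: "0 \<le> a j" for j by (simp add: a_def)
  have step: "2 * ennreal (a (Suc j)) \<le> 2 * ?c * e j + ennreal (a j)" for j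
  proof -
    have "2 * (\<epsilon> * 2 ^ j) = \<epsilon> * 2 ^ Suc j" by simp
    then have "ennreal (a (Suc j)) \<le> ?c * e j + ennreal (a j / 2)"
      using level_decay[OF n \<phi>, of "\<epsilon> * 2 ^ j"] \<epsilon> unfolding a_def e_def \<theta>_def by (metis mult_pos_pos zero_less_power zero_less_numeral)
    then have "2 * ennreal (a (Suc j)) \<le> 2 * (?c * e j + ennreal (a j / 2))" by (rule mult_left_mono) simp
    also have "\<dots> = 2 * ?c * e j + 2 * ennreal (a j / 2)" by (simp add: distrib_left mult.assoc)
    also have "2 * ennreal (a j / 2) = ennreal (2 * (a j / 2))"
      using a0[of j] by (subst ennreal_mult) auto
    finally show ?thesis by simp
  qed
  have alg: "S + x + (y + x) = S + 2 * x + y" for S x y :: ennreal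
    by (simp only: mult_2 add_ac)
  have "(\<Sum>j<J. ennreal (a j)) + 2 * ennreal (a J) \<le> 2 * ennreal (a 0) + 2 * ?c * (\<Sum>j<J. e j)"
  proof (induction J)
    case 0 show ?case by simp
  next
    case (Suc J)
    have "(\<Sum>j<Suc J. ennreal (a j)) + 2 * ennreal (a (Suc J))
        \<le> (\<Sum>j<Suc J. ennreal (a j)) + (2 * ?c * e J + ennreal (a J))"
      by (intro add_left_mono step)
    also have "\<dots> = ((\<Sum>j<J. ennreal (a j)) + 2 * ennreal (a J)) + 2 * ?c * e J"
      unfolding sum.lessThan_Suc by (rule alg)
    also have "\<dots> \<le> (2 * ennreal (a 0) + 2 * ?c * (\<Sum>j<J. e j)) + 2 * ?c * e J"
      by (intro add_right_mono Suc)
    also have "\<dots> = 2 * ennreal (a 0) + 2 * ?c * (\<Sum>j<Suc J. e j)"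
      unfolding sum.lessThan_Suc distrib_left by (rule add.assoc)
    finally show ?case .
  qed
  then have "(\<Sum>j<J. ennreal (a j)) \<le> 2 * ennreal (a 0) + 2 * ?c * (\<Sum>j<J. e j)"
    by (rule order_trans[rotated]) simp
  also have "\<dots> \<le> 2 * ennreal (a 0) + 2 * ?c * (ennreal (16 / 3) * (\<integral>\<^sup>+x. ennreal ((norm (grad \<phi> x))\<^sup>2) \<partial>lborel))"
    unfolding e_def by (intro add_left_mono mult_left_mono sum_weighted_energy_le[OF \<phi> \<epsilon>]) simp
  also have "2 * ennreal (a 0) = ennreal (2 * a 0)"
    using a0[of 0] by (subst ennreal_mult) auto
  also have "2 * ?c * (ennreal (16 / 3) * (\<integral>\<^sup>+x. ennreal ((norm (grad \<phi> x))\<^sup>2) \<partial>lborel))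
      = (2 * ?c * ennreal (16 / 3)) * (\<integral>\<^sup>+x. ennreal ((norm (grad \<phi> x))\<^sup>2) \<partial>lborel)" by (simp add: mult.assoc)
  also have "2 * ?c * ennreal (16 / 3) = ennreal (2 * dyadic_const (real CARD('n)) * (16 / 3))"
  proof -
    have "2 * ?c = ennreal (2 * dyadic_const (real CARD('n)))"
      using dyadic_const_nonneg[of "real CARD('n)"] by (subst ennreal_mult) auto
    then show ?thesis
      using dyadic_const_nonneg[of "real CARD('n)"] by (simp only:) (rule ennreal_mult[symmetric]; simp)
  qed
  also have "2 * a 0 = 2 * \<epsilon>\<^sup>2 * level_meas \<phi> \<epsilon> powr \<theta>" by (simp add: a_def)
  also have "2 * dyadic_const (real CARD('n)) * (16 / 3) = 32 / 3 * dyadic_const (real CARD('n))" by simp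
  finally show ?thesis unfolding a_def .
qed

lemma test_fun_square_le_levels:
  fixes \<phi> :: "real ^ 'n \<Rightarrow> real"
  assumes \<phi>: "\<phi> \<in> test_fun \<Omega>" and \<epsilon>: "0 < \<epsilon>" and J: "\<And>x. \<bar>\<phi> x\<bar> < \<epsilon> * 2 ^ J"
  shows "ennreal ((\<phi> x)\<^sup>2) \<le> ennreal (\<epsilon>\<^sup>2) * indicator (closure {x. \<phi> x \<noteq> 0}) x
    + (\<Sum>j<J. ennreal (4 * (\<epsilon> * 2 ^ j)\<^sup>2) * indicator {x. \<epsilon> * 2 ^ j \<le> \<bar>\<phi> x\<bar>} x)"
proof (cases "\<bar>\<phi> x\<bar> < \<epsilon>")
  case True
  show ?thesis
  proof (cases "\<phi> x = 0")
    case False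
    then have "x \<in> closure {x. \<phi> x \<noteq> 0}" using closure_subset[of "{x. \<phi> x \<noteq> 0}"] by auto
    moreover have "(\<phi> x)\<^sup>2 \<le> \<epsilon>\<^sup>2" using True by (intro power2_le_iff_abs_le[THEN iffD2]) auto
    ultimately show ?thesis by (auto intro!: order_trans[OF ennreal_leI[OF \<open>(\<phi> x)\<^sup>2 \<le> \<epsilon>\<^sup>2\<close>]])
  qed simp
next
  case False
  define k where "k = (LEAST k. \<bar>\<phi> x\<bar> < \<epsilon> * 2 ^ k)"
  have k: "\<bar>\<phi> x\<bar> < \<epsilon> * 2 ^ k" unfolding k_def using J by (rule LeastI)
  have kJ: "k \<le> J" unfolding k_def using J by (rule Least_le)
  have "k \<noteq> 0" using k False by (intro notI) simp
  then obtain j where j: "k = Suc j" by (cases k) auto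
  then have l: "\<epsilon> * 2 ^ j \<le> \<bar>\<phi> x\<bar>"
    using not_less_Least[of j "\<lambda>k. \<bar>\<phi> x\<bar> < \<epsilon> * 2 ^ k"] by (auto simp: k_def not_less)
  have "\<bar>\<phi> x\<bar>\<^sup>2 \<le> (\<epsilon> * 2 ^ k)\<^sup>2" using k by (intro power_mono) auto
  then have "(\<phi> x)\<^sup>2 \<le> 4 * (\<epsilon> * 2 ^ j)\<^sup>2" by (simp add: j power_mult_distrib)
  then have "ennreal ((\<phi> x)\<^sup>2) \<le> ennreal (4 * (\<epsilon> * 2 ^ j)\<^sup>2) * indicator {x. \<epsilon> * 2 ^ j \<le> \<bar>\<phi> x\<bar>} x"
    using l by (simp add: ennreal_leI)
  also have "\<dots> \<le> (\<Sum>j<J. ennreal (4 * (\<epsilon> * 2 ^ j)\<^sup>2) * indicator {x. \<epsilon> * 2 ^ j \<le> \<bar>\<phi> x\<bar>} x)"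
    using kJ j by (intro member_le_sum) auto
  also have "\<dots> \<le> ennreal (\<epsilon>\<^sup>2) * indicator (closure {x. \<phi> x \<noteq> 0}) x + \<dots>" by simp
  finally show ?thesis .
qed

text \<open>
  Membership in weak \<open>L^\<alpha>\<close>, the only consequence of the Lorentz norms of the coefficients that is used.
\<close>

definition weak_type :: "real \<Rightarrow> ('a::euclidean_space \<Rightarrow> real) \<Rightarrow> bool" where
  "weak_type \<alpha> V \<longleftrightarrow> V \<in> borel_measurable lebesgue \<and> (\<forall>x. 0 \<le> V x) \<and>
     (\<exists>K>0. \<forall>t>0. emeasure lebesgue {x. t < V x} \<le> ennreal (K * t powr (- \<alpha>)))"

text \<open>
  Splitting \<open>\<phi>\<^sup>2\<close> into dyadic layers, each layer contributes at most a multiple of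
  \<open>s\<^sup>2 m(s)^{1 - 2/n}\<close> because \<open>V\<close> is in
  weak \<open>L^{n/2}\<close>. The part of \<open>\<phi>\<close> below \<open>\<epsilon>\<close> lives on the support of \<open>\<phi>\<close> and vanishes as \<open>\<epsilon>\<close> tends to zero.
\<close>

lemma weak_type_Hardy_inequality:
  fixes V :: "real ^ 'n \<Rightarrow> real"
  assumes n: "CARD('n) \<ge> 3" and V: "weak_type (real CARD('n) / 2) V"
  shows "\<exists>C. \<forall>\<phi>\<in>test_fun \<Omega>. (\<integral>\<^sup>+x. ennreal (V x * (\<phi> x)\<^sup>2) \<partial>lebesgue)
    \<le> ennreal C * (\<integral>\<^sup>+x. ennreal ((norm (grad \<phi> x))\<^sup>2) \<partial>lborel)"
proof -
  define \<alpha> where "\<alpha> = real CARD('n) / 2"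
  define \<theta> where "\<theta> = 1 - 2 / real CARD('n)"
  have \<alpha>: "1 < \<alpha>" and \<theta>: "0 < \<theta>" "1 - 1 / \<alpha> = \<theta>" using n by (auto simp: \<alpha>_def \<theta>_def)
  have Vm [measurable]: "V \<in> borel_measurable lebesgue" and V0: "0 \<le> V x" for x
    using V by (auto simp: weak_type_def)
  obtain K where K: "0 < K" "\<And>t. 0 < t \<Longrightarrow> emeasure lebesgue {x. t < V x} \<le> ennreal (K * t powr (- \<alpha>))"
    using V unfolding weak_type_def \<alpha>_def by blast
  define A where "A = K powr (1 / \<alpha>) * (1 + 2 / (1 - 2 powr (1 - \<alpha>)))"
  have "2 powr (1 - \<alpha>) < 1" using \<alpha> by (simp add: powr_less_one)
  then have A0: "0 \<le> A" by (simp add: A_def)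
  have VE: "(\<integral>\<^sup>+x. ennreal (V x) * indicator E x \<partial>lebesgue) \<le> ennreal (A * m powr \<theta>)"
    if "E \<in> sets borel" "emeasure lborel E = ennreal m" "0 \<le> m" for E m
    using nn_integral_weak_Lebesgue_bound[OF Vm K(1) \<alpha> _ _ _ that(3), of E] that K(2)
    by (simp add: A_def \<theta>)
  show ?thesis
  proof (intro exI[of _ "4 * A * (32 / 3 * dyadic_const (real CARD('n)))"] ballI)
    fix \<phi> assume \<phi>: "\<phi> \<in> test_fun \<Omega>"
    let ?S = "closure {x. \<phi> x \<noteq> 0}" and ?N = "\<integral>\<^sup>+x. ennreal ((norm (grad \<phi> x))\<^sup>2) \<partial>lborel"
    let ?X = "\<integral>\<^sup>+x. ennreal (V x * (\<phi> x)\<^sup>2) \<partial>lebesgue"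
    define \<sigma> where "\<sigma> = measure lborel ?S"
    have \<sigma>: "emeasure lborel ?S = ennreal \<sigma>" "0 \<le> \<sigma>"
      using emeasure_compact_finite[OF test_funD(4)[OF \<phi>]] by (auto simp: \<sigma>_def emeasure_eq_ennreal_measure)
    obtain B where B: "0 < B" "\<And>x. \<bar>\<phi> x\<bar> \<le> B"
    proof -
      have "compact (\<phi> ` ?S)"
        by (intro compact_continuous_image continuous_on_subset[OF test_funD(1)[OF \<phi>]] test_funD[OF \<phi>]) auto
      then obtain B where "0 < B" "\<And>x. x \<in> ?S \<Longrightarrow> norm (\<phi> x) \<le> B"
        using compact_imp_bounded[of "\<phi> ` ?S"] by (auto simp: bounded_pos)
      then have "\<bar>\<phi> x\<bar> \<le> B" for x
        using closure_subset[of "{x. \<phi> x \<noteq> 0}"] by (cases "\<phi> x = 0") auto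
      with \<open>0 < B\<close> that show ?thesis by blast
    qed
    have main: "?X \<le> ennreal (9 * A * \<sigma> powr \<theta> * \<epsilon>\<^sup>2) + ennreal (4 * A * (32 / 3 * dyadic_const (real CARD('n)))) * ?N"
      if \<epsilon>: "0 < \<epsilon>" for \<epsilon>
    proof -
      obtain J where "B / \<epsilon> < 2 ^ J" using real_arch_pow[of 2 "B / \<epsilon>"] by auto
      then have "B < \<epsilon> * 2 ^ J" using \<epsilon> by (simp add: field_simps)
      then have J: "\<bar>\<phi> x\<bar> < \<epsilon> * 2 ^ J" for x using B(2)[of x] by simp
      define L where "L j = {x. \<epsilon> * 2 ^ j \<le> \<bar>\<phi> x\<bar>}" for j :: nat
      define a where "a j = (\<epsilon> * 2 ^ j)\<^sup>2 * level_meas \<phi> (\<epsilon> * 2 ^ j) powr \<theta>" for j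
      have Lb: "L j \<in> sets borel" "emeasure lborel (L j) = ennreal (level_meas \<phi> (\<epsilon> * 2 ^ j))" for j
        using superlevel_set[OF \<phi>, of "\<epsilon> * 2 ^ j"] \<epsilon> by (auto simp: L_def)
      have [measurable]: "L j \<in> sets lebesgue" for j using Lb(1)[of j] by simp
      have [measurable]: "?S \<in> sets lebesgue" by simp
      have "?X \<le> (\<integral>\<^sup>+x. ennreal (\<epsilon>\<^sup>2) * (ennreal (V x) * indicator ?S x)
          + (\<Sum>j<J. ennreal (4 * (\<epsilon> * 2 ^ j)\<^sup>2) * (ennreal (V x) * indicator (L j) x)) \<partial>lebesgue)"
      proof (rule nn_integral_mono)
        fix x
        have "ennreal (V x * (\<phi> x)\<^sup>2) = ennreal (V x) * ennreal ((\<phi> x)\<^sup>2)" using V0 by (simp add: ennreal_mult)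
        also have "\<dots> \<le> ennreal (V x) * (ennreal (\<epsilon>\<^sup>2) * indicator ?S x
            + (\<Sum>j<J. ennreal (4 * (\<epsilon> * 2 ^ j)\<^sup>2) * indicator (L j) x))"
          unfolding L_def by (intro mult_left_mono test_fun_square_le_levels[OF \<phi> \<epsilon> J]) simp
        also have "\<dots> = ennreal (\<epsilon>\<^sup>2) * (ennreal (V x) * indicator ?S x)
          + (\<Sum>j<J. ennreal (4 * (\<epsilon> * 2 ^ j)\<^sup>2) * (ennreal (V x) * indicator (L j) x))"
          by (simp only: distrib_left sum_distrib_left mult.left_commute[of "ennreal (V x)"])
        finally show "ennreal (V x * (\<phi> x)\<^sup>2) \<le> \<dots>" .
      qed
      also have "\<dots> = ennreal (\<epsilon>\<^sup>2) * (\<integral>\<^sup>+x. ennreal (V x) * indicator ?S x \<partial>lebesgue)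
          + (\<Sum>j<J. ennreal (4 * (\<epsilon> * 2 ^ j)\<^sup>2) * (\<integral>\<^sup>+x. ennreal (V x) * indicator (L j) x \<partial>lebesgue))"
        by (simp add: nn_integral_add nn_integral_sum nn_integral_cmult)
      also have "\<dots> \<le> ennreal (\<epsilon>\<^sup>2) * ennreal (A * \<sigma> powr \<theta>)
          + (\<Sum>j<J. ennreal (4 * (\<epsilon> * 2 ^ j)\<^sup>2) * ennreal (A * level_meas \<phi> (\<epsilon> * 2 ^ j) powr \<theta>))"
        using \<sigma> Lb by (intro add_mono sum_mono mult_left_mono VE) auto
      also have "(\<Sum>j<J. ennreal (4 * (\<epsilon> * 2 ^ j)\<^sup>2) * ennreal (A * level_meas \<phi> (\<epsilon> * 2 ^ j) powr \<theta>))
          = ennreal (4 * A) * (\<Sum>j<J. ennreal (a j))"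
      proof -
        have "ennreal (4 * (\<epsilon> * 2 ^ j)\<^sup>2) * ennreal (A * level_meas \<phi> (\<epsilon> * 2 ^ j) powr \<theta>) = ennreal (4 * A) * ennreal (a j)" for j
        proof -
          have "ennreal (4 * (\<epsilon> * 2 ^ j)\<^sup>2) * ennreal (A * level_meas \<phi> (\<epsilon> * 2 ^ j) powr \<theta>)
              = ennreal ((4 * (\<epsilon> * 2 ^ j)\<^sup>2) * (A * level_meas \<phi> (\<epsilon> * 2 ^ j) powr \<theta>))"
            using A0 by (intro ennreal_mult[symmetric]) auto
          also have "(4 * (\<epsilon> * 2 ^ j)\<^sup>2) * (A * level_meas \<phi> (\<epsilon> * 2 ^ j) powr \<theta>) = (4 * A) * a j"
            by (simp add: a_def)
          also have "ennreal \<dots> = ennreal (4 * A) * ennreal (a j)"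
            using A0 by (intro ennreal_mult) (auto simp: a_def)
          finally show ?thesis .
        qed
        then show ?thesis by (simp only: sum_distrib_left)
      qed
      finally have 1: "?X \<le> ennreal (\<epsilon>\<^sup>2) * ennreal (A * \<sigma> powr \<theta>) + ennreal (4 * A) * (\<Sum>j<J. ennreal (a j))" .
      have lev: "ennreal (2 * \<epsilon>\<^sup>2 * level_meas \<phi> \<epsilon> powr \<theta>) \<le> ennreal (2 * \<epsilon>\<^sup>2 * \<sigma> powr \<theta>)"
      proof -
        have "ennreal (level_meas \<phi> \<epsilon>) \<le> ennreal \<sigma>"
          unfolding superlevel_set(2)[OF \<phi> \<epsilon>, symmetric] \<sigma>(1)[symmetric]
          using superlevel_set[OF \<phi> \<epsilon>] by (intro emeasure_mono) auto
        then have "level_meas \<phi> \<epsilon> \<le> \<sigma>" using \<sigma> by simp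
        then show ?thesis using \<theta> by (intro ennreal_leI mult_left_mono powr_mono2) auto
      qed
      have "(\<Sum>j<J. ennreal (a j)) \<le> ennreal (2 * \<epsilon>\<^sup>2 * level_meas \<phi> \<epsilon> powr \<theta>)
          + ennreal (32 / 3 * dyadic_const (real CARD('n))) * ?N"
        unfolding a_def \<theta>_def by (rule sum_level_le[OF n \<phi> \<epsilon>])
      also have "\<dots> \<le> ennreal (2 * \<epsilon>\<^sup>2 * \<sigma> powr \<theta>) + ennreal (32 / 3 * dyadic_const (real CARD('n))) * ?N"
        by (intro add_right_mono lev)
      finally have 2: "(\<Sum>j<J. ennreal (a j))
          \<le> ennreal (2 * \<epsilon>\<^sup>2 * \<sigma> powr \<theta>) + ennreal (32 / 3 * dyadic_const (real CARD('n))) * ?N" .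
      note 1
      also have "ennreal (\<epsilon>\<^sup>2) * ennreal (A * \<sigma> powr \<theta>) + ennreal (4 * A) * (\<Sum>j<J. ennreal (a j))
        \<le> ennreal (\<epsilon>\<^sup>2) * ennreal (A * \<sigma> powr \<theta>) + ennreal (4 * A) *
          (ennreal (2 * \<epsilon>\<^sup>2 * \<sigma> powr \<theta>) + ennreal (32 / 3 * dyadic_const (real CARD('n))) * ?N)"
        by (intro add_left_mono mult_left_mono 2) simp
      also have "\<dots> = (ennreal (\<epsilon>\<^sup>2) * ennreal (A * \<sigma> powr \<theta>) + ennreal (4 * A) * ennreal (2 * \<epsilon>\<^sup>2 * \<sigma> powr \<theta>))
          + ennreal (4 * A) * ennreal (32 / 3 * dyadic_const (real CARD('n))) * ?N"
        by (simp only: distrib_left add.assoc mult.assoc)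
      also have "ennreal (\<epsilon>\<^sup>2) * ennreal (A * \<sigma> powr \<theta>) + ennreal (4 * A) * ennreal (2 * \<epsilon>\<^sup>2 * \<sigma> powr \<theta>)
          = ennreal (9 * A * \<sigma> powr \<theta> * \<epsilon>\<^sup>2)"
      proof -
        have "ennreal (\<epsilon>\<^sup>2) * ennreal (A * \<sigma> powr \<theta>) = ennreal (\<epsilon>\<^sup>2 * (A * \<sigma> powr \<theta>))"
          using A0 by (intro ennreal_mult[symmetric]) auto
        moreover have "ennreal (4 * A) * ennreal (2 * \<epsilon>\<^sup>2 * \<sigma> powr \<theta>) = ennreal (4 * A * (2 * \<epsilon>\<^sup>2 * \<sigma> powr \<theta>))"
          using A0 by (intro ennreal_mult[symmetric]) auto
        moreover have "ennreal (\<epsilon>\<^sup>2 * (A * \<sigma> powr \<theta>)) + ennreal (4 * A * (2 * \<epsilon>\<^sup>2 * \<sigma> powr \<theta>))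
            = ennreal (\<epsilon>\<^sup>2 * (A * \<sigma> powr \<theta>) + 4 * A * (2 * \<epsilon>\<^sup>2 * \<sigma> powr \<theta>))"
          using A0 by (intro ennreal_plus[symmetric]) auto
        moreover have "\<epsilon>\<^sup>2 * (A * \<sigma> powr \<theta>) + 4 * A * (2 * \<epsilon>\<^sup>2 * \<sigma> powr \<theta>) = 9 * A * \<sigma> powr \<theta> * \<epsilon>\<^sup>2"
          by (simp add: algebra_simps)
        ultimately show ?thesis by (simp only:)
      qed
      also have "ennreal (4 * A) * ennreal (32 / 3 * dyadic_const (real CARD('n)))
          = ennreal (4 * A * (32 / 3 * dyadic_const (real CARD('n))))"
        using A0 dyadic_const_nonneg by (intro ennreal_mult[symmetric]) auto
      finally show ?thesis .
    qed
    show "?X \<le> ennreal (4 * A * (32 / 3 * dyadic_const (real CARD('n)))) * ?N"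
    proof (rule ennreal_le_epsilon)
      fix e :: real assume "0 < e"
      define c where "c = 9 * A * \<sigma> powr \<theta>"
      define \<epsilon> where "\<epsilon> = sqrt (e / (c + 1))"
      have c: "0 \<le> c" using A0 by (simp add: c_def)
      have "0 < e / (c + 1)" using c \<open>0 < e\<close> by simp
      then have \<epsilon>: "0 < \<epsilon>" and \<epsilon>2: "\<epsilon>\<^sup>2 = e / (c + 1)"
        unfolding \<epsilon>_def by (simp, intro real_sqrt_pow2, linarith)
      have "c * \<epsilon>\<^sup>2 \<le> (c + 1) * \<epsilon>\<^sup>2" by (intro mult_right_mono) auto
      also have "\<dots> = e" using c by (simp add: \<epsilon>2)
      finally have "ennreal (c * \<epsilon>\<^sup>2) \<le> ennreal e" by (rule ennreal_leI)
      then have "ennreal (c * \<epsilon>\<^sup>2) + ennreal (4 * A * (32 / 3 * dyadic_const (real CARD('n)))) * ?N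
          \<le> ennreal e + ennreal (4 * A * (32 / 3 * dyadic_const (real CARD('n)))) * ?N"
        by (rule add_right_mono)
      with main[OF \<epsilon>, folded c_def] show "?X \<le> ennreal (4 * A * (32 / 3 * dyadic_const (real CARD('n)))) * ?N + ennreal e"
        unfolding add.commute[of _ "ennreal e"] by (rule order_trans)
    qed
  qed
qed

section \<open>Lorentz spaces and distribution functions\<close>

lemma epowr_mono_ennreal:
  assumes "ennreal y \<le> x" "0 \<le> y" "0 < a"
  shows "ennreal (y powr a) \<le> epowr x a"
proof (cases x)
  case (real r)
  then have "y \<le> r" using assms by simp
  then show ?thesis using assms real by (simp add: epowr_def powr_mono2)
qed (simp add: epowr_def)

lemma distr_fun_antimono:
  assumes "(f :: real ^ 'n \<Rightarrow> 'b::euclidean_space) \<in> borel_measurable (lebesgue_on \<Omega>)" "s \<le> t"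
  shows "distr_fun \<Omega> f t \<le> distr_fun \<Omega> f s"
  unfolding distr_fun_def
proof (rule emeasure_mono)
  have "{x \<in> space (lebesgue_on \<Omega>). s < norm (f x)} \<in> sets (lebesgue_on \<Omega>)"
    using assms(1) by measurable
  then show "{x \<in> \<Omega>. s < norm (f x)} \<in> sets (lebesgue_on \<Omega>)" by simp
qed (use assms in auto)

text \<open>
  The rearrangement is a generalised inverse of the distribution function.
\<close>

lemma rearr_ge:
  fixes f :: "real ^ 'n \<Rightarrow> 'b::euclidean_space"
  assumes f: "f \<in> borel_measurable (lebesgue_on \<Omega>)" and s: "ennreal s < distr_fun \<Omega> f t" and \<sigma>: "\<sigma> \<le> s"
  shows "ennreal t \<le> rearr \<Omega> f \<sigma>"
  unfolding rearr_def
proof (rule Inf_greatest, safe)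
  fix u assume "distr_fun \<Omega> f u \<le> ennreal \<sigma>"
  also have "ennreal \<sigma> \<le> ennreal s" using \<sigma> by (rule ennreal_leI)
  also note s
  finally have "distr_fun \<Omega> f u < distr_fun \<Omega> f t" .
  then have "t \<le> u" using distr_fun_antimono[OF f, of u t] by (cases "t \<le> u") auto
  then show "ennreal t \<le> ennreal u" by (rule ennreal_leI)
qed

lemma ennreal_le_if_all_less:
  assumes "\<And>s. 0 < s \<Longrightarrow> ennreal s < x \<Longrightarrow> s \<le> y" and "0 \<le> y"
  shows "x \<le> ennreal y"
proof (rule ccontr)
  assume "\<not> x \<le> ennreal y"
  then have "ennreal y < x" by simp
  then obtain z where z: "ennreal y < z" "z < x" using dense by blast
  then obtain s where s: "z = ennreal s" "0 \<le> s" by (cases z) auto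
  with z assms(2) have "y < s" by (simp add: ennreal_less_iff)
  with assms(1)[of s] z s assms(2) show False by auto
qed

lemma weak_Lorentz_distr_bound:
  fixes f :: "real ^ 'n \<Rightarrow> 'b::euclidean_space"
  assumes p: "0 < p" and f: "f \<in> weak_Lorentz \<Omega> p"
  shows "\<exists>K>0. \<forall>t>0. distr_fun \<Omega> f t \<le> ennreal (K * t powr (- p))"
proof -
  have fm: "f \<in> borel_measurable (lebesgue_on \<Omega>)" and fin: "weak_Lorentz_norm \<Omega> p f < \<infinity>"
    using f by (auto simp: weak_Lorentz_def)
  from fin obtain N where N: "weak_Lorentz_norm \<Omega> p f = ennreal N" "0 \<le> N"
    by (cases "weak_Lorentz_norm \<Omega> p f") auto
  show ?thesis
  proof (intro exI[of _ "N powr p + 1"] conjI allI impI)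
    show "0 < N powr p + 1" by (simp add: add_nonneg_pos)
    fix t :: real assume t: "0 < t"
    show "distr_fun \<Omega> f t \<le> ennreal ((N powr p + 1) * t powr (- p))"
    proof (rule ennreal_le_if_all_less)
      fix s assume s: "0 < s" "ennreal s < distr_fun \<Omega> f t"
      have "ennreal (s powr (1 / p) * t) = ennreal (s powr (1 / p)) * ennreal t" using t by (simp add: ennreal_mult)
      also have "\<dots> \<le> ennreal (s powr (1 / p)) * rearr \<Omega> f s"
        by (intro mult_left_mono rearr_ge[OF fm s(2)]) auto
      also have "\<dots> \<le> weak_Lorentz_norm \<Omega> p f"
        unfolding weak_Lorentz_norm_def using s by (intro SUP_upper) auto
      finally have "s powr (1 / p) * t \<le> N" using N t by simp
      then have "s powr (1 / p) \<le> N / t" using t by (simp add: field_simps)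
      then have "(s powr (1 / p)) powr p \<le> (N / t) powr p" using p by (intro powr_mono2) auto
      then have "s \<le> N powr p * t powr (- p)"
        using s p t N by (simp add: powr_powr powr_divide powr_minus_divide)
      also have "\<dots> \<le> (N powr p + 1) * t powr (- p)" by (intro mult_right_mono) auto
      finally show "s \<le> (N powr p + 1) * t powr (- p)" .
    qed simp
  qed
qed

text \<open>
  The inclusion of \<open>L^{p,q}\<close> in weak \<open>L^p\<close>: as the rearrangement decreases, a value attained at \<open>s\<close>
  forces a contribution of the interval \<open>[s/2, s]\<close> to the Lorentz integral.
\<close>

lemma Lorentz_distr_bound:
  fixes f :: "real ^ 'n \<Rightarrow> 'b::euclidean_space"
  assumes p: "0 < p" and q: "0 < q" and f: "f \<in> Lorentz \<Omega> p q"
  shows "\<exists>K>0. \<forall>t>0. distr_fun \<Omega> f t \<le> ennreal (K * t powr (- p))"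
proof -
  let ?h = "\<lambda>t. epowr (ennreal (t powr (1 / p)) * rearr \<Omega> f t) q * ennreal (1 / t)"
  define I where "I = (\<integral>\<^sup>+ t\<in>{0<..}. ?h t \<partial>lborel)"
  have fm: "f \<in> borel_measurable (lebesgue_on \<Omega>)" and "Lorentz_norm \<Omega> p q f < \<infinity>"
    using f by (auto simp: Lorentz_def)
  then have "I \<noteq> \<infinity>" by (auto simp: Lorentz_norm_def I_def epowr_def split: if_splits)
  then obtain i where i: "I = ennreal i" "0 \<le> i" by (cases I) auto
  \<comment> \<open>Any \<open>s\<close> below the distribution function at \<open>t\<close> satisfies \<open>(s/2)^{1/p} t \<le> R\<close>.\<close>
  define R where "R = (2 * i) powr (1 / q)"
  show ?thesis
  proof (intro exI[of _ "2 * R powr p + 1"] conjI allI impI)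
    show "0 < 2 * R powr p + 1" by (simp add: add_nonneg_pos)
    fix t :: real assume t: "0 < t"
    show "distr_fun \<Omega> f t \<le> ennreal ((2 * R powr p + 1) * t powr (- p))"
    proof (rule ennreal_le_if_all_less)
      fix s assume s: "0 < s" "ennreal s < distr_fun \<Omega> f t"
      define u where "u = ((s / 2) powr (1 / p) * t) powr q"
      have "ennreal (u / 2) = ennreal (u * (1 / s)) * emeasure lborel {s / 2..s}"
        using s by (simp add: u_def flip: ennreal_mult)
      also have "\<dots> = (\<integral>\<^sup>+ \<sigma>. ennreal (u * (1 / s)) * indicator {s / 2..s} \<sigma> \<partial>lborel)"
        by (subst nn_integral_cmult_indicator) auto
      also have "\<dots> \<le> I"
        unfolding I_def
      proof (rule nn_integral_mono)
        fix \<sigma> :: real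
        show "ennreal (u * (1 / s)) * indicator {s / 2..s} \<sigma> \<le> ?h \<sigma> * indicator {0<..} \<sigma>"
        proof (cases "\<sigma> \<in> {s / 2..s}")
          case True
          then have \<sigma>: "0 < \<sigma>" "\<sigma> \<le> s" "s / 2 \<le> \<sigma>" using s by auto
          have "ennreal ((s / 2) powr (1 / p) * t) \<le> ennreal (\<sigma> powr (1 / p) * t)"
            using \<sigma> s p t by (intro ennreal_leI mult_right_mono powr_mono2) auto
          also have "\<dots> = ennreal (\<sigma> powr (1 / p)) * ennreal t" using t by (simp add: ennreal_mult)
          also have "\<dots> \<le> ennreal (\<sigma> powr (1 / p)) * rearr \<Omega> f \<sigma>"
            using \<sigma> by (intro mult_left_mono rearr_ge[OF fm s(2)]) auto
          finally have "ennreal u \<le> epowr (ennreal (\<sigma> powr (1 / p)) * rearr \<Omega> f \<sigma>) q"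
            unfolding u_def using t q by (intro epowr_mono_ennreal) auto
          moreover have "ennreal (1 / s) \<le> ennreal (1 / \<sigma>)"
            using \<sigma> s by (intro ennreal_leI divide_left_mono) auto
          ultimately have "ennreal u * ennreal (1 / s) \<le> ?h \<sigma>" by (intro mult_mono) auto
          then show ?thesis using True \<sigma> s by (simp add: u_def flip: ennreal_mult)
        qed simp
      qed
      finally have "u \<le> 2 * i" using i by (simp add: u_def)
      then have "u powr (1 / q) \<le> R" unfolding R_def using q by (intro powr_mono2) (auto simp: u_def)
      then have "(s / 2) powr (1 / p) * t \<le> R" using q t by (simp add: u_def powr_powr)
      then have "(s / 2) powr (1 / p) \<le> R / t" using t by (simp add: field_simps)
      then have "((s / 2) powr (1 / p)) powr p \<le> (R / t) powr p" using p by (intro powr_mono2) auto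
      then have "s / 2 \<le> R powr p * t powr (- p)"
        using s p t by (simp add: R_def powr_powr powr_divide powr_minus_divide)
      then have "s \<le> 2 * R powr p * t powr (- p)" by simp
      also have "\<dots> \<le> (2 * R powr p + 1) * t powr (- p)" by (intro mult_right_mono) auto
      finally show "s \<le> (2 * R powr p + 1) * t powr (- p)" .
    qed simp
  qed
qed

text \<open>
  Turns a coefficient on \<open>\<Omega>\<close> into a weight on the whole space: \<open>r = 2\<close> serves the drift terms and
  \<open>r = 1\<close> the potential.
\<close>

lemma weak_type_from_distr_bound:
  fixes f :: "real ^ 'n \<Rightarrow> 'b::euclidean_space"
  assumes \<Omega>: "open \<Omega>" and f: "f \<in> borel_measurable (lebesgue_on \<Omega>)" and r: "0 < r"
    and K: "\<exists>K>0. \<forall>t>0. distr_fun \<Omega> f t \<le> ennreal (K * t powr (- p))"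
  shows "weak_type (p / r) (\<lambda>x. indicator \<Omega> x * norm (f x) powr r)"
  unfolding weak_type_def
proof (intro conjI allI)
  obtain K where K: "0 < K" "\<And>t. 0 < t \<Longrightarrow> distr_fun \<Omega> f t \<le> ennreal (K * t powr (- p))"
    using K by blast
  have "(\<lambda>x. norm (f x) powr r) \<in> borel_measurable (lebesgue_on \<Omega>)" using f by measurable
  then show "(\<lambda>x. indicator \<Omega> x * norm (f x) powr r) \<in> borel_measurable lebesgue"
    using \<Omega> by (subst (asm) borel_measurable_restrict_space_iff) auto
  show "\<exists>K>0. \<forall>t>0. emeasure lebesgue {x. t < indicator \<Omega> x * norm (f x) powr r} \<le> ennreal (K * t powr - (p / r))"
  proof (intro exI[of _ K] conjI K allI impI)
    fix t :: real assume t: "0 < t"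
    have "t < norm (f x) powr r \<longleftrightarrow> t powr (1 / r) < norm (f x)" for x
    proof
      assume "t < norm (f x) powr r"
      then have "t powr (1 / r) < (norm (f x) powr r) powr (1 / r)" using t r by (intro powr_less_mono2) auto
      then show "t powr (1 / r) < norm (f x)" using r by (simp add: powr_powr)
    next
      assume "t powr (1 / r) < norm (f x)"
      then have "(t powr (1 / r)) powr r < norm (f x) powr r" using r by (intro powr_less_mono2) auto
      then show "t < norm (f x) powr r" using r t by (simp add: powr_powr)
    qed
    moreover have "{x. t < indicator \<Omega> x * norm (f x) powr r} = {x \<in> \<Omega>. t < norm (f x) powr r}"
      using t by (auto simp: indicator_def split: if_splits)
    ultimately have e: "{x. t < indicator \<Omega> x * norm (f x) powr r} = {x \<in> \<Omega>. t powr (1 / r) < norm (f x)}"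
      by (simp only:)
    have "emeasure lebesgue {x. t < indicator \<Omega> x * norm (f x) powr r} = distr_fun \<Omega> f (t powr (1 / r))"
      unfolding distr_fun_def e
    proof (rule emeasure_restrict_space[symmetric])
      show "\<Omega> \<inter> space lebesgue \<in> sets lebesgue" using \<Omega> by simp
      show "{x \<in> \<Omega>. t powr (1 / r) < norm (f x)} \<subseteq> \<Omega>" by blast
    qed
    also have "\<dots> \<le> ennreal (K * (t powr (1 / r)) powr (- p))" using t by (intro K) auto
    also have "(t powr (1 / r)) powr (- p) = t powr - (p / r)" by (simp add: powr_powr)
    finally show "emeasure lebesgue {x. t < indicator \<Omega> x * norm (f x) powr r} \<le> ennreal (K * t powr - (p / r))" .
  qed
qed auto

text \<open>
  With this weight the Hardy inequality also controls the pairing with compactly supported data.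
\<close>

lemma weak_type_indicator_compact:
  fixes K :: "(real ^ 'n) set"
  assumes "compact K" "0 < \<alpha>"
  shows "weak_type \<alpha> (indicator K)"
  unfolding weak_type_def
proof (intro conjI allI)
  have K: "K \<in> sets borel" using assms by (simp add: borel_compact)
  then have "K \<in> sets lebesgue" by simp
  then show "indicat_real K \<in> borel_measurable lebesgue" by (rule borel_measurable_indicator)
  have fin: "emeasure lebesgue K = ennreal (measure lborel K)"
    using emeasure_compact_finite[OF \<open>compact K\<close>] K by (simp add: emeasure_eq_ennreal_measure)
  show "\<exists>C>0. \<forall>t>0. emeasure lebesgue {x. t < indicat_real K x} \<le> ennreal (C * t powr - \<alpha>)"
  proof (intro exI[of _ "measure lborel K + 1"] conjI allI impI)
    show "0 < measure lborel K + 1" by (simp add: add_nonneg_pos)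
    fix t :: real assume t: "0 < t"
    show "emeasure lebesgue {x. t < indicat_real K x} \<le> ennreal ((measure lborel K + 1) * t powr - \<alpha>)"
    proof (cases "t < 1")
      case True
      have "1 \<le> t powr - \<alpha>" using True t \<open>0 < \<alpha>\<close>
        using powr_mono_both[of t 1 "- \<alpha>" 0] powr_le1[of \<alpha> t] by (simp add: powr_minus_divide)
      then have "(measure lborel K + 1) * 1 \<le> (measure lborel K + 1) * t powr - \<alpha>"
        by (intro mult_left_mono) (auto simp: add_nonneg_nonneg)
      then have "ennreal (measure lborel K) \<le> ennreal ((measure lborel K + 1) * t powr - \<alpha>)"
        by (intro ennreal_leI) simp
      moreover have "{x. t < indicat_real K x} = K" using True t by (auto simp: indicator_def split: if_splits)
      ultimately show ?thesis using fin by simp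
    next
      case False
      then have "{x. t < indicat_real K x} = {}" by (auto simp: indicator_def)
      then show ?thesis by simp
    qed
  qed
qed auto

section \<open>Limits of inner products in the space of square integrable functions\<close>

lemma L2_inner_integrable:
  fixes X Y :: "'a \<Rightarrow> 'b::euclidean_space"
  assumes [measurable]: "X \<in> borel_measurable M" "Y \<in> borel_measurable M"
  shows "(ennreal (norm (LINT x|M. X x \<bullet> Y x)))\<^sup>2
      \<le> (\<integral>\<^sup>+x. ennreal ((norm (X x))\<^sup>2) \<partial>M) * (\<integral>\<^sup>+x. ennreal ((norm (Y x))\<^sup>2) \<partial>M)"
    and "(\<integral>\<^sup>+x. ennreal ((norm (X x))\<^sup>2) \<partial>M) < \<infinity> \<Longrightarrow> (\<integral>\<^sup>+x. ennreal ((norm (Y x))\<^sup>2) \<partial>M) < \<infinity>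
      \<Longrightarrow> integrable M (\<lambda>x. X x \<bullet> Y x)"
proof -
  let ?P = "(\<integral>\<^sup>+x. ennreal ((norm (X x))\<^sup>2) \<partial>M) * (\<integral>\<^sup>+x. ennreal ((norm (Y x))\<^sup>2) \<partial>M)"
  have "(\<integral>\<^sup>+x. ennreal (norm (X x \<bullet> Y x)) \<partial>M) \<le> (\<integral>\<^sup>+x. ennreal (norm (X x)) * ennreal (norm (Y x)) \<partial>M)"
  proof (rule nn_integral_mono)
    fix x
    have "ennreal (norm (X x \<bullet> Y x)) \<le> ennreal (norm (X x) * norm (Y x))"
      by (rule ennreal_leI) (simp add: Cauchy_Schwarz_ineq2)
    also have "\<dots> = ennreal (norm (X x)) * ennreal (norm (Y x))" by (rule ennreal_mult) auto
    finally show "ennreal (norm (X x \<bullet> Y x)) \<le> ennreal (norm (X x)) * ennreal (norm (Y x))" .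
  qed
  then have "(\<integral>\<^sup>+x. ennreal (norm (X x \<bullet> Y x)) \<partial>M)\<^sup>2 \<le> (\<integral>\<^sup>+x. ennreal (norm (X x)) * ennreal (norm (Y x)) \<partial>M)\<^sup>2"
    by (intro power_mono) auto
  also have "\<dots> \<le> (\<integral>\<^sup>+x. (ennreal (norm (X x)))\<^sup>2 \<partial>M) * (\<integral>\<^sup>+x. (ennreal (norm (Y x)))\<^sup>2 \<partial>M)"
    by (rule Cauchy_Schwarz_nn_integral) measurable
  also have "\<dots> = ?P" by (simp add: ennreal_power)
  finally have CS: "(\<integral>\<^sup>+x. ennreal (norm (X x \<bullet> Y x)) \<partial>M)\<^sup>2 \<le> ?P" .
  show "(ennreal (norm (LINT x|M. X x \<bullet> Y x)))\<^sup>2 \<le> ?P"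
  proof (cases "integrable M (\<lambda>x. X x \<bullet> Y x)")
    case True
    then have "(ennreal (norm (LINT x|M. X x \<bullet> Y x)))\<^sup>2 \<le> (\<integral>\<^sup>+x. ennreal (norm (X x \<bullet> Y x)) \<partial>M)\<^sup>2"
      by (intro power_mono integral_norm_bound_ennreal) auto
    with CS show ?thesis by (rule order_trans[rotated])
  next
    case False
    then show ?thesis by (simp add: not_integrable_integral_eq)
  qed
  assume fin: "(\<integral>\<^sup>+x. ennreal ((norm (X x))\<^sup>2) \<partial>M) < \<infinity>" "(\<integral>\<^sup>+x. ennreal ((norm (Y x))\<^sup>2) \<partial>M) < \<infinity>"
  then have "?P < \<infinity>" by (simp add: ennreal_mult_less_top)
  with CS have "(\<integral>\<^sup>+x. ennreal (norm (X x \<bullet> Y x)) \<partial>M)\<^sup>2 < \<infinity>" by (rule le_less_trans)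
  then have "(\<integral>\<^sup>+x. ennreal (norm (X x \<bullet> Y x)) \<partial>M) < \<infinity>"
    by (rule contrapos_pp) (simp add: power2_eq_square less_top[symmetric])
  then show "integrable M (\<lambda>x. X x \<bullet> Y x)" by (intro integrableI_bounded) auto
qed

text \<open>
  Every term of the bilinear form is such a pairing, with \<open>X\<close> linear in the test function and \<open>Y\<close> independent of it.
  Integrability along the sequence is asserted for large \<open>k\<close>, when \<open>Xk k - X\<close> is square integrable.
\<close>

lemma L2_inner_limit:
  fixes X Y :: "'a \<Rightarrow> 'b::euclidean_space" and Xk :: "nat \<Rightarrow> 'a \<Rightarrow> 'b"
  assumes [measurable]: "\<And>k. Xk k \<in> borel_measurable M" "X \<in> borel_measurable M" "Y \<in> borel_measurable M"
    and lim: "(\<lambda>k. \<integral>\<^sup>+x. ennreal ((norm (Xk k x - X x))\<^sup>2) \<partial>M) \<longlonglongrightarrow> 0"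
    and X: "(\<integral>\<^sup>+x. ennreal ((norm (X x))\<^sup>2) \<partial>M) < \<infinity>" and Y: "(\<integral>\<^sup>+x. ennreal ((norm (Y x))\<^sup>2) \<partial>M) < \<infinity>"
  shows "integrable M (\<lambda>x. X x \<bullet> Y x)"
    and "\<forall>\<^sub>F k in sequentially. integrable M (\<lambda>x. Xk k x \<bullet> Y x)"
    and "(\<lambda>k. LINT x|M. Xk k x \<bullet> Y x) \<longlonglongrightarrow> (LINT x|M. X x \<bullet> Y x)"
proof -
  let ?d = "\<lambda>k. \<integral>\<^sup>+x. ennreal ((norm (Xk k x - X x))\<^sup>2) \<partial>M" and ?Y = "\<integral>\<^sup>+x. ennreal ((norm (Y x))\<^sup>2) \<partial>M"
  show i: "integrable M (\<lambda>x. X x \<bullet> Y x)" by (rule L2_inner_integrable(2)[OF _ _ X Y]) measurable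
  have ev: "\<forall>\<^sub>F k in sequentially. ?d k < \<infinity>" using lim by (rule order_tendstoD) simp
  then have evd: "\<forall>\<^sub>F k in sequentially. integrable M (\<lambda>x. (Xk k x - X x) \<bullet> Y x)"
  proof eventually_elim
    case (elim k)
    show ?case by (rule L2_inner_integrable(2)[OF _ _ elim Y]) measurable
  qed
  then show evk: "\<forall>\<^sub>F k in sequentially. integrable M (\<lambda>x. Xk k x \<bullet> Y x)"
  proof eventually_elim
    case (elim k)
    have "integrable M (\<lambda>x. (Xk k x - X x) \<bullet> Y x + X x \<bullet> Y x)"
      by (intro Bochner_Integration.integrable_add elim i)
    then show ?case by (simp add: inner_diff_left)
  qed
  define D where "D k = (LINT x|M. (Xk k x - X x) \<bullet> Y x)" for k
  have "(\<lambda>k. ?Y * ?d k) \<longlonglongrightarrow> ?Y * 0"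
    using Y by (intro ennreal_tendsto_cmult lim) simp
  then have up: "(\<lambda>k. ?d k * ?Y) \<longlonglongrightarrow> 0" by (simp add: mult.commute)
  have le: "ennreal ((D k)\<^sup>2) \<le> ?d k * ?Y" for k
    using L2_inner_integrable(1)[of "\<lambda>x. Xk k x - X x" M Y] by (simp add: D_def ennreal_power)
  have "(\<lambda>k. ennreal ((D k)\<^sup>2)) \<longlonglongrightarrow> 0"
  proof (rule tendsto_sandwich)
    show "\<forall>\<^sub>F k in sequentially. 0 \<le> ennreal ((D k)\<^sup>2)" by simp
    show "\<forall>\<^sub>F k in sequentially. ennreal ((D k)\<^sup>2) \<le> ?d k * ?Y" by (intro always_eventually allI le)
  qed (rule tendsto_const, rule up)
  then have "(\<lambda>k. (D k)\<^sup>2) \<longlonglongrightarrow> 0" by (subst (asm) ennreal_tendsto_0_iff) simp_all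
  then have D: "D \<longlonglongrightarrow> 0" by simp
  have "\<forall>\<^sub>F k in sequentially. D k + (LINT x|M. X x \<bullet> Y x) = (LINT x|M. Xk k x \<bullet> Y x)"
    using evk
  proof eventually_elim
    case (elim k)
    then show ?case using i by (simp add: D_def inner_diff_left)
  qed
  moreover have "(\<lambda>k. D k + (LINT x|M. X x \<bullet> Y x)) \<longlonglongrightarrow> (LINT x|M. X x \<bullet> Y x)"
    using tendsto_add[OF D tendsto_const[of "LINT x|M. X x \<bullet> Y x"]] by simp
  ultimately show "(\<lambda>k. LINT x|M. Xk k x \<bullet> Y x) \<longlonglongrightarrow> (LINT x|M. X x \<bullet> Y x)"
    by (rule Lim_transform_eventually[rotated])
qed

section \<open>Weighted approximation by test functions\<close>

lemma epowr_tendsto_0D: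
  assumes a: "0 < a" and lim: "(\<lambda>k. epowr (x k) a) \<longlonglongrightarrow> 0"
  shows "x \<longlonglongrightarrow> 0"
proof (rule order_tendstoI)
  fix e :: ennreal assume "0 < e"
  then obtain z where z: "0 < z" "z < e" using dense by blast
  then obtain \<delta> where \<delta>: "z = ennreal \<delta>" "0 < \<delta>" by (cases z) auto
  have "\<forall>\<^sub>F k in sequentially. epowr (x k) a < ennreal (\<delta> powr a)"
    using lim by (rule order_tendstoD) (use \<delta> in auto)
  then show "\<forall>\<^sub>F k in sequentially. x k < e"
  proof eventually_elim
    case (elim k)
    then have "\<not> ennreal \<delta> \<le> x k" using epowr_mono_ennreal[of \<delta> "x k" a] \<delta> a by auto
    then show ?case using \<delta> z by simp
  qed
qed simp

lemma grad_eq_0_outside_support: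
  assumes "x \<notin> closure {x. \<phi> x \<noteq> 0}"
  shows "grad \<phi> x = 0"
proof -
  have "((\<lambda>x. 0) has_derivative (\<lambda>h. 0)) (at x)" by simp
  then have "(\<phi> has_derivative (\<lambda>h. 0)) (at x)"
    by (rule has_derivative_transform_within_open[of _ _ _ _ "- closure {x. \<phi> x \<noteq> 0}"])
      (use assms closure_subset[of "{x. \<phi> x \<noteq> 0}"] in \<open>auto simp: open_Compl\<close>)
  from grad_nth_eqI[OF this] show ?thesis by (simp add: vec_eq_iff)
qed

lemma test_fun_diff:
  assumes \<phi>: "\<phi> \<in> test_fun \<Omega>" and \<psi>: "\<psi> \<in> test_fun \<Omega>"
  shows "(\<lambda>x. \<phi> x - \<psi> x) \<in> test_fun \<Omega>"
proof -
  have "{x. \<phi> x - \<psi> x \<noteq> 0} \<subseteq> closure {x. \<phi> x \<noteq> 0} \<union> closure {x. \<psi> x \<noteq> 0}"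
  proof
    fix x assume "x \<in> {x. \<phi> x - \<psi> x \<noteq> 0}"
    then have "x \<in> {x. \<phi> x \<noteq> 0} \<or> x \<in> {x. \<psi> x \<noteq> 0}" by auto
    then show "x \<in> closure {x. \<phi> x \<noteq> 0} \<union> closure {x. \<psi> x \<noteq> 0}"
      using closure_subset[of "{x. \<phi> x \<noteq> 0}"] closure_subset[of "{x. \<psi> x \<noteq> 0}"] by (elim disjE) blast+
  qed
  then have *: "closure {x. \<phi> x - \<psi> x \<noteq> 0} \<subseteq> closure {x. \<phi> x \<noteq> 0} \<union> closure {x. \<psi> x \<noteq> 0}"
    by (intro closure_minimal) auto
  have c: "compact (closure {x. \<phi> x \<noteq> 0} \<union> closure {x. \<psi> x \<noteq> 0})"
    by (intro compact_Un test_funD[OF \<phi>] test_funD[OF \<psi>])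
  have "compact (closure {x. \<phi> x - \<psi> x \<noteq> 0})"
    using bounded_subset[OF compact_imp_bounded[OF c] *] by (simp add: compact_eq_bounded_closed)
  moreover have "closure {x. \<phi> x - \<psi> x \<noteq> 0} \<subseteq> \<Omega>"
    using * test_funD(5)[OF \<phi>] test_funD(5)[OF \<psi>] by blast
  moreover have "Ck k (\<lambda>x. \<phi> x - \<psi> x)" for k
    using \<phi> \<psi> by (intro Ck_diff) (auto simp: test_fun_def)
  ultimately show ?thesis by (simp add: test_fun_def)
qed

lemma nn_integral_lebesgue_on_eq_lborel:
  fixes g :: "'a::euclidean_space \<Rightarrow> ennreal"
  assumes "open \<Omega>" and "\<And>x. x \<notin> \<Omega> \<Longrightarrow> g x = 0"
  shows "(\<integral>\<^sup>+x. g x \<partial>lebesgue_on \<Omega>) = (\<integral>\<^sup>+x. g x \<partial>lborel)"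
proof -
  have "(\<integral>\<^sup>+x. g x \<partial>lebesgue_on \<Omega>) = (\<integral>\<^sup>+x. g x * indicator \<Omega> x \<partial>lebesgue)"
    using assms by (subst nn_integral_restrict_space) auto
  also have "\<dots> = (\<integral>\<^sup>+x. g x \<partial>lebesgue)"
    using assms by (intro nn_integral_cong) (auto simp: indicator_def)
  finally show ?thesis by (simp add: nn_integral_completion)
qed

lemma norm_add_square_le: "(norm (x + y :: 'a::real_normed_vector))\<^sup>2 \<le> 2 * (norm x)\<^sup>2 + 2 * (norm y)\<^sup>2"
proof -
  have "(norm (x + y))\<^sup>2 \<le> (norm x + norm y)\<^sup>2" by (intro power_mono norm_triangle_ineq) simp
  also have "\<dots> \<le> 2 * (norm x)\<^sup>2 + 2 * (norm y)\<^sup>2"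
    using zero_le_power2[of "norm x - norm y"] by (simp add: power2_eq_square algebra_simps)
  finally show ?thesis .
qed

lemma powr_2_eq_square: "0 \<le> (x::real) \<Longrightarrow> x powr 2 = x\<^sup>2"
  by (cases "x = 0") (auto simp: powr_numeral)

lemma Y_norm_tendsto_0D:
  fixes u :: "nat \<Rightarrow> real ^ 'n \<Rightarrow> real"
  assumes n: "CARD('n) \<ge> 3" and lim: "(\<lambda>k. Y_norm \<Omega> (u k) (D k)) \<longlonglongrightarrow> 0"
  shows "(\<lambda>k. \<integral>\<^sup>+x. ennreal (norm (u k x) powr (2 * real CARD('n) / (real CARD('n) - 2))) \<partial>lebesgue_on \<Omega>) \<longlonglongrightarrow> 0"
    and "(\<lambda>k. \<integral>\<^sup>+x. ennreal ((norm (D k x))\<^sup>2) \<partial>lebesgue_on \<Omega>) \<longlonglongrightarrow> 0"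
proof -
  let ?p = "2 * real CARD('n) / (real CARD('n) - 2)"
  have p: "0 < 1 / ?p" using n by simp
  have 1: "(\<lambda>k. Lp_norm \<Omega> ?p (u k)) \<longlonglongrightarrow> 0"
  proof (rule tendsto_sandwich)
    show "\<forall>\<^sub>F k in sequentially. Lp_norm \<Omega> ?p (u k) \<le> Y_norm \<Omega> (u k) (D k)"
      unfolding Y_norm_def by (intro always_eventually allI) simp
    show "\<forall>\<^sub>F k in sequentially. 0 \<le> Lp_norm \<Omega> ?p (u k)" by simp
  qed (rule tendsto_const, rule lim)
  have 2: "(\<lambda>k. Lp_norm \<Omega> 2 (D k)) \<longlonglongrightarrow> 0"
  proof (rule tendsto_sandwich)
    show "\<forall>\<^sub>F k in sequentially. Lp_norm \<Omega> 2 (D k) \<le> Y_norm \<Omega> (u k) (D k)"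
      unfolding Y_norm_def by (intro always_eventually allI) simp
    show "\<forall>\<^sub>F k in sequentially. 0 \<le> Lp_norm \<Omega> 2 (D k)" by simp
  qed (rule tendsto_const, rule lim)
  show "(\<lambda>k. \<integral>\<^sup>+x. ennreal (norm (u k x) powr ?p) \<partial>lebesgue_on \<Omega>) \<longlonglongrightarrow> 0"
    by (rule epowr_tendsto_0D[OF p 1[unfolded Lp_norm_def]])
  have "(\<lambda>k. \<integral>\<^sup>+x. ennreal (norm (D k x) powr 2) \<partial>lebesgue_on \<Omega>) \<longlonglongrightarrow> 0"
    by (rule epowr_tendsto_0D[OF _ 2[unfolded Lp_norm_def]]) simp
  then show "(\<lambda>k. \<integral>\<^sup>+x. ennreal ((norm (D k x))\<^sup>2) \<partial>lebesgue_on \<Omega>) \<longlonglongrightarrow> 0"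
    by (simp add: powr_2_eq_square)
qed

text \<open>
  The subsequence starts late enough for all the integrals to be finite.
\<close>

lemma Lp_convergence_AE_subseq:
  fixes u :: "nat \<Rightarrow> 'a \<Rightarrow> real"
  assumes p: "0 < p" and [measurable]: "\<And>k. u k \<in> borel_measurable M"
    and lim: "(\<lambda>k. \<integral>\<^sup>+x. ennreal (norm (u k x) powr p) \<partial>M) \<longlonglongrightarrow> 0"
  shows "\<exists>r. filterlim r at_top sequentially \<and> (AE x in M. (\<lambda>i. u (r i) x) \<longlonglongrightarrow> 0)"
proof -
  let ?I = "\<lambda>k. \<integral>\<^sup>+x. ennreal (norm (u k x) powr p) \<partial>M"
  have "\<forall>\<^sub>F k in sequentially. ?I k < \<infinity>" using lim by (rule order_tendstoD) simp
  then obtain N where N: "\<And>k. N \<le> k \<Longrightarrow> ?I k < \<infinity>" by (auto simp: eventually_sequentially)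
  define v where "v k x = norm (u (k + N) x) powr p" for k x
  have v: "integrable M (v k)" for k
  proof (rule integrableI_nonneg)
    show "v k \<in> borel_measurable M" unfolding v_def[abs_def] by measurable
    show "(\<integral>\<^sup>+x. ennreal (v k x) \<partial>M) < \<infinity>" unfolding v_def by (rule N) simp
  qed (simp add: v_def)
  have e: "ennreal (LINT x|M. norm (v k x)) = ?I (k + N)" for k
  proof -
    have "(\<integral>\<^sup>+x. ennreal (v k x) \<partial>M) = ennreal (LINT x|M. v k x)"
      by (rule nn_integral_eq_integral[OF v]) (simp add: v_def)
    then show ?thesis by (simp add: v_def)
  qed
  have "(\<lambda>k. ennreal (LINT x|M. norm (v k x))) \<longlonglongrightarrow> 0"
    unfolding e using lim by (rule LIMSEQ_ignore_initial_segment)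
  then have "(\<lambda>k. LINT x|M. norm (v k x)) \<longlonglongrightarrow> 0"
    by (subst (asm) ennreal_tendsto_0_iff) simp_all
  then obtain r :: "nat \<Rightarrow> nat" where r: "strict_mono r" "AE x in M. (\<lambda>i. v (r i) x) \<longlonglongrightarrow> 0"
    using tendsto_L1_AE_subseq[of M v] v by blast
  have "filterlim (\<lambda>i. r i + N) at_top sequentially"
    by (rule filterlim_at_top_mono[OF filterlim_subseq[OF r(1)]]) simp
  moreover have "AE x in M. (\<lambda>i. u (r i + N) x) \<longlonglongrightarrow> 0"
    using r(2)
  proof eventually_elim
    case (elim x)
    have "(\<lambda>i. v (r i) x powr (1 / p)) \<longlonglongrightarrow> 0"
      by (rule tendsto_zero_powrI[OF elim tendsto_const]) (use p in \<open>auto simp: v_def\<close>)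
    moreover have "v (r i) x powr (1 / p) = norm (u (r i + N) x)" for i
      using p by (simp add: v_def powr_powr)
    ultimately have "(\<lambda>i. norm (u (r i + N) x)) \<longlonglongrightarrow> 0" by (simp only:)
    then show ?case by (rule tendsto_norm_zero_cancel)
  qed
  ultimately show ?thesis by blast
qed

text \<open>
  The Hardy inequality makes \<open>\<phi> k\<close> a Cauchy sequence in the space with weight \<open>V\<close>. Convergence in
  \<open>L^{2^*}\<close> is used only to identify its limit: along an almost everywhere convergent subsequence,
  Fatou's lemma passes the estimate for \<open>\<phi> i - \<phi> j\<close> to \<open>u - \<phi> j\<close>.
\<close>

lemma Y0_weighted_L2_approximation:
  fixes u :: "real ^ 'n \<Rightarrow> real"
  assumes n: "CARD('n) \<ge> 3" and \<Omega>: "open \<Omega>"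
    and um: "u \<in> borel_measurable (lebesgue_on \<Omega>)" and Dm: "Du \<in> borel_measurable (lebesgue_on \<Omega>)"
    and \<phi>: "\<And>k. \<phi> k \<in> test_fun \<Omega>"
    and lim: "(\<lambda>k. Y_norm \<Omega> (\<lambda>x. \<phi> k x - u x) (\<lambda>x. grad (\<phi> k) x - Du x)) \<longlonglongrightarrow> 0"
    and Dfin: "(\<integral>\<^sup>+x. ennreal ((norm (Du x))\<^sup>2) \<partial>lebesgue_on \<Omega>) < \<infinity>"
    and V: "weak_type (real CARD('n) / 2) V"
  shows "(\<lambda>k. \<integral>\<^sup>+x. ennreal (V x * (\<phi> k x - u x)\<^sup>2) \<partial>lebesgue_on \<Omega>) \<longlonglongrightarrow> 0"
    and "(\<integral>\<^sup>+x. ennreal (V x * (u x)\<^sup>2) \<partial>lebesgue_on \<Omega>) < \<infinity>"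
proof -
  let ?M = "lebesgue_on \<Omega>" and ?p = "2 * real CARD('n) / (real CARD('n) - 2)"
  have p: "0 < ?p" using n by simp
  have Vm: "V \<in> borel_measurable lebesgue" and V0: "\<And>x. 0 \<le> V x"
    using V by (auto simp: weak_type_def)
  note um [measurable] Dm [measurable]
  have [measurable]: "V \<in> borel_measurable ?M" using Vm by (rule measurable_restrict_space1)
  have [measurable]: "\<phi> k \<in> borel_measurable ?M" "grad (\<phi> k) \<in> borel_measurable ?M" for k
    by (intro measurable_lebesgue_on_continuous test_funD[OF \<phi>])+
  define g where "g k = (\<integral>\<^sup>+x. ennreal ((norm (grad (\<phi> k) x - Du x))\<^sup>2) \<partial>?M)" for k
  have g: "g \<longlonglongrightarrow> 0" unfolding g_def[abs_def] by (rule Y_norm_tendsto_0D(2)[OF n lim])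
  obtain C where C: "\<And>\<psi>. \<psi> \<in> test_fun \<Omega> \<Longrightarrow> (\<integral>\<^sup>+x. ennreal (V x * (\<psi> x)\<^sup>2) \<partial>lebesgue)
      \<le> ennreal C * (\<integral>\<^sup>+x. ennreal ((norm (grad \<psi> x))\<^sup>2) \<partial>lborel)"
    using weak_type_Hardy_inequality[OF n V, of \<Omega>] by blast
  have H: "(\<integral>\<^sup>+x. ennreal (V x * (\<psi> x)\<^sup>2) \<partial>?M) \<le> ennreal C * (\<integral>\<^sup>+x. ennreal ((norm (grad \<psi> x))\<^sup>2) \<partial>?M)"
    if \<psi>: "\<psi> \<in> test_fun \<Omega>" for \<psi>
  proof -
    have "(\<integral>\<^sup>+x. ennreal (V x * (\<psi> x)\<^sup>2) \<partial>?M) = (\<integral>\<^sup>+x. ennreal (V x * (\<psi> x)\<^sup>2) * indicator \<Omega> x \<partial>lebesgue)"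
      using \<Omega> by (subst nn_integral_restrict_space) auto
    also have "\<dots> \<le> (\<integral>\<^sup>+x. ennreal (V x * (\<psi> x)\<^sup>2) \<partial>lebesgue)"
      by (intro nn_integral_mono) (auto simp: indicator_def)
    also note C[OF \<psi>]
    also have "(\<integral>\<^sup>+x. ennreal ((norm (grad \<psi> x))\<^sup>2) \<partial>lborel) = (\<integral>\<^sup>+x. ennreal ((norm (grad \<psi> x))\<^sup>2) \<partial>?M)"
    proof (rule nn_integral_lebesgue_on_eq_lborel[symmetric, OF \<Omega>])
      fix x assume "x \<notin> \<Omega>"
      then have "grad \<psi> x = 0" using test_funD(5)[OF \<psi>] by (intro grad_eq_0_outside_support) auto
      then show "ennreal ((norm (grad \<psi> x))\<^sup>2) = 0" by simp
    qed
    finally show ?thesis .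
  qed
  have sq: "ennreal ((norm (a + b :: real ^ 'n))\<^sup>2) \<le> 2 * ennreal ((norm a)\<^sup>2) + 2 * ennreal ((norm b)\<^sup>2)" for a b
  proof -
    have "ennreal ((norm (a + b))\<^sup>2) \<le> ennreal (2 * (norm a)\<^sup>2 + 2 * (norm b)\<^sup>2)"
      by (intro ennreal_leI norm_add_square_le)
    also have "\<dots> = ennreal (2 * (norm a)\<^sup>2) + ennreal (2 * (norm b)\<^sup>2)" by (intro ennreal_plus) auto
    also have "\<dots> = 2 * ennreal ((norm a)\<^sup>2) + 2 * ennreal ((norm b)\<^sup>2)" by (subst (1 2) ennreal_mult) auto
    finally show ?thesis .
  qed
  have diff: "(\<integral>\<^sup>+x. ennreal (V x * (\<phi> i x - \<phi> j x)\<^sup>2) \<partial>?M) \<le> ennreal C * (2 * g i + 2 * g j)" for i j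
  proof -
    have "(\<integral>\<^sup>+x. ennreal (V x * (\<phi> i x - \<phi> j x)\<^sup>2) \<partial>?M)
        \<le> ennreal C * (\<integral>\<^sup>+x. ennreal ((norm (grad (\<lambda>x. \<phi> i x - \<phi> j x) x))\<^sup>2) \<partial>?M)"
      by (rule H[OF test_fun_diff[OF \<phi> \<phi>]])
    also have "\<dots> \<le> ennreal C * (\<integral>\<^sup>+x. 2 * ennreal ((norm (grad (\<phi> i) x - Du x))\<^sup>2) + 2 * ennreal ((norm (grad (\<phi> j) x - Du x))\<^sup>2) \<partial>?M)"
    proof (intro mult_left_mono nn_integral_mono)
      fix x
      have "grad (\<lambda>x. \<phi> i x - \<phi> j x) x = grad (\<phi> i) x - grad (\<phi> j) x"
        by (intro grad_diff test_funD(2)[OF \<phi>])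
      then have "grad (\<lambda>x. \<phi> i x - \<phi> j x) x = (grad (\<phi> i) x - Du x) + (Du x - grad (\<phi> j) x)"
        by simp
      then show "ennreal ((norm (grad (\<lambda>x. \<phi> i x - \<phi> j x) x))\<^sup>2)
          \<le> 2 * ennreal ((norm (grad (\<phi> i) x - Du x))\<^sup>2) + 2 * ennreal ((norm (grad (\<phi> j) x - Du x))\<^sup>2)"
        using sq[of "grad (\<phi> i) x - Du x" "Du x - grad (\<phi> j) x"] by (simp only: norm_minus_commute[of "Du x"])
    qed simp
    also have "\<dots> = ennreal C * (2 * g i + 2 * g j)"
      unfolding g_def by (simp add: nn_integral_add nn_integral_cmult)
    finally show ?thesis .
  qed
  obtain r where r: "filterlim r at_top sequentially"
    and rAE: "AE x in ?M. (\<lambda>i. \<phi> (r i) x - u x) \<longlonglongrightarrow> 0"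
    using Lp_convergence_AE_subseq[OF p _ Y_norm_tendsto_0D(1)[OF n lim]] by auto
  have gr: "(\<lambda>i. g (r i)) \<longlonglongrightarrow> 0" using filterlim_compose[OF g r] .
  \<comment> \<open>Fatou, with \<open>j\<close> fixed and the subsequence index tending to infinity.\<close>
  have bound: "(\<integral>\<^sup>+x. ennreal (V x * (\<phi> j x - u x)\<^sup>2) \<partial>?M) \<le> ennreal C * (2 * g j)" for j
  proof -
    have "(\<integral>\<^sup>+x. ennreal (V x * (\<phi> j x - u x)\<^sup>2) \<partial>?M) = (\<integral>\<^sup>+x. liminf (\<lambda>i. ennreal (V x * (\<phi> (r i) x - \<phi> j x)\<^sup>2)) \<partial>?M)"
    proof (rule nn_integral_cong_AE, use rAE in eventually_elim)
      case (elim x)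
      have "(\<lambda>i. V x * ((\<phi> (r i) x - u x) - (\<phi> j x - u x))\<^sup>2) \<longlonglongrightarrow> V x * (0 - (\<phi> j x - u x))\<^sup>2"
        by (intro tendsto_intros elim)
      then have "(\<lambda>i. V x * (\<phi> (r i) x - \<phi> j x)\<^sup>2) \<longlonglongrightarrow> V x * (\<phi> j x - u x)\<^sup>2"
        by (simp add: power2_commute)
      then have "(\<lambda>i. ennreal (V x * (\<phi> (r i) x - \<phi> j x)\<^sup>2)) \<longlonglongrightarrow> ennreal (V x * (\<phi> j x - u x)\<^sup>2)"
        by (rule tendsto_ennrealI)
      then show ?case by (intro lim_imp_Liminf[symmetric]) auto
    qed
    also have "\<dots> \<le> liminf (\<lambda>i. \<integral>\<^sup>+x. ennreal (V x * (\<phi> (r i) x - \<phi> j x)\<^sup>2) \<partial>?M)"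
      by (rule nn_integral_liminf) measurable
    also have "\<dots> \<le> liminf (\<lambda>i. ennreal C * (2 * g (r i) + 2 * g j))"
      by (intro Liminf_mono always_eventually allI diff)
    also have "\<dots> = ennreal C * (2 * 0 + 2 * g j)"
      by (intro lim_imp_Liminf ennreal_tendsto_cmult tendsto_add tendsto_const gr) auto
    finally show ?thesis by simp
  qed
  have "(\<lambda>k. ennreal C * (2 * g k)) \<longlonglongrightarrow> ennreal C * (2 * 0)"
    by (intro ennreal_tendsto_cmult g) auto
  then have up: "(\<lambda>k. ennreal C * (2 * g k)) \<longlonglongrightarrow> 0" by simp
  show "(\<lambda>k. \<integral>\<^sup>+x. ennreal (V x * (\<phi> k x - u x)\<^sup>2) \<partial>?M) \<longlonglongrightarrow> 0"
  proof (rule tendsto_sandwich[OF _ _ tendsto_const up])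
    show "\<forall>\<^sub>F k in sequentially. (\<integral>\<^sup>+x. ennreal (V x * (\<phi> k x - u x)\<^sup>2) \<partial>?M) \<le> ennreal C * (2 * g k)"
      by (intro always_eventually allI bound)
  qed simp
  have "\<forall>\<^sub>F k in sequentially. g k < \<infinity>" using g by (rule order_tendstoD) simp
  then obtain j where j: "g j < \<infinity>" by (auto simp: eventually_sequentially)
  have "(\<integral>\<^sup>+x. ennreal ((norm (grad (\<phi> j) x))\<^sup>2) \<partial>?M)
      \<le> (\<integral>\<^sup>+x. 2 * ennreal ((norm (grad (\<phi> j) x - Du x))\<^sup>2) + 2 * ennreal ((norm (Du x))\<^sup>2) \<partial>?M)"
    using sq[of "grad (\<phi> j) x - Du x" "Du x" for x] by (intro nn_integral_mono) simp
  also have "\<dots> = 2 * g j + 2 * (\<integral>\<^sup>+x. ennreal ((norm (Du x))\<^sup>2) \<partial>?M)"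
    unfolding g_def by (simp add: nn_integral_add nn_integral_cmult)
  also have "\<dots> < \<infinity>" using j Dfin by (simp add: ennreal_mult_less_top)
  finally have "ennreal C * (\<integral>\<^sup>+x. ennreal ((norm (grad (\<phi> j) x))\<^sup>2) \<partial>?M) < \<infinity>"
    by (simp add: ennreal_mult_less_top)
  with H[OF \<phi>[of j]] have fin1: "(\<integral>\<^sup>+x. ennreal (V x * (\<phi> j x)\<^sup>2) \<partial>?M) < \<infinity>" by (rule le_less_trans)
  have "(\<integral>\<^sup>+x. ennreal (V x * (\<phi> j x - u x)\<^sup>2) \<partial>?M) < \<infinity>"
    by (rule le_less_trans[OF bound]) (use j in \<open>simp add: ennreal_mult_less_top\<close>)
  note fin2 = this
  have "(\<integral>\<^sup>+x. ennreal (V x * (u x)\<^sup>2) \<partial>?M)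
      \<le> (\<integral>\<^sup>+x. 2 * ennreal (V x * (\<phi> j x)\<^sup>2) + 2 * ennreal (V x * (\<phi> j x - u x)\<^sup>2) \<partial>?M)"
  proof (rule nn_integral_mono)
    fix x
    have "(u x)\<^sup>2 \<le> 2 * (\<phi> j x)\<^sup>2 + 2 * (\<phi> j x - u x)\<^sup>2"
      using norm_add_square_le[of "\<phi> j x" "u x - \<phi> j x"] by (simp add: power2_commute)
    then have "V x * (u x)\<^sup>2 \<le> V x * (2 * (\<phi> j x)\<^sup>2 + 2 * (\<phi> j x - u x)\<^sup>2)"
      using V0 by (rule mult_left_mono)
    also have "\<dots> = 2 * (V x * (\<phi> j x)\<^sup>2) + 2 * (V x * (\<phi> j x - u x)\<^sup>2)" by (simp add: algebra_simps)
    finally have "ennreal (V x * (u x)\<^sup>2) \<le> ennreal (2 * (V x * (\<phi> j x)\<^sup>2) + 2 * (V x * (\<phi> j x - u x)\<^sup>2))"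
      by (rule ennreal_leI)
    also have "\<dots> = ennreal (2 * (V x * (\<phi> j x)\<^sup>2)) + ennreal (2 * (V x * (\<phi> j x - u x)\<^sup>2))"
      using V0 by (intro ennreal_plus) auto
    also have "\<dots> = 2 * ennreal (V x * (\<phi> j x)\<^sup>2) + 2 * ennreal (V x * (\<phi> j x - u x)\<^sup>2)"
      using V0 by (subst (1 2) ennreal_mult) auto
    finally show "ennreal (V x * (u x)\<^sup>2) \<le> \<dots>" .
  qed
  also have "\<dots> = 2 * (\<integral>\<^sup>+x. ennreal (V x * (\<phi> j x)\<^sup>2) \<partial>?M) + 2 * (\<integral>\<^sup>+x. ennreal (V x * (\<phi> j x - u x)\<^sup>2) \<partial>?M)"
    by (simp add: nn_integral_add nn_integral_cmult)
  also have "\<dots> < \<infinity>" using fin1 fin2 by (simp add: ennreal_mult_less_top)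
  finally show "(\<integral>\<^sup>+x. ennreal (V x * (u x)\<^sup>2) \<partial>?M) < \<infinity>" .
qed

section \<open>Testing the equation against the energy space\<close>

lemma borel_measurable_matrix_vector_mult:
  fixes A :: "'a \<Rightarrow> real ^ 'n ^ 'n"
  assumes [measurable]: "A \<in> borel_measurable M" "v \<in> borel_measurable M"
  shows "(\<lambda>x. A x *v v x) \<in> borel_measurable M"
proof (rule borel_measurable_continuous_Pair[where H="\<lambda>A v. A *v v", OF assms])
  show "continuous_on UNIV (\<lambda>x::(real^'n^'n) \<times> (real^'n). fst x *v snd x)"
    unfolding matrix_vector_mult_def by (intro continuous_on_vec_lambda continuous_intros)
qed

lemma norm_matrix_vector_mult_le:
  fixes A :: "real ^ 'n ^ 'm"
  shows "norm (A *v v) \<le> real CARD('m) * norm A * norm v"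
proof -
  have "norm (A *v v) \<le> (\<Sum>i\<in>UNIV. \<bar>(A *v v) $ i\<bar>)" by (rule norm_le_l1_cart)
  also have "\<dots> \<le> (\<Sum>i\<in>(UNIV::'m set). norm A * norm v)"
  proof (rule sum_mono)
    fix i
    have "\<bar>(A *v v) $ i\<bar> = \<bar>A $ i \<bullet> v\<bar>" by (simp add: matrix_vector_mult_def inner_vec_def)
    also have "\<dots> \<le> norm (A $ i) * norm v" by (rule Cauchy_Schwarz_ineq2)
    also have "\<dots> \<le> norm A * norm v"
      by (rule mult_right_mono[OF Finite_Cartesian_Product.norm_nth_le]) simp
    finally show "\<bar>(A *v v) $ i\<bar> \<le> norm A * norm v" .
  qed
  finally show ?thesis by simp
qed

text \<open>
  The integrand of the bilinear form of the operator, with the gradients as separate arguments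
  because weak gradients are determined only almost everywhere.
\<close>

definition form_integrand ::
  "(real ^ 'n \<Rightarrow> real ^ 'n ^ 'n) \<Rightarrow> (real ^ 'n \<Rightarrow> real ^ 'n) \<Rightarrow> (real ^ 'n \<Rightarrow> real ^ 'n) \<Rightarrow> (real ^ 'n \<Rightarrow> real) \<Rightarrow>
   (real ^ 'n \<Rightarrow> real) \<Rightarrow> (real ^ 'n \<Rightarrow> real ^ 'n) \<Rightarrow> (real ^ 'n \<Rightarrow> real) \<Rightarrow> (real ^ 'n \<Rightarrow> real ^ 'n) \<Rightarrow> real ^ 'n \<Rightarrow> real" where
  "form_integrand A b c d u Du w Dw x =
     (A x *v Du x) \<bullet> Dw x + (b x \<bullet> Dw x) * u x + (c x \<bullet> Du x) * w x + d x * u x * w x"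

lemma form_integrand_adjoint:
  "form_integrand (\<lambda>x. transpose (A x)) c b d w Dw u Du = form_integrand A b c d u Du w Dw"
proof
  fix x
  have "(transpose (A x) *v Dw x) \<bullet> Du x = (A x *v Du x) \<bullet> Dw x"
    using dot_lmul_matrix[of "Dw x" "A x" "Du x"] by (simp add: transpose_matrix_vector inner_commute)
  then show "form_integrand (\<lambda>x. transpose (A x)) c b d w Dw u Du x = form_integrand A b c d u Du w Dw x"
    by (simp add: form_integrand_def)
qed

text \<open>
  The properties of the coefficients that the continuity of the form depends on; they are invariant
  under passing to the adjoint operator.
\<close>

definition weak_type_coeffs ::
  "(real ^ 'n) set \<Rightarrow> (real ^ 'n \<Rightarrow> real ^ 'n ^ 'n) \<Rightarrow> (real ^ 'n \<Rightarrow> real ^ 'n) \<Rightarrow> (real ^ 'n \<Rightarrow> real ^ 'n) \<Rightarrow> (real ^ 'n \<Rightarrow> real) \<Rightarrow> bool" where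
  "weak_type_coeffs \<Omega> A b c d \<longleftrightarrow>
     A \<in> borel_measurable (lebesgue_on \<Omega>) \<and> bounded (A ` \<Omega>) \<and>
     b \<in> borel_measurable (lebesgue_on \<Omega>) \<and> c \<in> borel_measurable (lebesgue_on \<Omega>) \<and> d \<in> borel_measurable (lebesgue_on \<Omega>) \<and>
     weak_type (real CARD('n) / 2) (\<lambda>x. indicator \<Omega> x * (norm (b x))\<^sup>2) \<and>
     weak_type (real CARD('n) / 2) (\<lambda>x. indicator \<Omega> x * (norm (c x))\<^sup>2) \<and>
     weak_type (real CARD('n) / 2) (\<lambda>x. indicator \<Omega> x * \<bar>d x\<bar>)"

lemma nn_integral_lebesgue_on_indicator:
  shows "(\<integral>\<^sup>+x. ennreal (indicator \<Omega> x * V x * W x) \<partial>lebesgue_on \<Omega>) = (\<integral>\<^sup>+x. ennreal (V x * W x) \<partial>lebesgue_on \<Omega>)"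
  by (intro nn_integral_cong) (auto simp: indicator_def)

text \<open>
  One gradient and one sequence of test functions that work simultaneously for all weights.
\<close>

lemma Y0_gradient_approximation:
  fixes u :: "real ^ 'n \<Rightarrow> real"
  assumes n: "CARD('n) \<ge> 3" and \<Omega>: "open \<Omega>" and u: "u \<in> Y0 \<Omega>"
  shows "\<exists>Du \<phi>. u \<in> borel_measurable (lebesgue_on \<Omega>) \<and> Du \<in> borel_measurable (lebesgue_on \<Omega>) \<and> weak_grad \<Omega> u Du \<and>
    (\<integral>\<^sup>+x. ennreal ((norm (Du x))\<^sup>2) \<partial>lebesgue_on \<Omega>) < \<infinity> \<and> (\<forall>k. \<phi> k \<in> test_fun \<Omega>) \<and>
    (\<lambda>k. \<integral>\<^sup>+x. ennreal ((norm (grad (\<phi> k) x - Du x))\<^sup>2) \<partial>lebesgue_on \<Omega>) \<longlonglongrightarrow> 0 \<and>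
    (\<forall>V. weak_type (real CARD('n) / 2) V \<longrightarrow>
      (\<lambda>k. \<integral>\<^sup>+x. ennreal (V x * (\<phi> k x - u x)\<^sup>2) \<partial>lebesgue_on \<Omega>) \<longlonglongrightarrow> 0 \<and>
      (\<integral>\<^sup>+x. ennreal (V x * (u x)\<^sup>2) \<partial>lebesgue_on \<Omega>) < \<infinity>)"
proof -
  from u obtain Du \<phi> where um: "u \<in> borel_measurable (lebesgue_on \<Omega>)"
    and Dm: "Du \<in> borel_measurable (lebesgue_on \<Omega>)" and wg: "weak_grad \<Omega> u Du" and Yf: "Y_norm \<Omega> u Du < \<infinity>"
    and \<phi>: "\<And>k. \<phi> k \<in> test_fun \<Omega>"
    and lim: "(\<lambda>k. Y_norm \<Omega> (\<lambda>x. \<phi> k x - u x) (\<lambda>x. grad (\<phi> k) x - Du x)) \<longlonglongrightarrow> 0"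
    unfolding Y0_def by blast
  have "Lp_norm \<Omega> 2 Du < \<infinity>" using Yf by (simp add: Y_norm_def)
  then have "(\<integral>\<^sup>+x. ennreal (norm (Du x) powr 2) \<partial>lebesgue_on \<Omega>) < \<infinity>"
    by (auto simp: Lp_norm_def epowr_def less_top[symmetric] split: if_splits)
  then have fin: "(\<integral>\<^sup>+x. ennreal ((norm (Du x))\<^sup>2) \<partial>lebesgue_on \<Omega>) < \<infinity>"
    by (simp add: powr_2_eq_square)
  note Vs = Y0_weighted_L2_approximation[OF n \<Omega> um Dm \<phi> lim fin]
  show ?thesis
    using um Dm wg fin \<phi> Y_norm_tendsto_0D(2)[OF n lim] Vs
    by (intro exI[of _ Du] exI[of _ \<phi>] conjI allI impI)
qed

text \<open>
  With \<open>\<phi> k\<close> converging to \<open>w\<close>, the four terms of the form and the right-hand side converge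
  separately, each as an inner product of square integrable functions whose second factor does not
  depend on \<open>k\<close>. For \<open>d u w\<close> the weight \<open>|d|\<close> is split evenly, the sign going to the fixed factor.
\<close>

lemma solution_tested_against_Y0:
  fixes \<Omega> :: "(real ^ 'n) set"
  assumes n: "CARD('n) \<ge> 3" and \<Omega>: "open \<Omega>" and co: "weak_type_coeffs \<Omega> A b c d"
    and f: "f \<in> Linf_c \<Omega>" and sol: "is_solution \<Omega> A b c d f u"
    and u: "u \<in> Y0 \<Omega>" and w: "w \<in> Y0 \<Omega>"
    and Du: "weak_grad \<Omega> u Du" and Dum: "Du \<in> borel_measurable (lebesgue_on \<Omega>)"
    and Dw: "weak_grad \<Omega> w Dw" and Dwm: "Dw \<in> borel_measurable (lebesgue_on \<Omega>)"
  shows "(LINT x|lebesgue_on \<Omega>. form_integrand A b c d u Du w Dw x) = (LINT x|lebesgue_on \<Omega>. f x * w x)"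
proof -
  let ?M = "lebesgue_on \<Omega>"
  have Am: "A \<in> borel_measurable ?M" and Ab: "bounded (A ` \<Omega>)"
    and bm [measurable]: "b \<in> borel_measurable ?M" and cm [measurable]: "c \<in> borel_measurable ?M"
    and dm [measurable]: "d \<in> borel_measurable ?M"
    and Vb: "weak_type (real CARD('n) / 2) (\<lambda>x. indicator \<Omega> x * (norm (b x))\<^sup>2)"
    and Vc: "weak_type (real CARD('n) / 2) (\<lambda>x. indicator \<Omega> x * (norm (c x))\<^sup>2)"
    and Vd: "weak_type (real CARD('n) / 2) (\<lambda>x. indicator \<Omega> x * \<bar>d x\<bar>)"
    using co by (auto simp: weak_type_coeffs_def)
  obtain Eu \<psi> where um [measurable]: "u \<in> borel_measurable ?M" and Eum [measurable]: "Eu \<in> borel_measurable ?M"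
    and wgu: "weak_grad \<Omega> u Eu" and Eufin: "(\<integral>\<^sup>+x. ennreal ((norm (Eu x))\<^sup>2) \<partial>?M) < \<infinity>"
    and Vu: "\<And>V. weak_type (real CARD('n) / 2) V \<Longrightarrow> (\<integral>\<^sup>+x. ennreal (V x * (u x)\<^sup>2) \<partial>?M) < \<infinity>"
    using Y0_gradient_approximation[OF n \<Omega> u] by blast
  obtain Ew \<phi> where wm [measurable]: "w \<in> borel_measurable ?M" and Ewm [measurable]: "Ew \<in> borel_measurable ?M"
    and wgw: "weak_grad \<Omega> w Ew" and Ewfin: "(\<integral>\<^sup>+x. ennreal ((norm (Ew x))\<^sup>2) \<partial>?M) < \<infinity>"
    and \<phi>: "\<And>k. \<phi> k \<in> test_fun \<Omega>"
    and Glim: "(\<lambda>k. \<integral>\<^sup>+x. ennreal ((norm (grad (\<phi> k) x - Ew x))\<^sup>2) \<partial>?M) \<longlonglongrightarrow> 0"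
    and Vlim: "\<And>V. weak_type (real CARD('n) / 2) V \<Longrightarrow>
      (\<lambda>k. \<integral>\<^sup>+x. ennreal (V x * (\<phi> k x - w x)\<^sup>2) \<partial>?M) \<longlonglongrightarrow> 0"
    and Vw: "\<And>V. weak_type (real CARD('n) / 2) V \<Longrightarrow> (\<integral>\<^sup>+x. ennreal (V x * (w x)\<^sup>2) \<partial>?M) < \<infinity>"
    using Y0_gradient_approximation[OF n \<Omega> w] by blast
  have [measurable]: "\<phi> k \<in> borel_measurable ?M" "grad (\<phi> k) \<in> borel_measurable ?M" for k
    by (intro measurable_lebesgue_on_continuous test_funD[OF \<phi>])+
  have on: "(\<integral>\<^sup>+x. ennreal (indicator \<Omega> x * V x * W x) \<partial>?M) = (\<integral>\<^sup>+x. ennreal (V x * W x) \<partial>?M)" for V W :: "real ^ 'n \<Rightarrow> real"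
    by (rule nn_integral_lebesgue_on_indicator)

  have [measurable]: "(\<lambda>x. A x *v Eu x) \<in> borel_measurable ?M"
    by (rule borel_measurable_matrix_vector_mult[OF Am Eum])
  have AEfin: "(\<integral>\<^sup>+x. ennreal ((norm (A x *v Eu x))\<^sup>2) \<partial>?M) < \<infinity>"
  proof -
    obtain B where B: "\<And>x. x \<in> \<Omega> \<Longrightarrow> norm (A x) \<le> B" "0 < B"
      using Ab by (auto simp: bounded_pos)
    define L where "L = (real CARD('n) * B)\<^sup>2"
    have "(\<integral>\<^sup>+x. ennreal ((norm (A x *v Eu x))\<^sup>2) \<partial>?M) \<le> (\<integral>\<^sup>+x. ennreal L * ennreal ((norm (Eu x))\<^sup>2) \<partial>?M)"
    proof (rule nn_integral_mono)
      fix x assume "x \<in> space ?M"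
      then have "x \<in> \<Omega>" by simp
      have "norm (A x *v Eu x) \<le> real CARD('n) * norm (A x) * norm (Eu x)" by (rule norm_matrix_vector_mult_le)
      also have "\<dots> \<le> real CARD('n) * B * norm (Eu x)"
        by (intro mult_right_mono mult_left_mono B \<open>x \<in> \<Omega>\<close>) auto
      finally have "(norm (A x *v Eu x))\<^sup>2 \<le> (real CARD('n) * B * norm (Eu x))\<^sup>2"
        by (intro power_mono) auto
      then have "ennreal ((norm (A x *v Eu x))\<^sup>2) \<le> ennreal (L * (norm (Eu x))\<^sup>2)"
        by (intro ennreal_leI) (simp add: L_def power_mult_distrib)
      also have "\<dots> = ennreal L * ennreal ((norm (Eu x))\<^sup>2)" by (rule ennreal_mult) (auto simp: L_def)
      finally show "ennreal ((norm (A x *v Eu x))\<^sup>2) \<le> ennreal L * ennreal ((norm (Eu x))\<^sup>2)" .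
    qed
    also have "\<dots> = ennreal L * (\<integral>\<^sup>+x. ennreal ((norm (Eu x))\<^sup>2) \<partial>?M)" by (rule nn_integral_cmult) measurable
    also have "\<dots> < \<infinity>" using Eufin by (simp add: ennreal_mult_less_top)
    finally show ?thesis .
  qed
  have T1: "integrable ?M (\<lambda>x. Ew x \<bullet> (A x *v Eu x))"
      "\<forall>\<^sub>F k in sequentially. integrable ?M (\<lambda>x. grad (\<phi> k) x \<bullet> (A x *v Eu x))"
      "(\<lambda>k. LINT x|?M. grad (\<phi> k) x \<bullet> (A x *v Eu x)) \<longlonglongrightarrow> (LINT x|?M. Ew x \<bullet> (A x *v Eu x))"
    by (rule L2_inner_limit[OF _ _ _ Glim Ewfin AEfin]; measurable)+

  have ubfin: "(\<integral>\<^sup>+x. ennreal ((norm (u x *\<^sub>R b x))\<^sup>2) \<partial>?M) < \<infinity>"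
    using Vu[OF Vb] unfolding on by (simp add: power_mult_distrib mult.commute)
  have T2: "integrable ?M (\<lambda>x. Ew x \<bullet> (u x *\<^sub>R b x))"
      "\<forall>\<^sub>F k in sequentially. integrable ?M (\<lambda>x. grad (\<phi> k) x \<bullet> (u x *\<^sub>R b x))"
      "(\<lambda>k. LINT x|?M. grad (\<phi> k) x \<bullet> (u x *\<^sub>R b x)) \<longlonglongrightarrow> (LINT x|?M. Ew x \<bullet> (u x *\<^sub>R b x))"
    by (rule L2_inner_limit[OF _ _ _ Glim Ewfin ubfin]; measurable)+

  have wcfin: "(\<integral>\<^sup>+x. ennreal ((norm (w x *\<^sub>R c x))\<^sup>2) \<partial>?M) < \<infinity>"
    using Vw[OF Vc] unfolding on by (simp add: power_mult_distrib mult.commute)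
  have wclim: "(\<lambda>k. \<integral>\<^sup>+x. ennreal ((norm (\<phi> k x *\<^sub>R c x - w x *\<^sub>R c x))\<^sup>2) \<partial>?M) \<longlonglongrightarrow> 0"
    using Vlim[OF Vc] unfolding on by (simp add: power_mult_distrib mult.commute flip: scaleR_diff_left)
  have T3: "integrable ?M (\<lambda>x. (w x *\<^sub>R c x) \<bullet> Eu x)"
      "\<forall>\<^sub>F k in sequentially. integrable ?M (\<lambda>x. (\<phi> k x *\<^sub>R c x) \<bullet> Eu x)"
      "(\<lambda>k. LINT x|?M. (\<phi> k x *\<^sub>R c x) \<bullet> Eu x) \<longlonglongrightarrow> (LINT x|?M. (w x *\<^sub>R c x) \<bullet> Eu x)"
    by (rule L2_inner_limit[OF _ _ _ wclim wcfin Eufin]; measurable)+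

  define \<delta> where "\<delta> x = sqrt \<bar>d x\<bar>" for x
  have \<delta>2: "(\<delta> x)\<^sup>2 = \<bar>d x\<bar>" for x by (simp add: \<delta>_def)
  have [measurable]: "\<delta> \<in> borel_measurable ?M" unfolding \<delta>_def[abs_def] by measurable
  have sgnm [measurable]: "(\<lambda>x. sgn (d x)) \<in> borel_measurable ?M" by measurable
  have wdfin: "(\<integral>\<^sup>+x. ennreal ((norm (\<delta> x * w x))\<^sup>2) \<partial>?M) < \<infinity>"
    using Vw[OF Vd] unfolding on by (simp add: power_mult_distrib \<delta>2)
  have udfin: "(\<integral>\<^sup>+x. ennreal ((norm (sgn (d x) * \<delta> x * u x))\<^sup>2) \<partial>?M) < \<infinity>"
  proof (rule le_less_trans)
    show "(\<integral>\<^sup>+x. ennreal ((norm (sgn (d x) * \<delta> x * u x))\<^sup>2) \<partial>?M) \<le> (\<integral>\<^sup>+x. ennreal (\<bar>d x\<bar> * (u x)\<^sup>2) \<partial>?M)"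
      by (intro nn_integral_mono ennreal_leI) (simp add: power_mult_distrib \<delta>2 sgn_if)
    show "(\<integral>\<^sup>+x. ennreal (\<bar>d x\<bar> * (u x)\<^sup>2) \<partial>?M) < \<infinity>" using Vu[OF Vd] unfolding on .
  qed
  have wdlim: "(\<lambda>k. \<integral>\<^sup>+x. ennreal ((norm (\<delta> x * \<phi> k x - \<delta> x * w x))\<^sup>2) \<partial>?M) \<longlonglongrightarrow> 0"
    using Vlim[OF Vd] unfolding on by (simp add: power_mult_distrib \<delta>2 flip: right_diff_distrib)
  have T4: "integrable ?M (\<lambda>x. (\<delta> x * w x) \<bullet> (sgn (d x) * \<delta> x * u x))"
      "\<forall>\<^sub>F k in sequentially. integrable ?M (\<lambda>x. (\<delta> x * \<phi> k x) \<bullet> (sgn (d x) * \<delta> x * u x))"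
      "(\<lambda>k. LINT x|?M. (\<delta> x * \<phi> k x) \<bullet> (sgn (d x) * \<delta> x * u x)) \<longlonglongrightarrow> (LINT x|?M. (\<delta> x * w x) \<bullet> (sgn (d x) * \<delta> x * u x))"
    by (rule L2_inner_limit[OF _ _ _ wdlim wdfin udfin]; measurable)+
  have \<delta>eq: "(\<delta> x * s) \<bullet> (sgn (d x) * \<delta> x * u x) = d x * u x * s" for x s
  proof -
    have "(\<delta> x * s) \<bullet> (sgn (d x) * \<delta> x * u x) = sgn (d x) * (\<delta> x)\<^sup>2 * u x * s"
      by (simp add: power2_eq_square)
    also have "sgn (d x) * (\<delta> x)\<^sup>2 = d x" by (simp add: \<delta>2 sgn_mult_abs)
    finally show ?thesis .
  qed

  obtain K where K: "compact K" "K \<subseteq> \<Omega>" "\<And>x. x \<in> \<Omega> - K \<Longrightarrow> f x = 0" and fm [measurable]: "f \<in> borel_measurable ?M"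
    and fb: "bounded (f ` \<Omega>)" using f by (auto simp: Linf_c_def)
  have Km [measurable]: "K \<in> sets ?M" using K \<Omega> by (auto simp: sets_restrict_space_iff borel_compact)
  have VK: "weak_type (real CARD('n) / 2) (indicator K :: real ^ 'n \<Rightarrow> real)"
    using K by (intro weak_type_indicator_compact) auto
  have ind: "(indicat_real K x)\<^sup>2 = indicator K x" for x by (simp add: indicator_def)
  have ffin: "(\<integral>\<^sup>+x. ennreal ((norm (f x))\<^sup>2) \<partial>?M) < \<infinity>"
  proof -
    obtain B where B: "\<And>x. x \<in> \<Omega> \<Longrightarrow> norm (f x) \<le> B" using fb by (auto simp: bounded_iff)
    have "(\<integral>\<^sup>+x. ennreal ((norm (f x))\<^sup>2) \<partial>?M) \<le> (\<integral>\<^sup>+x. ennreal (B\<^sup>2) * indicator K x \<partial>?M)"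
    proof (rule nn_integral_mono)
      fix x assume "x \<in> space ?M"
      then have x: "x \<in> \<Omega>" by simp
      show "ennreal ((norm (f x))\<^sup>2) \<le> ennreal (B\<^sup>2) * indicator K x"
      proof (cases "x \<in> K")
        case True
        have "(norm (f x))\<^sup>2 \<le> B\<^sup>2" using B[OF x] by (intro power_mono) auto
        then have "ennreal ((norm (f x))\<^sup>2) \<le> ennreal (B\<^sup>2)" by (rule ennreal_leI)
        then show ?thesis using True by simp
      next
        case False
        then have "f x = 0" using K x by auto
        then show ?thesis by simp
      qed
    qed
    also have "\<dots> = ennreal (B\<^sup>2) * emeasure ?M K" by (rule nn_integral_cmult_indicator[OF Km])
    also have "emeasure ?M K = emeasure lborel K"
      using K \<Omega> by (subst emeasure_restrict_space) (auto simp: borel_compact)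
    also have "ennreal (B\<^sup>2) * emeasure lborel K < \<infinity>"
      using emeasure_compact_finite[OF K(1)] by (simp add: ennreal_mult_less_top)
    finally show ?thesis .
  qed
  have wKfin: "(\<integral>\<^sup>+x. ennreal ((norm (indicator K x * w x))\<^sup>2) \<partial>?M) < \<infinity>"
    using Vw[OF VK] by (simp add: power_mult_distrib ind)
  have wKlim: "(\<lambda>k. \<integral>\<^sup>+x. ennreal ((norm (indicator K x * \<phi> k x - indicator K x * w x))\<^sup>2) \<partial>?M) \<longlonglongrightarrow> 0"
    using Vlim[OF VK] by (simp add: power_mult_distrib ind flip: right_diff_distrib)
  have T5: "(\<lambda>k. LINT x|?M. (indicator K x * \<phi> k x) \<bullet> f x) \<longlonglongrightarrow> (LINT x|?M. (indicator K x * w x) \<bullet> f x)"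
    by (rule L2_inner_limit(3)[OF _ _ _ wKlim wKfin ffin]; measurable)
  have Kf: "(LINT x|?M. (indicator K x * h x) \<bullet> f x) = (LINT x|?M. f x * h x)" for h :: "real ^ 'n \<Rightarrow> real"
    using K by (intro Bochner_Integration.integral_cong) (auto simp: indicator_def)

  have AEu: "AE x in ?M. Eu x = Du x" by (rule weak_grad_unique[OF \<Omega> wgu Du])
  have AEw: "AE x in ?M. Ew x = Dw x" by (rule weak_grad_unique[OF \<Omega> wgw Dw])
  \<comment> \<open>\<open>Su\<close> is the gradient chosen by the equation, \<open>Eu\<close> the one from the approximation in \<open>Y0\<close>.\<close>
  obtain Su where Su: "weak_grad \<Omega> u Su" and
    eqn: "\<And>\<psi>. \<psi> \<in> test_fun \<Omega> \<Longrightarrow> integrable ?M (form_integrand A b c d u Su \<psi> (grad \<psi>)) \<and>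
      (LINT x|?M. form_integrand A b c d u Su \<psi> (grad \<psi>) x) = (LINT x|?M. f x * \<psi> x)"
    using sol unfolding is_solution_def Let_def form_integrand_def[abs_def] by blast
  have AES: "AE x in ?M. Eu x = Su x" by (rule weak_grad_unique[OF \<Omega> wgu Su])

  have split: "form_integrand A b c d u Eu h Dh x = Dh x \<bullet> (A x *v Eu x) + Dh x \<bullet> (u x *\<^sub>R b x)
      + (h x *\<^sub>R c x) \<bullet> Eu x + (\<delta> x * h x) \<bullet> (sgn (d x) * \<delta> x * u x)" for h Dh x
    unfolding \<delta>eq by (simp add: form_integrand_def inner_commute)
  have terms: "integrable ?M (form_integrand A b c d u Eu h Dh) \<and>
      (LINT x|?M. form_integrand A b c d u Eu h Dh x) = (LINT x|?M. Dh x \<bullet> (A x *v Eu x)) + (LINT x|?M. Dh x \<bullet> (u x *\<^sub>R b x))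
      + (LINT x|?M. (h x *\<^sub>R c x) \<bullet> Eu x) + (LINT x|?M. (\<delta> x * h x) \<bullet> (sgn (d x) * \<delta> x * u x))"
    if "integrable ?M (\<lambda>x. Dh x \<bullet> (A x *v Eu x))" "integrable ?M (\<lambda>x. Dh x \<bullet> (u x *\<^sub>R b x))"
      "integrable ?M (\<lambda>x. (h x *\<^sub>R c x) \<bullet> Eu x)" "integrable ?M (\<lambda>x. (\<delta> x * h x) \<bullet> (sgn (d x) * \<delta> x * u x))" for h Dh
    unfolding split[abs_def] using that
    by (simp only: Bochner_Integration.integral_add Bochner_Integration.integrable_add simp_thms)

  let ?F = "\<lambda>k. LINT x|?M. form_integrand A b c d u Eu (\<phi> k) (grad (\<phi> k)) x"
  let ?S = "\<lambda>k. (LINT x|?M. grad (\<phi> k) x \<bullet> (A x *v Eu x)) + (LINT x|?M. grad (\<phi> k) x \<bullet> (u x *\<^sub>R b x))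
      + (LINT x|?M. (\<phi> k x *\<^sub>R c x) \<bullet> Eu x) + (LINT x|?M. (\<delta> x * \<phi> k x) \<bullet> (sgn (d x) * \<delta> x * u x))"
  have wi: "integrable ?M (form_integrand A b c d u Eu w Ew)"
    and wv: "(LINT x|?M. form_integrand A b c d u Eu w Ew x) = (LINT x|?M. Ew x \<bullet> (A x *v Eu x)) + (LINT x|?M. Ew x \<bullet> (u x *\<^sub>R b x))
      + (LINT x|?M. (w x *\<^sub>R c x) \<bullet> Eu x) + (LINT x|?M. (\<delta> x * w x) \<bullet> (sgn (d x) * \<delta> x * u x))"
    using terms[OF T1(1) T2(1) T3(1) T4(1)] by auto
  have "?S \<longlonglongrightarrow> (LINT x|?M. form_integrand A b c d u Eu w Ew x)"
    unfolding wv by (intro tendsto_add T1(3) T2(3) T3(3) T4(3))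
  moreover have "\<forall>\<^sub>F k in sequentially. ?S k = (LINT x|?M. f x * \<phi> k x)"
    using T1(2) T2(2) T3(2) T4(2)
  proof eventually_elim
    case (elim k)
    note m = terms[OF elim]
    have "(LINT x|?M. form_integrand A b c d u Eu (\<phi> k) (grad (\<phi> k)) x)
        = (LINT x|?M. form_integrand A b c d u Su (\<phi> k) (grad (\<phi> k)) x)"
    proof (rule integral_cong_AE)
      show "form_integrand A b c d u Eu (\<phi> k) (grad (\<phi> k)) \<in> borel_measurable ?M" using m by auto
      show "form_integrand A b c d u Su (\<phi> k) (grad (\<phi> k)) \<in> borel_measurable ?M" using eqn[OF \<phi>[of k]] by auto
      show "AE x in ?M. form_integrand A b c d u Eu (\<phi> k) (grad (\<phi> k)) x = form_integrand A b c d u Su (\<phi> k) (grad (\<phi> k)) x"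
        using AES by eventually_elim (simp add: form_integrand_def)
    qed
    then show ?case using m eqn[OF \<phi>[of k]] by simp
  qed
  ultimately have "(\<lambda>k. LINT x|?M. f x * \<phi> k x) \<longlonglongrightarrow> (LINT x|?M. form_integrand A b c d u Eu w Ew x)"
    by (rule Lim_transform_eventually)
  with T5[unfolded Kf] have "(LINT x|?M. f x * w x) = (LINT x|?M. form_integrand A b c d u Eu w Ew x)"
    by (rule LIMSEQ_unique)
  also have "\<dots> = (LINT x|?M. form_integrand A b c d u Du w Dw x)"
  proof (rule integral_cong_AE)
    show "form_integrand A b c d u Eu w Ew \<in> borel_measurable ?M" using wi by auto
    show "AE x in ?M. form_integrand A b c d u Eu w Ew x = form_integrand A b c d u Du w Dw x"
      using AEu AEw by eventually_elim (simp add: form_integrand_def)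
    note Dum [measurable] Dwm [measurable]
    have [measurable]: "(\<lambda>x. A x *v Du x) \<in> borel_measurable ?M"
      by (rule borel_measurable_matrix_vector_mult[OF Am Dum])
    show "form_integrand A b c d u Du w Dw \<in> borel_measurable ?M"
      unfolding form_integrand_def[abs_def] by measurable
  qed
  finally show ?thesis ..
qed

section \<open>Duality and uniqueness\<close>

lemma is_adjoint_solution_iff:
  "is_adjoint_solution \<Omega> (\<lambda>x. transpose (A x)) c b d f u \<longleftrightarrow> is_solution \<Omega> A b c d f u"
  by (simp add: is_adjoint_solution_def transpose_transpose)

lemma weak_type_coeffs_adjoint:
  assumes "weak_type_coeffs \<Omega> A b c d"
  shows "weak_type_coeffs \<Omega> (\<lambda>x. transpose (A x)) c b d"
proof -
  have cont: "continuous_on UNIV (transpose :: real ^ 'n ^ 'n \<Rightarrow> real ^ 'n ^ 'n)"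
    unfolding transpose_def by (intro continuous_on_vec_lambda continuous_intros)
  have lin: "bounded_linear (transpose :: real ^ 'n ^ 'n \<Rightarrow> real ^ 'n ^ 'n)"
    by (intro linear_conv_bounded_linear[THEN iffD1] linearI) (simp_all add: transpose_def vec_eq_iff)
  have "A \<in> borel_measurable (lebesgue_on \<Omega>)" "bounded (A ` \<Omega>)"
    using assms by (auto simp: weak_type_coeffs_def)
  then have "(\<lambda>x. transpose (A x)) \<in> borel_measurable (lebesgue_on \<Omega>)" "bounded ((\<lambda>x. transpose (A x)) ` \<Omega>)"
    using borel_measurable_continuous_on[OF cont] bounded_linear_image[OF _ lin, of "A ` \<Omega>"]
    by (auto simp: image_image)
  with assms show ?thesis by (auto simp: weak_type_coeffs_def)
qed

text \<open>
  Both sides equal the bilinear form at \<open>(u, v)\<close>.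
\<close>

lemma solution_duality:
  fixes \<Omega> :: "(real ^ 'n) set"
  assumes n: "CARD('n) \<ge> 3" and \<Omega>: "open \<Omega>" and co: "weak_type_coeffs \<Omega> A b c d"
    and f: "f \<in> Linf_c \<Omega>" and h: "h \<in> Linf_c \<Omega>"
    and u: "u \<in> Y0 \<Omega>" "is_solution \<Omega> A b c d h u"
    and v: "v \<in> Y0 \<Omega>" "is_adjoint_solution \<Omega> A b c d f v"
  shows "(LINT x|lebesgue_on \<Omega>. h x * v x) = (LINT x|lebesgue_on \<Omega>. f x * u x)"
proof -
  obtain Du where Du: "weak_grad \<Omega> u Du" "Du \<in> borel_measurable (lebesgue_on \<Omega>)"
    using u(1) by (auto simp: Y0_def)
  obtain Dv where Dv: "weak_grad \<Omega> v Dv" "Dv \<in> borel_measurable (lebesgue_on \<Omega>)"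
    using v(1) by (auto simp: Y0_def)
  have "(LINT x|lebesgue_on \<Omega>. h x * v x) = (LINT x|lebesgue_on \<Omega>. form_integrand A b c d u Du v Dv x)"
    by (rule solution_tested_against_Y0[OF n \<Omega> co h u(2,1) v(1) Du Dv, symmetric])
  also have "\<dots> = (LINT x|lebesgue_on \<Omega>. form_integrand (\<lambda>x. transpose (A x)) c b d v Dv u Du x)"
    by (simp only: form_integrand_adjoint)
  also have "\<dots> = (LINT x|lebesgue_on \<Omega>. f x * u x)"
    by (rule solution_tested_against_Y0[OF n \<Omega> weak_type_coeffs_adjoint[OF co] f
          v(2)[unfolded is_adjoint_solution_def] v(1) u(1) Dv Du])
  finally show ?thesis .
qed

lemma indicator_rat_box_Linf_c:
  assumes "B \<in> rat_boxes" "closure B \<subseteq> \<Omega>" "open \<Omega>"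
  shows "indicator B \<in> Linf_c (\<Omega> :: (real ^ 'n) set)"
proof -
  have B: "bounded B" "open B" using assms by (auto simp: rat_boxes_def bounded_box)
  have "B \<subseteq> \<Omega>" using assms closure_subset by blast
  then have "B \<in> sets (lebesgue_on \<Omega>)" using B assms by (auto simp: sets_restrict_space_iff)
  then have "indicat_real B \<in> borel_measurable (lebesgue_on \<Omega>)" by (rule borel_measurable_indicator)
  moreover have "bounded (indicat_real B ` \<Omega>)"
    by (rule boundedI[of _ 1]) (auto simp: indicator_def)
  moreover have "compact (closure B)" using B by simp
  moreover have "\<forall>x\<in>\<Omega> - closure B. indicat_real B x = 0"
    using closure_subset[of B] by (auto simp: indicator_def)
  ultimately show ?thesis using assms(2) unfolding Linf_c_def by blast
qed

lemma L1_loc_integrable_rat_box: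
  fixes f :: "real ^ 'n \<Rightarrow> real"
  assumes f: "f \<in> L1_loc \<Omega>" and B: "B \<in> rat_boxes" "closure B \<subseteq> \<Omega>" and \<Omega>: "open \<Omega>"
  shows "integrable (lebesgue_on \<Omega>) (\<lambda>x. f x * indicator B x)"
proof -
  have b: "bounded B" "open B" using B by (auto simp: rat_boxes_def bounded_box)
  have i: "integrable (lebesgue_on \<Omega>) (\<lambda>x. indicator (closure B) x *\<^sub>R f x)"
    using b by (intro L1_loc_integrable_indicator f B \<Omega>) simp
  have "B \<subseteq> \<Omega>" using B closure_subset by blast
  then have "B \<in> sets (lebesgue_on \<Omega>)" using b \<Omega> by (auto simp: sets_restrict_space_iff)
  from integrable_mult_indicator[OF this i]
  have "integrable (lebesgue_on \<Omega>) (\<lambda>x. indicator B x *\<^sub>R (indicator (closure B) x *\<^sub>R f x))" .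
  moreover have "indicator B x *\<^sub>R (indicator (closure B) x *\<^sub>R f x) = f x * indicator B x" for x
    using closure_subset[of B] by (auto simp: indicator_def)
  ultimately show ?thesis by (simp only:)
qed

lemma adjoint_solution_unique:
  fixes \<Omega> :: "(real ^ 'n) set"
  assumes n: "CARD('n) \<ge> 3" and \<Omega>: "open \<Omega>" and co: "weak_type_coeffs \<Omega> A b c d"
    and solvable: "\<And>h. h \<in> Linf_c \<Omega> \<Longrightarrow> \<exists>u\<in>Y0 \<Omega>. is_solution \<Omega> A b c d h u"
    and f: "f \<in> Linf_c \<Omega>"
    and v: "v \<in> Y0 \<Omega>" "is_adjoint_solution \<Omega> A b c d f v"
    and w: "w \<in> Y0 \<Omega>" "is_adjoint_solution \<Omega> A b c d f w"
  shows "AE x in lebesgue_on \<Omega>. v x = w x"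
proof -
  have loc: "v \<in> L1_loc \<Omega>" "w \<in> L1_loc \<Omega>" using v w by (auto simp: Y0_def weak_grad_def)
  have "AE x in lebesgue_on \<Omega>. v x - w x = 0"
  proof (rule AE_zero_if_box_integrals_zero[OF \<Omega>])
    show "(\<lambda>x. v x - w x) \<in> L1_loc \<Omega>"
      using loc by (auto simp: L1_loc_def intro!: Bochner_Integration.integrable_diff)
    fix B :: "(real ^ 'n) set" assume B: "B \<in> rat_boxes" "closure B \<subseteq> \<Omega>"
    have h: "indicat_real B \<in> Linf_c \<Omega>" by (rule indicator_rat_box_Linf_c[OF B \<Omega>])
    then obtain u where u: "u \<in> Y0 \<Omega>" "is_solution \<Omega> A b c d (indicator B) u"
      using solvable by blast
    have eq: "(LINT x|lebesgue_on \<Omega>. v x * indicator B x) = (LINT x|lebesgue_on \<Omega>. w x * indicator B x)"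
      using solution_duality[OF n \<Omega> co f h u v] solution_duality[OF n \<Omega> co f h u w]
      by (simp add: mult.commute)
    show "(LINT x|lebesgue_on \<Omega>. (v x - w x) * indicator B x) = 0"
      using eq L1_loc_integrable_rat_box[OF loc(1) B \<Omega>] L1_loc_integrable_rat_box[OF loc(2) B \<Omega>]
      by (simp add: left_diff_distrib)
  qed
  then show ?thesis by simp
qed

text \<open>
  For each right-hand side the potentials agree outside a null set of \<open>y\<close>. Only countably many
  right-hand sides, the indicators of rational boxes, are needed to recover \<open>K(\<cdot>, y)\<close> and \<open>L(\<cdot>, y)\<close>.
\<close>

lemma kernel_unique:
  fixes \<Omega> :: "(real ^ 'n) set"
  assumes n: "CARD('n) \<ge> 3" and \<Omega>: "open \<Omega>" and co: "weak_type_coeffs \<Omega> A b c d"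
    and solvable: "\<And>h. h \<in> Linf_c \<Omega> \<Longrightarrow> \<exists>u\<in>Y0 \<Omega>. is_solution \<Omega> A b c d h u"
    and K: "AE y in lebesgue_on \<Omega>. (\<lambda>z. K z y) \<in> L1_loc \<Omega>"
      "\<And>f. f \<in> Linf_c \<Omega> \<Longrightarrow> potential \<Omega> K f \<in> Y0 \<Omega> \<and> is_adjoint_solution \<Omega> A b c d f (potential \<Omega> K f)"
    and L: "AE y in lebesgue_on \<Omega>. (\<lambda>z. L z y) \<in> L1_loc \<Omega>"
      "\<And>f. f \<in> Linf_c \<Omega> \<Longrightarrow> potential \<Omega> L f \<in> Y0 \<Omega> \<and> is_adjoint_solution \<Omega> A b c d f (potential \<Omega> L f)"
  shows "AE y in lebesgue_on \<Omega>. AE z in lebesgue_on \<Omega>. K z y = L z y"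
proof -
  let ?F = "{B :: (real ^ 'n) set. B \<in> rat_boxes \<and> closure B \<subseteq> \<Omega>}"
  have "countable ?F" using countable_rat_boxes by (rule countable_subset[rotated]) auto
  then have "AE y in lebesgue_on \<Omega>. \<forall>B\<in>?F. potential \<Omega> K (indicator B) y = potential \<Omega> L (indicator B) y"
  proof (subst AE_ball_countable, safe)
    fix B :: "(real ^ 'n) set" assume "B \<in> rat_boxes" "closure B \<subseteq> \<Omega>"
    then have f: "indicat_real B \<in> Linf_c \<Omega>" by (rule indicator_rat_box_Linf_c[OF _ _ \<Omega>])
    show "AE y in lebesgue_on \<Omega>. potential \<Omega> K (indicator B) y = potential \<Omega> L (indicator B) y"
      using K(2)[OF f] L(2)[OF f] by (intro adjoint_solution_unique[OF n \<Omega> co solvable f]) auto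
  qed
  with K(1) L(1) show ?thesis
  proof eventually_elim
    case (elim y)
    have "AE z in lebesgue_on \<Omega>. K z y - L z y = 0"
    proof (rule AE_zero_if_box_integrals_zero[OF \<Omega>])
      show "(\<lambda>z. K z y - L z y) \<in> L1_loc \<Omega>"
        using elim(1,2) by (auto simp: L1_loc_def intro!: Bochner_Integration.integrable_diff)
      fix B :: "(real ^ 'n) set" assume B: "B \<in> rat_boxes" "closure B \<subseteq> \<Omega>"
      then have "potential \<Omega> K (indicator B) y = potential \<Omega> L (indicator B) y" using elim(3) by blast
      then show "(LINT z|lebesgue_on \<Omega>. (K z y - L z y) * indicator B z) = 0"
        using L1_loc_integrable_rat_box[OF elim(1) B \<Omega>] L1_loc_integrable_rat_box[OF elim(2) B \<Omega>]
        by (simp add: left_diff_distrib potential_def)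
    qed
    then show ?case by simp
  qed
qed

lemma weak_type_coeffs_Lorentz:
  fixes \<Omega> :: "(real ^ 'n) set"
  assumes \<Omega>: "open \<Omega>" and A: "A \<in> borel_measurable (lebesgue_on \<Omega>)" "bounded (A ` \<Omega>)" and q: "1 \<le> q"
    and b: "b \<in> Lorentz \<Omega> (real CARD('n)) q" and c: "c \<in> Lorentz \<Omega> (real CARD('n)) q"
    and d: "d \<in> weak_Lorentz \<Omega> (real CARD('n) / 2)"
  shows "weak_type_coeffs \<Omega> A b c d"
proof -
  have m: "b \<in> borel_measurable (lebesgue_on \<Omega>)" "c \<in> borel_measurable (lebesgue_on \<Omega>)" "d \<in> borel_measurable (lebesgue_on \<Omega>)"
    using b c d by (auto simp: Lorentz_def weak_Lorentz_def)
  have q0: "0 < q" using q by simp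
  have n0: "0 < real CARD('n)" "0 < real CARD('n) / 2" by simp_all
  have "weak_type (real CARD('n) / 2) (\<lambda>x. indicator \<Omega> x * norm (b x) powr 2)"
    by (rule weak_type_from_distr_bound[OF \<Omega> m(1) _ Lorentz_distr_bound[OF n0(1) q0 b]]) simp
  moreover have "weak_type (real CARD('n) / 2) (\<lambda>x. indicator \<Omega> x * norm (c x) powr 2)"
    by (rule weak_type_from_distr_bound[OF \<Omega> m(2) _ Lorentz_distr_bound[OF n0(1) q0 c]]) simp
  moreover have "weak_type (real CARD('n) / 2 / 1) (\<lambda>x. indicator \<Omega> x * norm (d x) powr 1)"
    by (rule weak_type_from_distr_bound[OF \<Omega> m(3) _ weak_Lorentz_distr_bound[OF n0(2) d]]) simp
  ultimately show ?thesis
    using A m by (simp add: weak_type_coeffs_def powr_2_eq_square)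
qed

theorem proposition5p6:
  fixes \<Omega> :: "(real ^ 'n::finite) set"
    and A :: "real ^ 'n \<Rightarrow> real ^ 'n ^ 'n"
    and b c :: "real ^ 'n \<Rightarrow> real ^ 'n"
    and d :: "real ^ 'n \<Rightarrow> real"
    and lam q :: real
    and G g :: "real ^ 'n \<Rightarrow> real ^ 'n \<Rightarrow> real"
  assumes "CARD('n) \<ge> 3"
    and "open \<Omega>" and "connected \<Omega>"
    and "A \<in> borel_measurable (lebesgue_on \<Omega>)"
    and "bounded (A ` \<Omega>)"
    and "uniformly_elliptic \<Omega> lam A"
    and "1 \<le> q"
    and "b \<in> Lorentz \<Omega> (real CARD('n)) q"
    and "c \<in> Lorentz \<Omega> (real CARD('n)) q"
    and "d \<in> weak_Lorentz \<Omega> (real CARD('n) / 2)"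
    and "(\<lambda>x. b x - c x) \<in> Lorentz \<Omega> (real CARD('n)) 1"
    and "ge_div \<Omega> d b"
    and "constructed_green \<Omega> A b c d G g"
  shows
    "(\<forall>Gs :: real ^ 'n \<Rightarrow> real ^ 'n \<Rightarrow> real.
        (AE y in lebesgue_on \<Omega>. (\<lambda>z. Gs z y) \<in> L1_loc \<Omega>) \<and>
        (\<forall>f\<in>Linf_c \<Omega>. potential \<Omega> Gs f \<in> Y0 \<Omega> \<and>
           is_adjoint_solution \<Omega> A b c d f (potential \<Omega> Gs f))
        \<longrightarrow> (AE y in lebesgue_on \<Omega>. AE z in lebesgue_on \<Omega>. Gs z y = G z y)) \<and>
     (\<forall>gs :: real ^ 'n \<Rightarrow> real ^ 'n \<Rightarrow> real.
        (AE x in lebesgue_on \<Omega>. (\<lambda>z. gs z x) \<in> L1_loc \<Omega>) \<and>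
        (\<forall>f\<in>Linf_c \<Omega>. potential \<Omega> gs f \<in> Y0 \<Omega> \<and>
           is_solution \<Omega> A b c d f (potential \<Omega> gs f))
        \<longrightarrow> (AE x in lebesgue_on \<Omega>. AE z in lebesgue_on \<Omega>. gs z x = g z x))"
proof -
  note n = \<open>CARD('n) \<ge> 3\<close> and \<Omega> = \<open>open \<Omega>\<close>
  have co: "weak_type_coeffs \<Omega> A b c d" by (rule weak_type_coeffs_Lorentz) fact+
  have G: "AE y in lebesgue_on \<Omega>. (\<lambda>z. G z y) \<in> L1_loc \<Omega>"
      "\<And>f. f \<in> Linf_c \<Omega> \<Longrightarrow> potential \<Omega> G f \<in> Y0 \<Omega> \<and> is_adjoint_solution \<Omega> A b c d f (potential \<Omega> G f)"
    and g: "AE x in lebesgue_on \<Omega>. (\<lambda>z. g z x) \<in> L1_loc \<Omega>"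
      "\<And>f. f \<in> Linf_c \<Omega> \<Longrightarrow> potential \<Omega> g f \<in> Y0 \<Omega> \<and> is_solution \<Omega> A b c d f (potential \<Omega> g f)"
    using \<open>constructed_green \<Omega> A b c d G g\<close> unfolding constructed_green_def green_bounds_def
    by (auto intro!: AE_I2)
  show ?thesis
  proof (intro conjI allI impI; elim conjE)
    fix Gs :: "real ^ 'n \<Rightarrow> real ^ 'n \<Rightarrow> real"
    assume "AE y in lebesgue_on \<Omega>. (\<lambda>z. Gs z y) \<in> L1_loc \<Omega>"
      and "\<forall>f\<in>Linf_c \<Omega>. potential \<Omega> Gs f \<in> Y0 \<Omega> \<and> is_adjoint_solution \<Omega> A b c d f (potential \<Omega> Gs f)"
    then show "AE y in lebesgue_on \<Omega>. AE z in lebesgue_on \<Omega>. Gs z y = G z y"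
      using g(2) G by (intro kernel_unique[OF n \<Omega> co]) blast+
  next
    fix gs :: "real ^ 'n \<Rightarrow> real ^ 'n \<Rightarrow> real"
    assume "AE x in lebesgue_on \<Omega>. (\<lambda>z. gs z x) \<in> L1_loc \<Omega>"
      and "\<forall>f\<in>Linf_c \<Omega>. potential \<Omega> gs f \<in> Y0 \<Omega> \<and> is_solution \<Omega> A b c d f (potential \<Omega> gs f)"
    then show "AE x in lebesgue_on \<Omega>. AE z in lebesgue_on \<Omega>. gs z x = g z x"
      using G(2) g unfolding is_adjoint_solution_def
      by (intro kernel_unique[OF n \<Omega> weak_type_coeffs_adjoint[OF co]]) (unfold is_adjoint_solution_iff, blast+)
  qed
qed

end
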